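(* Let $G$ be a Lie group. (i) Let $(X,\omega,\Phi)$ be a Hamiltonian $G$-space, and suppose the $G$-action on $C=\Phi^{-1}(0)$ (with its subset diffeology) is strict. Then $X/\!\!/G$ carries a reduced $2$-form. (ii) Let $(\tilde X,\varpi)$ be a prequantum $G$-space with moment map $\Phi$, and suppose the $G$-action on $C=\Phi^{-1}(0)$ (with its subset diffeology) is strict. Then $\tilde X/\!\!/G$ carries a reduced $1$-form.
   Context: Diffeology: notions (plot, smooth map, induction, subduction, subset, product and quotient diffeology) are those of Souriau and Iglesias-Zemmour. A differential form $\alpha$ on a diffeological space assigns to each plot $P:U\to X$ an ordinary form $P^*\alpha$ on $U$, with $(P\circ f)^*\alpha=f^*(P^*\alpha)$ for all smooth $f:V\to U$ between open subsets of Euclidean spaces; forms are pulled back by smooth maps in the obvious way. Strict action: let a diffeological group $G$ act smoothly on a diffeological space $C$, and let $\theta:G\times C\to C\times C$, $\theta(g,x)=(x,g(x))$. Let $\sim$ be the relation "equal value under $\theta$" on $G\times C$, and $\dot\theta:(G\times C)/{\sim}\to\theta(G\times C)$ the resulting bijection, where the source has the quotient diffeology and $\theta(G\times C)$ the subset diffeology of $C\times C$. The action is strict if $\dot\theta$ is a diffeomorphism. Hamiltonian $G$-space: a triple $(X,\omega,\Phi)$ with $X$ a manifold on which $G$ acts smoothly, $\omega$ a $G$-invariant symplectic form, and $\Phi:X\to\mathfrak g^*$ an $\mathrm{Ad}^*$-equivariant moment map: $\mathrm i_{Z_X}\omega=-d\langle\Phi(\cdot),Z\rangle$, where $Z_X(x)=\frac{d}{dt}e^{tZ}(x)|_{t=0}$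 for $Z\in\mathfrak g$. Prequantum $G$-space: a pair $(\tilde X,\varpi)$ of a manifold $\tilde X$ on which $G$ acts smoothly and a $G$-invariant contact $1$-form $\varpi$ whose Reeb vector field generates a free action of the circle group $\mathbf T=\mathrm U_1$. Its moment map $\Phi:\tilde X\to\mathfrak g^*$ is $\langle\Phi(\tilde x),Z\rangle=\varpi(Z_{\tilde X}(\tilde x))$. Reduced space: $X/\!\!/G:=\Phi^{-1}(0)/G$ (resp. $\tilde X/\!\!/G:=\Phi^{-1}(0)/G$) with the subquotient diffeology (subset diffeology on $\Phi^{-1}(0)$, then quotient diffeology). Let $j$ be the inclusion of $\Phi^{-1}(0)$ and $\pi$ its projection onto the reduced space. $X/\!\!/G$ carries a reduced $2$-form if there is a diffeological $2$-form $\omega_{X/\!\!/G}$ on it with $j^*\omega=\pi^*\omega_{X/\!\!/G}$; $\tilde X/\!\!/G$ carries a reduced $1$-form if there is a diffeological $1$-form $\varpi_{\tilde X/\!\!/G}$ on it with $j^*\varpi=\pi^*\varpi_{\tilde X/\!\!/G}$. *)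

theory Defs
  imports "HOL-Analysis.Analysis" "HOL-Algebra.Group_Action"
begin

section \<open>Smooth functions on open subsets of Euclidean spaces\<close>

text \<open>Plots of a diffeology have domains in \<open>\<real>\<^sup>n\<close> for all \<open>n\<close> at once, so the dimension cannot be
  a type. As in the library, \<open>\<real>\<^sup>n\<close> is the subspace \<^term>\<open>topspace (Euclidean_space n)\<close> of
  \<^typ>\<open>nat \<Rightarrow> real\<close>: the sequences vanishing from index \<open>n\<close> on.\<close>

type_synonym vec = "nat \<Rightarrow> real"

abbreviation Rn :: "nat \<Rightarrow> vec set" where
  "Rn n \<equiv> topspace (Euclidean_space n)"

abbreviation open_Rn :: "nat \<Rightarrow> vec set \<Rightarrow> bool" where
  "open_Rn n U \<equiv> openin (Euclidean_space n) U"

definition partial_deriv :: "nat \<Rightarrow> (vec \<Rightarrow> real) \<Rightarrow> vec \<Rightarrow> real" where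
  "partial_deriv i f u = deriv (\<lambda>t. f (u(i := t))) (u i)"

definition dir_deriv :: "(vec \<Rightarrow> real) \<Rightarrow> vec \<Rightarrow> vec \<Rightarrow> real" where
  "dir_deriv f u v = deriv (\<lambda>t. f (\<lambda>i. u i + t * v i)) 0"

text \<open>Class \<open>C\<^sup>k\<close>: the partial derivatives up to order \<open>k\<close> exist and are continuous on the open
  set \<open>U\<close> of \<open>\<real>\<^sup>n\<close>.\<close>

primrec Ck :: "nat \<Rightarrow> nat \<Rightarrow> vec set \<Rightarrow> (vec \<Rightarrow> real) \<Rightarrow> bool" where
  "Ck 0 n U f \<longleftrightarrow> continuous_on U f"
| "Ck (Suc k) n U f \<longleftrightarrow> continuous_on U f \<and>
     (\<forall>i<n. (\<forall>u\<in>U. (\<lambda>t. f (u(i := t))) differentiable (at (u i))) \<and> Ck k n U (partial_deriv i f))"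

definition smooth_fun :: "nat \<Rightarrow> vec set \<Rightarrow> (vec \<Rightarrow> real) \<Rightarrow> bool" where
  "smooth_fun n U f \<longleftrightarrow> (\<forall>k. Ck k n U f)"

definition smooth_map :: "nat \<Rightarrow> vec set \<Rightarrow> nat \<Rightarrow> vec set \<Rightarrow> (vec \<Rightarrow> vec) \<Rightarrow> bool" where
  "smooth_map m V n U f \<longleftrightarrow> f ` V \<subseteq> U \<and> (\<forall>j<n. smooth_fun m V (\<lambda>v. f v j))"

definition jacobian :: "(vec \<Rightarrow> vec) \<Rightarrow> vec \<Rightarrow> vec \<Rightarrow> vec" where
  "jacobian f v w = (\<lambda>j. dir_deriv (\<lambda>x. f x j) v w)"


section \<open>Diffeological spaces\<close>

text \<open>\<open>plot X n U P\<close>: the restriction of \<open>P\<close> to the open set \<open>U\<close> of \<open>\<real>\<^sup>n\<close> is a plot of \<open>X\<close>.\<close>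

record 'a diffspace = "'a partial_object" +
  plot :: "nat \<Rightarrow> vec set \<Rightarrow> (vec \<Rightarrow> 'a) \<Rightarrow> bool"

text \<open>The three axioms covering, locality and smooth compatibility. Stating the last one for any
  \<open>Q\<close> that agrees with \<open>P \<circ> f\<close> on \<open>V\<close> also says that only the values of a plot on its domain
  matter.\<close>

definition diffeological_space :: "'a diffspace \<Rightarrow> bool" where
  "diffeological_space X \<longleftrightarrow>
     (\<forall>n U P. plot X n U P \<longrightarrow> open_Rn n U \<and> P ` U \<subseteq> carrier X) \<and>
     (\<forall>n U x. open_Rn n U \<and> x \<in> carrier X \<longrightarrow> plot X n U (\<lambda>_. x)) \<and>
     (\<forall>n U P. open_Rn n U \<and> (\<forall>u\<in>U. \<exists>V. u \<in> V \<and> V \<subseteq> U \<and> plot X n V P) \<longrightarrow> plot X n U P) \<and>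
     (\<forall>n U P m V f Q. plot X n U P \<and> open_Rn m V \<and> smooth_map m V n U f \<and>
        (\<forall>v\<in>V. Q v = P (f v)) \<longrightarrow> plot X m V Q)"

definition dsmooth :: "'a diffspace \<Rightarrow> 'b diffspace \<Rightarrow> ('a \<Rightarrow> 'b) \<Rightarrow> bool" where
  "dsmooth X Y f \<longleftrightarrow> f ` carrier X \<subseteq> carrier Y \<and>
     (\<forall>n U P. plot X n U P \<longrightarrow> plot Y n U (\<lambda>u. f (P u)))"

definition diffeomorphism :: "'a diffspace \<Rightarrow> 'b diffspace \<Rightarrow> ('a \<Rightarrow> 'b) \<Rightarrow> bool" where
  "diffeomorphism X Y f \<longleftrightarrow> bij_betw f (carrier X) (carrier Y) \<and>
     dsmooth X Y f \<and> dsmooth Y X (inv_into (carrier X) f)"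

definition sub_diff :: "'a diffspace \<Rightarrow> 'a set \<Rightarrow> 'a diffspace" where
  "sub_diff X A = \<lparr>carrier = carrier X \<inter> A, plot = (\<lambda>n U P. plot X n U P \<and> P ` U \<subseteq> A)\<rparr>"

definition prod_diff :: "'a diffspace \<Rightarrow> 'b diffspace \<Rightarrow> ('a \<times> 'b) diffspace" where
  "prod_diff X Y = \<lparr>carrier = carrier X \<times> carrier Y,
     plot = (\<lambda>n U P. plot X n U (\<lambda>u. fst (P u)) \<and> plot Y n U (\<lambda>u. snd (P u)))\<rparr>"

text \<open>Quotient diffeology by an equivalence relation \<open>R\<close> on the carrier: plots are the maps that
  lift locally to plots of \<open>X\<close>.\<close>

definition quot_diff :: "'a diffspace \<Rightarrow> ('a \<times> 'a) set \<Rightarrow> 'a set diffspace" where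
  "quot_diff X R = \<lparr>carrier = carrier X // R,
     plot = (\<lambda>n U P. open_Rn n U \<and>
       (\<forall>u\<in>U. \<exists>V Q. u \<in> V \<and> V \<subseteq> U \<and> plot X n V Q \<and> (\<forall>v\<in>V. P v = R `` {Q v})))\<rparr>"


section \<open>Manifolds and Lie groups\<close>

definition D_open :: "'a diffspace \<Rightarrow> 'a set \<Rightarrow> bool" where
  "D_open X A \<longleftrightarrow> A \<subseteq> carrier X \<and> (\<forall>n U P. plot X n U P \<longrightarrow> open_Rn n {u \<in> U. P u \<in> A})"

definition D_topology :: "'a diffspace \<Rightarrow> 'a topology" where
  "D_topology X = topology (D_open X)"

lemma istopology_D_open: "istopology (D_open X)"
  unfolding istopology_def
proof (intro conjI allI impI)
  fix S T assume "D_open X S" "D_open X T"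
  moreover have "{u \<in> U. P u \<in> S \<inter> T} = {u \<in> U. P u \<in> S} \<inter> {u \<in> U. P u \<in> T}" for U and P :: "vec \<Rightarrow> 'a"
    by auto
  ultimately show "D_open X (S \<inter> T)"
    by (auto simp: D_open_def)
next
  fix K assume "\<forall>S\<in>K. D_open X S"
  moreover have "{u \<in> U. P u \<in> \<Union> K} = (\<Union>S\<in>K. {u \<in> U. P u \<in> S})" for U and P :: "vec \<Rightarrow> 'a"
    by auto
  ultimately show "D_open X (\<Union> K)"
    by (auto simp: D_open_def)
qed

lemma openin_D_topology: "openin (D_topology X) = D_open X"
  by (simp add: D_topology_def istopology_D_open)

text \<open>Charts are parametrized from the model space: diffeomorphisms from an open set \<open>U\<close> of \<open>\<real>\<^sup>n\<close>
  onto a D-open subset of \<open>X\<close>.\<close>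

definition chart :: "'a diffspace \<Rightarrow> nat \<Rightarrow> vec set \<Rightarrow> (vec \<Rightarrow> 'a) \<Rightarrow> bool" where
  "chart X n U F \<longleftrightarrow> plot X n U F \<and> inj_on F U \<and> D_open X (F ` U) \<and>
     (\<forall>m V P. plot X m V P \<and> P ` V \<subseteq> F ` U \<longrightarrow> smooth_map m V n U (\<lambda>v. inv_into U F (P v)))"

definition manifold :: "nat \<Rightarrow> 'a diffspace \<Rightarrow> bool" where
  "manifold n X \<longleftrightarrow> diffeological_space X \<and> Hausdorff_space (D_topology X) \<and>
     second_countable (D_topology X) \<and> (\<forall>x\<in>carrier X. \<exists>U F. chart X n U F \<and> x \<in> F ` U)"

definition lie_group :: "('g, 'b) monoid_scheme \<Rightarrow> 'g diffspace \<Rightarrow> bool" where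
  "lie_group G DG \<longleftrightarrow> group G \<and> carrier DG = carrier G \<and> (\<exists>n. manifold n DG) \<and>
     dsmooth (prod_diff DG DG) DG (\<lambda>(g, h). g \<otimes>\<^bsub>G\<^esub> h) \<and> dsmooth DG DG (\<lambda>g. inv\<^bsub>G\<^esub> g)"

definition smooth_action ::
    "('g, 'b) monoid_scheme \<Rightarrow> 'g diffspace \<Rightarrow> 'x diffspace \<Rightarrow> ('g \<Rightarrow> 'x \<Rightarrow> 'x) \<Rightarrow> bool" where
  "smooth_action G DG X \<phi> \<longleftrightarrow> group_action G (carrier X) \<phi> \<and>
     dsmooth (prod_diff DG X) X (\<lambda>(g, x). \<phi> g x)"

text \<open>The induced bijection sends a class of the kernel relation of \<open>\<theta>\<close> to the common value of
  \<open>\<theta>\<close> on it.\<close>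

definition strict_action :: "'g diffspace \<Rightarrow> 'x diffspace \<Rightarrow> ('g \<Rightarrow> 'x \<Rightarrow> 'x) \<Rightarrow> bool" where
  "strict_action DG C \<phi> \<longleftrightarrow>
     (let GC = prod_diff DG C;
          \<theta> = (\<lambda>(g, x). (x, \<phi> g x));
          R = {(p, q). p \<in> carrier GC \<and> q \<in> carrier GC \<and> \<theta> p = \<theta> q}
      in diffeomorphism (quot_diff GC R) (sub_diff (prod_diff C C) (\<theta> ` carrier GC))
           (\<lambda>A. the_elem (\<theta> ` A)))"


section \<open>Tangent vectors and the Lie algebra\<close>

text \<open>Tangent vectors are derivations at \<open>x\<close> of the smooth functions defined near \<open>x\<close>. As functions
  are total in HOL, a derivation is normalized to vanish on functions that are not smooth near
  \<open>x\<close>; linear operations on tangent vectors are then pointwise.\<close>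

type_synonym 'a tvec = "('a \<Rightarrow> real) \<Rightarrow> real"

definition smooth_real_on :: "'a diffspace \<Rightarrow> 'a set \<Rightarrow> ('a \<Rightarrow> real) \<Rightarrow> bool" where
  "smooth_real_on X A f \<longleftrightarrow>
     (\<forall>n U P. plot X n U P \<and> P ` U \<subseteq> A \<longrightarrow> smooth_fun n U (\<lambda>u. f (P u)))"

definition smooth_near :: "'a diffspace \<Rightarrow> 'a \<Rightarrow> ('a \<Rightarrow> real) \<Rightarrow> bool" where
  "smooth_near X x f \<longleftrightarrow> (\<exists>A. openin (D_topology X) A \<and> x \<in> A \<and> smooth_real_on X A f)"

definition tangent_space :: "'a diffspace \<Rightarrow> 'a \<Rightarrow> 'a tvec set" where
  "tangent_space X x = {v.
     (\<forall>f. \<not> smooth_near X x f \<longrightarrow> v f = 0) \<and>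
     (\<forall>f g. smooth_near X x f \<and> smooth_near X x g \<and>
        (\<exists>A. openin (D_topology X) A \<and> x \<in> A \<and> (\<forall>y\<in>A. f y = g y)) \<longrightarrow> v f = v g) \<and>
     (\<forall>f g a b. smooth_near X x f \<and> smooth_near X x g \<longrightarrow>
        v (\<lambda>y. a * f y + b * g y) = a * v f + b * v g \<and>
        v (\<lambda>y. f y * g y) = f x * v g + v f * g x)}"

definition velocity :: "'a diffspace \<Rightarrow> (real \<Rightarrow> 'a) \<Rightarrow> 'a tvec" where
  "velocity X c = (\<lambda>f. if smooth_near X (c 0) f then deriv (\<lambda>t. f (c t)) 0 else 0)"

definition lie_algebra :: "('g, 'b) monoid_scheme \<Rightarrow> 'g diffspace \<Rightarrow> 'g tvec set" where
  "lie_algebra G DG = tangent_space DG \<one>\<^bsub>G\<^esub>"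

definition one_param_subgroup ::
    "('g, 'b) monoid_scheme \<Rightarrow> 'g diffspace \<Rightarrow> (real \<Rightarrow> 'g) \<Rightarrow> bool" where
  "one_param_subgroup G DG \<gamma> \<longleftrightarrow> plot DG 1 (Rn 1) (\<lambda>u. \<gamma> (u 0)) \<and>
     (\<forall>s t. \<gamma> (s + t) = \<gamma> s \<otimes>\<^bsub>G\<^esub> \<gamma> t)"

text \<open>The curve \<open>t \<mapsto> e\<^sup>t\<^sup>Z\<close>: in a Lie group there is exactly one one-parameter subgroup with
  velocity \<open>Z\<close> at \<open>0\<close>.\<close>

definition exp_curve ::
    "('g, 'b) monoid_scheme \<Rightarrow> 'g diffspace \<Rightarrow> 'g tvec \<Rightarrow> real \<Rightarrow> 'g" where
  "exp_curve G DG Z = (SOME \<gamma>. one_param_subgroup G DG \<gamma> \<and> velocity DG \<gamma> = Z)"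

text \<open>\<open>Ad\<^sub>g\<close> is the tangent map at the unit of the conjugation by \<open>g\<close>.\<close>

definition Ad ::
    "('g, 'b) monoid_scheme \<Rightarrow> 'g diffspace \<Rightarrow> 'g \<Rightarrow> 'g tvec \<Rightarrow> 'g tvec" where
  "Ad G DG g Z = (\<lambda>f. if smooth_near DG \<one>\<^bsub>G\<^esub> f
     then Z (\<lambda>h. f (g \<otimes>\<^bsub>G\<^esub> h \<otimes>\<^bsub>G\<^esub> inv\<^bsub>G\<^esub> g)) else 0)"

definition fundamental_field :: "('g, 'b) monoid_scheme \<Rightarrow> 'g diffspace \<Rightarrow> 'x diffspace \<Rightarrow>
    ('g \<Rightarrow> 'x \<Rightarrow> 'x) \<Rightarrow> 'g tvec \<Rightarrow> 'x \<Rightarrow> 'x tvec" where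
  "fundamental_field G DG X \<phi> Z x = velocity X (\<lambda>t. \<phi> (exp_curve G DG Z t) x)"


section \<open>Differential forms\<close>

text \<open>\<open>\<beta> u [v\<^sub>1, \<dots>, v\<^sub>k]\<close> is the value at \<open>u\<close> of an ordinary \<open>k\<close>-form on \<open>U \<subseteq> \<real>\<^sup>n\<close>; only tuples of \<open>k\<close>
  vectors of \<open>\<real>\<^sup>n\<close> matter.\<close>

definition tuples :: "nat \<Rightarrow> nat \<Rightarrow> vec list set" where
  "tuples k n = {vs. length vs = k \<and> set vs \<subseteq> Rn n}"

definition ordinary_form ::
    "nat \<Rightarrow> nat \<Rightarrow> vec set \<Rightarrow> (vec \<Rightarrow> vec list \<Rightarrow> real) \<Rightarrow> bool" where
  "ordinary_form k n U \<beta> \<longleftrightarrow>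
     (\<forall>vs\<in>tuples k n. smooth_fun n U (\<lambda>u. \<beta> u vs)) \<and>
     (\<forall>u\<in>U. \<forall>vs\<in>tuples k n.
        (\<forall>i<k. \<forall>v\<in>Rn n. \<forall>w\<in>Rn n. \<forall>a b.
           \<beta> u (vs[i := (\<lambda>j. a * v j + b * w j)]) = a * \<beta> u (vs[i := v]) + b * \<beta> u (vs[i := w])) \<and>
        (\<not> distinct vs \<longrightarrow> \<beta> u vs = 0))"

text \<open>Invariant formula for the exterior derivative, evaluated on constant vector fields.\<close>

definition ordinary_d :: "(vec \<Rightarrow> vec list \<Rightarrow> real) \<Rightarrow> vec \<Rightarrow> vec list \<Rightarrow> real" where
  "ordinary_d \<beta> u vs =
     (\<Sum>i<length vs. (- 1) ^ i * dir_deriv (\<lambda>x. \<beta> x (take i vs @ drop (Suc i) vs)) u (vs ! i))"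

text \<open>\<open>\<alpha> n U P\<close> is the form \<open>P\<^sup>*\<alpha>\<close> on \<open>U\<close>, for a plot \<open>P\<close> of \<open>X\<close>. The compatibility condition is
  stated for any \<open>Q\<close> that agrees with \<open>P \<circ> f\<close> on \<open>V\<close>, as values of plots outside their domain do
  not matter.\<close>

type_synonym 'a form = "nat \<Rightarrow> vec set \<Rightarrow> (vec \<Rightarrow> 'a) \<Rightarrow> vec \<Rightarrow> vec list \<Rightarrow> real"

definition diff_form :: "nat \<Rightarrow> 'a diffspace \<Rightarrow> 'a form \<Rightarrow> bool" where
  "diff_form k X \<alpha> \<longleftrightarrow>
     (\<forall>n U P. plot X n U P \<longrightarrow> ordinary_form k n U (\<alpha> n U P)) \<and>
     (\<forall>n U P m V f Q. plot X n U P \<and> open_Rn m V \<and> smooth_map m V n U f \<and>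
        (\<forall>v\<in>V. Q v = P (f v)) \<longrightarrow>
        (\<forall>v\<in>V. \<forall>ws\<in>tuples k m. \<alpha> m V Q v ws = \<alpha> n U P (f v) (map (jacobian f v) ws)))"

definition form_eq :: "nat \<Rightarrow> 'a diffspace \<Rightarrow> 'a form \<Rightarrow> 'a form \<Rightarrow> bool" where
  "form_eq k X \<alpha> \<beta> \<longleftrightarrow>
     (\<forall>n U P. plot X n U P \<longrightarrow> (\<forall>u\<in>U. \<forall>vs\<in>tuples k n. \<alpha> n U P u vs = \<beta> n U P u vs))"

definition pullback :: "('a \<Rightarrow> 'b) \<Rightarrow> 'b form \<Rightarrow> 'a form" where
  "pullback f \<alpha> = (\<lambda>n U P. \<alpha> n U (\<lambda>u. f (P u)))"

definition ext_d :: "'a form \<Rightarrow> 'a form" where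
  "ext_d \<alpha> = (\<lambda>n U P. ordinary_d (\<alpha> n U P))"

definition zero_form :: "'a form" where
  "zero_form = (\<lambda>n U P u vs. 0)"

definition invariant_form ::
    "nat \<Rightarrow> ('g, 'b) monoid_scheme \<Rightarrow> 'x diffspace \<Rightarrow> ('g \<Rightarrow> 'x \<Rightarrow> 'x) \<Rightarrow> 'x form \<Rightarrow> bool" where
  "invariant_form k G X \<phi> \<alpha> \<longleftrightarrow> (\<forall>g\<in>carrier G. form_eq k X (pullback (\<phi> g) \<alpha>) \<alpha>)"

text \<open>Value of a form on a manifold at tangent vectors: express the vectors in a chart around the
  point. The result does not depend on the chart.\<close>

definition chart_at :: "'a diffspace \<Rightarrow> 'a \<Rightarrow> nat \<times> vec set \<times> (vec \<Rightarrow> 'a)" where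
  "chart_at X x = (SOME (n, U, F). chart X n U F \<and> x \<in> F ` U)"

definition chart_components :: "nat \<Rightarrow> vec set \<Rightarrow> (vec \<Rightarrow> 'a) \<Rightarrow> 'a tvec \<Rightarrow> vec" where
  "chart_components n U F v = (\<lambda>i. if i < n then v (\<lambda>y. inv_into U F y i) else 0)"

definition form_at :: "'a diffspace \<Rightarrow> 'a form \<Rightarrow> 'a \<Rightarrow> 'a tvec list \<Rightarrow> real" where
  "form_at X \<alpha> x vs = (case chart_at X x of (n, U, F) \<Rightarrow>
     \<alpha> n U F (inv_into U F x) (map (chart_components n U F) vs))"


section \<open>Hamiltonian and prequantum spaces\<close>

definition symplectic_form :: "'x diffspace \<Rightarrow> 'x form \<Rightarrow> bool" where
  "symplectic_form X \<omega> \<longleftrightarrow> diff_form 2 X \<omega> \<and> form_eq 3 X (ext_d \<omega>) zero_form \<and>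
     (\<forall>x\<in>carrier X. \<forall>v\<in>tangent_space X x.
        (\<forall>w\<in>tangent_space X x. form_at X \<omega> x [v, w] = 0) \<longrightarrow> v = (\<lambda>_. 0))"

text \<open>\<open>\<Phi> x Z\<close> is the pairing \<open>\<langle>\<Phi>(x), Z\<rangle>\<close>; only the values for \<open>Z\<close> in the Lie algebra matter.
  Smoothness of a map to the finite-dimensional space dual to the Lie algebra is smoothness of
  its pairings with all \<open>Z\<close>, and \<open>\<langle>Ad\<^sup>*\<^sub>g \<mu>, Z\<rangle> = \<langle>\<mu>, Ad\<^sub>h Z\<rangle>\<close> where \<open>h\<close> is the inverse of \<open>g\<close>.\<close>

definition moment_map :: "('g, 'b) monoid_scheme \<Rightarrow> 'g diffspace \<Rightarrow> 'x diffspace \<Rightarrow>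
    ('g \<Rightarrow> 'x \<Rightarrow> 'x) \<Rightarrow> 'x form \<Rightarrow> ('x \<Rightarrow> 'g tvec \<Rightarrow> real) \<Rightarrow> bool" where
  "moment_map G DG X \<phi> \<omega> \<Phi> \<longleftrightarrow>
     (\<forall>x\<in>carrier X. \<forall>Z\<in>lie_algebra G DG. \<forall>W\<in>lie_algebra G DG. \<forall>a b.
        \<Phi> x (\<lambda>f. a * Z f + b * W f) = a * \<Phi> x Z + b * \<Phi> x W) \<and>
     (\<forall>Z\<in>lie_algebra G DG. smooth_real_on X (carrier X) (\<lambda>x. \<Phi> x Z)) \<and>
     (\<forall>g\<in>carrier G. \<forall>x\<in>carrier X. \<forall>Z\<in>lie_algebra G DG.
        \<Phi> (\<phi> g x) Z = \<Phi> x (Ad G DG (inv\<^bsub>G\<^esub> g) Z)) \<and>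
     (\<forall>Z\<in>lie_algebra G DG. \<forall>x\<in>carrier X. \<forall>v\<in>tangent_space X x.
        form_at X \<omega> x [fundamental_field G DG X \<phi> Z x, v] = - v (\<lambda>y. \<Phi> y Z))"

definition hamiltonian_space :: "('g, 'b) monoid_scheme \<Rightarrow> 'g diffspace \<Rightarrow> 'x diffspace \<Rightarrow>
    ('g \<Rightarrow> 'x \<Rightarrow> 'x) \<Rightarrow> 'x form \<Rightarrow> ('x \<Rightarrow> 'g tvec \<Rightarrow> real) \<Rightarrow> bool" where
  "hamiltonian_space G DG X \<phi> \<omega> \<Phi> \<longleftrightarrow> (\<exists>n. manifold n X) \<and> smooth_action G DG X \<phi> \<and>
     symplectic_form X \<omega> \<and> invariant_form 2 G X \<phi> \<omega> \<and> moment_map G DG X \<phi> \<omega> \<Phi>"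

text \<open>The kernel of \<open>\<alpha>\<close> is a hyperplane field on which \<open>d\<alpha>\<close> is nondegenerate; in dimension
  \<open>2m + 1\<close> this says that \<open>\<alpha> \<and> (d\<alpha>)\<^sup>m\<close> is a volume form.\<close>

definition contact_form :: "'x diffspace \<Rightarrow> 'x form \<Rightarrow> bool" where
  "contact_form X \<alpha> \<longleftrightarrow> diff_form 1 X \<alpha> \<and>
     (\<forall>x\<in>carrier X. (\<exists>v\<in>tangent_space X x. form_at X \<alpha> x [v] \<noteq> 0) \<and>
        (\<forall>v\<in>tangent_space X x. form_at X \<alpha> x [v] = 0 \<and>
           (\<forall>w\<in>tangent_space X x. form_at X \<alpha> x [w] = 0 \<longrightarrow> form_at X (ext_d \<alpha>) x [v, w] = 0) \<longrightarrow>
           v = (\<lambda>_. 0)))"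

definition reeb_field :: "'x diffspace \<Rightarrow> 'x form \<Rightarrow> ('x \<Rightarrow> 'x tvec) \<Rightarrow> bool" where
  "reeb_field X \<alpha> R \<longleftrightarrow> (\<forall>x\<in>carrier X. R x \<in> tangent_space X x \<and> form_at X \<alpha> x [R x] = 1 \<and>
     (\<forall>w\<in>tangent_space X x. form_at X (ext_d \<alpha>) x [R x, w] = 0))"

definition circle_group :: "complex monoid" where
  "circle_group = \<lparr>carrier = sphere 0 1, mult = (*), one = 1\<rparr>"

definition circle_diff :: "complex diffspace" where
  "circle_diff = \<lparr>carrier = sphere 0 1, plot = (\<lambda>n U P. open_Rn n U \<and> P ` U \<subseteq> sphere 0 1 \<and>
     smooth_fun n U (\<lambda>u. Re (P u)) \<and> smooth_fun n U (\<lambda>u. Im (P u)))\<rparr>"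

text \<open>The Reeb field generates the circle action \<open>\<psi>\<close> if its flow at time \<open>t\<close> is the action of
  \<open>e\<^sup>i\<^sup>t\<close>; the flow thus has period \<open>2\<pi>\<close>.\<close>

definition prequantum_space :: "('g, 'b) monoid_scheme \<Rightarrow> 'g diffspace \<Rightarrow> 'x diffspace \<Rightarrow>
    ('g \<Rightarrow> 'x \<Rightarrow> 'x) \<Rightarrow> 'x form \<Rightarrow> bool" where
  "prequantum_space G DG X \<phi> \<alpha> \<longleftrightarrow> (\<exists>n. manifold n X) \<and> smooth_action G DG X \<phi> \<and>
     contact_form X \<alpha> \<and> invariant_form 1 G X \<phi> \<alpha> \<and>
     (\<exists>R \<psi>. reeb_field X \<alpha> R \<and> smooth_action circle_group circle_diff X \<psi> \<and>
        (\<forall>x\<in>carrier X. velocity X (\<lambda>t. \<psi> (cis t) x) = R x) \<and>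
        (\<forall>z\<in>carrier circle_group. \<forall>x\<in>carrier X. \<psi> z x = x \<longrightarrow> z = 1))"

definition prequantum_moment :: "('g, 'b) monoid_scheme \<Rightarrow> 'g diffspace \<Rightarrow> 'x diffspace \<Rightarrow>
    ('g \<Rightarrow> 'x \<Rightarrow> 'x) \<Rightarrow> 'x form \<Rightarrow> 'x \<Rightarrow> 'g tvec \<Rightarrow> real" where
  "prequantum_moment G DG X \<phi> \<alpha> x Z = form_at X \<alpha> x [fundamental_field G DG X \<phi> Z x]"


section \<open>Reduced spaces\<close>

definition zero_level :: "('g, 'b) monoid_scheme \<Rightarrow> 'g diffspace \<Rightarrow> 'x diffspace \<Rightarrow>
    ('x \<Rightarrow> 'g tvec \<Rightarrow> real) \<Rightarrow> 'x set" where
  "zero_level G DG X \<Phi> = {x \<in> carrier X. \<forall>Z\<in>lie_algebra G DG. \<Phi> x Z = 0}"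

definition orbit_rel ::
    "('g, 'b) monoid_scheme \<Rightarrow> ('g \<Rightarrow> 'x \<Rightarrow> 'x) \<Rightarrow> 'x set \<Rightarrow> ('x \<times> 'x) set" where
  "orbit_rel G \<phi> C = {(x, y). x \<in> C \<and> y \<in> C \<and> y \<in> orbit G \<phi> x}"

definition reduced_space :: "('g, 'b) monoid_scheme \<Rightarrow> 'g diffspace \<Rightarrow> 'x diffspace \<Rightarrow>
    ('g \<Rightarrow> 'x \<Rightarrow> 'x) \<Rightarrow> ('x \<Rightarrow> 'g tvec \<Rightarrow> real) \<Rightarrow> 'x set diffspace" where
  "reduced_space G DG X \<phi> \<Phi> =
     quot_diff (sub_diff X (zero_level G DG X \<Phi>)) (orbit_rel G \<phi> (zero_level G DG X \<Phi>))"

text \<open>The inclusion \<open>j\<close> is \<^const>\<open>id\<close>, and the projection \<open>\<pi>\<close> sends \<open>x\<close> to its class.\<close>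

definition carries_reduced_form :: "nat \<Rightarrow> ('g, 'b) monoid_scheme \<Rightarrow> 'g diffspace \<Rightarrow>
    'x diffspace \<Rightarrow> ('g \<Rightarrow> 'x \<Rightarrow> 'x) \<Rightarrow> ('x \<Rightarrow> 'g tvec \<Rightarrow> real) \<Rightarrow> 'x form \<Rightarrow> bool" where
  "carries_reduced_form k G DG X \<phi> \<Phi> \<alpha> \<longleftrightarrow>
     (\<exists>\<beta>. diff_form k (reduced_space G DG X \<phi> \<Phi>) \<beta> \<and>
        form_eq k (sub_diff X (zero_level G DG X \<Phi>)) (pullback id \<alpha>)
          (pullback (\<lambda>x. orbit_rel G \<phi> (zero_level G DG X \<Phi>) `` {x}) \<beta>))"

end

(* The criterion of Souriau reduces the claim to this: two plots P, Q of C with the same projection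
   to C/G must pull the form back to the same form. Strictness makes the pair (P, Q) locally equal
   to (P, g P) for a plot g of G, and by invariance g may be normalized to g(u) = 1 at the point u
   considered. Then DQ(v) = DP(v) + Z_X(P u) at u, where Z = Dg(v) is in the Lie algebra, and the
   extra terms vanish: the moment map condition turns each of them into a value of the moment map
   on C or into its derivative along a curve in C.

   The moment map conditions are stated with the curves exp(tZ), so the argument needs the existence
   of one-parameter subgroups: they are integral curves of left-invariant vector fields, obtained
   from the contraction principle in a chart at 1. *)

theory Submission
  imports Defs "HOL-Probability.Discrete_Topology"
begin

section \<open>Calculus on open subsets of Euclidean spaces\<close>

text \<open>The dimension of a plot domain is a number and not a type, so the calculus is built
  directly on the partial derivatives in \<open>Ck\<close>. Neighbourhoods are cubes, and a
  difference of two values is treated one coordinate at a time by the mean value theorem in one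
  variable; the chain rule along curves and the Lipschitz bound for the differential equation both
  come from this.

  \<open>exp_curve\<close> is a choice, so nothing is known about \<open>fundamental_field\<close>
  at Z until a one-parameter subgroup with velocity Z is exhibited. The Z that occur are velocities
  of smooth curves through the unit, and such a curve is also what defines the left-invariant field.

  Pullbacks are compared at one point at a time: \<open>form_at_plot\<close> rewrites them as values
  of the form on the velocities of the images of straight lines, so that two plots matter only
  through their velocities at u. In the expansion of \<omega>(DQ(v), DQ(w)) the term with two
  fundamental vectors is never isolated: the sum is split so that each fundamental vector is paired
  with the velocity of a curve that stays in the zero level.\<close>

lemma Rn_iff: "x \<in> Rn n \<longleftrightarrow> (\<forall>i\<ge>n. x i = 0)"
  by (simp add: topspace_Euclidean_space)

text \<open>A ball of the maximum norm. Being given coordinate by coordinate, it contains every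
  point that mixes the coordinates of two of its points, which is how \<open>cube_mean_value\<close>
  moves inside it.\<close>

definition cube :: "nat \<Rightarrow> vec \<Rightarrow> real \<Rightarrow> vec set" where
  "cube n a r = {x \<in> Rn n. \<forall>i<n. \<bar>x i - a i\<bar> < r}"

lemma open_Rn_alt: "open_Rn n U \<longleftrightarrow> (\<exists>T. open T \<and> U = T \<inter> Rn n)"
  by (simp add: Euclidean_space_def openin_subtopology euclidean_product_topology)

lemma open_Rn_subset: "open_Rn n U \<Longrightarrow> U \<subseteq> Rn n"
  by (rule openin_subset)

lemma open_Rn_cube: "open_Rn n (cube n a r)"
proof -
  have "open (\<Inter>i<n. {x :: vec. \<bar>x i - a i\<bar> < r})"
    by (intro open_INT finite_lessThan ballI open_Collect_less continuous_intros
        continuous_on_product_then_coordinatewise[OF continuous_on_id])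
  moreover have "cube n a r = (\<Inter>i<n. {x. \<bar>x i - a i\<bar> < r}) \<inter> Rn n"
    by (auto simp: cube_def)
  ultimately show ?thesis
    unfolding open_Rn_alt by blast
qed

lemma cube_centre: "a \<in> Rn n \<Longrightarrow> 0 < r \<Longrightarrow> a \<in> cube n a r"
  by (simp add: cube_def)

text \<open>A product neighbourhood constrains each coordinate separately. On R^n the coordinates
  from n on are all 0, so the least of n radii suffices.\<close>

lemma open_Rn_iff:
  "open_Rn n U \<longleftrightarrow> U \<subseteq> Rn n \<and> (\<forall>u\<in>U. \<exists>r>0. cube n u r \<subseteq> U)"
proof (intro iffI conjI ballI)
  assume "open_Rn n U"
  then obtain T where T: "open T" "U = T \<inter> Rn n"
    unfolding open_Rn_alt by blast
  then show "U \<subseteq> Rn n" by simp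
  fix u assume u: "u \<in> U"
  have "\<exists>X. u \<in> Pi\<^sub>E UNIV X \<and> (\<forall>i. open (X i)) \<and> finite {i. X i \<noteq> UNIV} \<and> Pi\<^sub>E UNIV X \<subseteq> T"
    using product_topology_open_contains_basis[of "\<lambda>_. euclideanreal" UNIV T u] T u
    by (auto simp: euclidean_product_topology)
  then obtain X where X: "u \<in> Pi\<^sub>E UNIV X" "\<And>i. open (X i)" "Pi\<^sub>E UNIV X \<subseteq> T"
    by blast
  have "\<exists>r>0. \<forall>y. \<bar>y - u i\<bar> < r \<longrightarrow> y \<in> X i" for i
    using X(1) X(2)[of i] by (auto simp: open_dist dist_real_def PiE_iff)
  then obtain r where r: "\<And>i. r i > 0" "\<And>i y. \<bar>y - u i\<bar> < r i \<Longrightarrow> y \<in> X i"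
    by metis
  \<comment> \<open>The entry 1 keeps the minimum defined for n = 0.\<close>
  define s where "s = Min (insert 1 (r ` {..<n}))"
  have s: "s > 0" "\<And>i. i < n \<Longrightarrow> s \<le> r i"
    using r(1) by (auto simp: s_def)
  have "cube n u s \<subseteq> U"
  proof
    fix x assume x: "x \<in> cube n u s"
    have "x i \<in> X i" for i
    proof (cases "i < n")
      case True
      then show ?thesis using x s(2)[of i] r(2)[of "x i" i] by (force simp: cube_def)
    next
      case False
      then have "x i = u i" using x u T(2) by (auto simp: cube_def Rn_iff)
      then show ?thesis using r by simp
    qed
    then show "x \<in> U" using X(3) x T(2) by (auto simp: cube_def PiE_iff)
  qed
  then show "\<exists>r>0. cube n u r \<subseteq> U" using s by blast
next
  assume U: "U \<subseteq> Rn n \<and> (\<forall>u\<in>U. \<exists>r>0. cube n u r \<subseteq> U)"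
  have "\<exists>T. open_Rn n T \<and> u \<in> T \<and> T \<subseteq> U" if "u \<in> U" for u
    using that U open_Rn_cube cube_centre by (metis subsetD)
  then show "open_Rn n U"
    by (subst openin_subopen) auto
qed

lemma open_RnD: "open_Rn n U \<Longrightarrow> u \<in> U \<Longrightarrow> \<exists>r>0. cube n u r \<subseteq> U"
  by (simp add: open_Rn_iff)

lemma continuous_on_cube:
  assumes "continuous_on U (f :: vec \<Rightarrow> real)" "open_Rn n U" "u \<in> U" "0 < e"
  shows "\<exists>r>0. \<forall>y\<in>cube n u r. y \<in> U \<and> \<bar>f y - f u\<bar> < e"
proof -
  have "openin (top_of_set U) (U \<inter> f -` ball (f u) e)"
    using assms by (intro continuous_openin_preimage_gen) auto
  then obtain T where "open T" "U \<inter> f -` ball (f u) e = T \<inter> U"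
    by (auto simp: openin_open)
  moreover obtain T' where "open T'" "U = T' \<inter> Rn n"
    using assms(2) open_Rn_alt by blast
  ultimately have "open_Rn n (U \<inter> f -` ball (f u) e)"
    unfolding open_Rn_alt by (metis inf_assoc open_Int)
  then obtain r where "r > 0" "cube n u r \<subseteq> U \<inter> f -` ball (f u) e"
    using open_RnD[of n _ u] assms by fastforce
  then show ?thesis by (force simp: dist_real_def abs_minus_commute)
qed

text \<open>Near u both sets agree. In \<open>smooth_fun_local\<close> this carries continuity from
  a small open set to the large one.\<close>

lemma at_within_open_Rn:
  assumes "open_Rn n U" "open_Rn n V" "u \<in> V" "V \<subseteq> U"
  shows "at u within V = at u within U"
proof -
  obtain T where T: "open T" "V = T \<inter> Rn n"
    using assms(2) open_Rn_alt by blast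
  have "U \<inter> T - {u} = V \<inter> T - {u}"
    using T assms open_Rn_subset[OF assms(1)] by auto
  then show ?thesis
    using T assms by (intro at_within_nhd[of u T]) auto
qed

lemma eventually_upd_open_Rn:
  assumes "open_Rn n U" "u \<in> U" "i < n"
  shows "\<forall>\<^sub>F t in nhds (u i). u(i := t) \<in> U"
proof -
  obtain r where r: "r > 0" "cube n u r \<subseteq> U"
    using open_RnD assms by blast
  have "u \<in> Rn n"
    using assms open_Rn_subset by blast
  then have "u(i := t) \<in> cube n u r" if "dist t (u i) < r" for t
    using that r assms(3) by (auto simp: cube_def Rn_iff dist_real_def)
  then show ?thesis
    unfolding eventually_nhds_metric using r by blast
qed

section \<open>Functions of class C^k and smooth functions\<close>

lemma has_partial_deriv:
  assumes "Ck (Suc k) n U f" "u \<in> U" "i < n"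
  shows "((\<lambda>t. f (u(i := t))) has_real_derivative partial_deriv i f u) (at (u i))"
  using assms by (auto simp: partial_deriv_def DERIV_deriv_iff_real_differentiable)

text \<open>A partial derivative at u depends only on the values on a short coordinate segment
  through u, and openness keeps that segment inside U.\<close>

lemma Ck_cong:
  assumes "open_Rn n U" "\<And>u. u \<in> U \<Longrightarrow> f u = g u" "Ck k n U f"
  shows "Ck k n U g"
  using assms(2,3)
proof (induction k arbitrary: f g)
  case 0
  then show ?case by (metis Ck.simps(1) continuous_on_cong)
next
  case (Suc k)
  have ev: "\<forall>\<^sub>F t in nhds (u i). f (u(i := t)) = g (u(i := t))" if "u \<in> U" "i < n" for u i
    by (rule eventually_mono[OF eventually_upd_open_Rn[OF assms(1) that]]) (rule Suc.prems(1))
  have 1: "continuous_on U g"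
    using Suc.prems by (metis Ck.simps(2) continuous_on_cong)
  have 2: "(\<lambda>t. g (u(i := t))) differentiable (at (u i))" if "u \<in> U" "i < n" for u i
    using has_partial_deriv[OF Suc.prems(2) that] DERIV_cong_ev[OF refl ev[OF that] refl]
      real_differentiable_def by blast
  have 3: "partial_deriv i f u = partial_deriv i g u" if "u \<in> U" "i < n" for u i
    using deriv_cong_ev[OF ev[OF that] refl] by (simp add: partial_deriv_def)
  then have "Ck k n U (partial_deriv i g)" if "i < n" for i
    using Suc.IH[of "partial_deriv i f"] Suc.prems(2) that by auto
  then show ?case using 1 2 by simp
qed

text \<open>\<open>partial_deriv\<close> carries no information until a derivative is known to
  exist; exhibiting \<open>D\<close> settles existence and value together.\<close>

lemma Ck_SucI:
  assumes U: "open_Rn n U" and "continuous_on U f"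
    and "\<And>i u. i < n \<Longrightarrow> u \<in> U \<Longrightarrow> ((\<lambda>t. f (u(i := t))) has_real_derivative D i u) (at (u i))"
    and "\<And>i. i < n \<Longrightarrow> Ck k n U (D i)"
  shows "Ck (Suc k) n U f"
proof -
  have "D i u = partial_deriv i f u" if "i < n" "u \<in> U" for i u
    using assms(3)[OF that] by (simp add: partial_deriv_def DERIV_imp_deriv)
  then have "Ck k n U (partial_deriv i f)" if "i < n" for i
    using assms(4)[OF that] that Ck_cong[OF U, of "D i"] by simp
  then show ?thesis
    using assms(2,3) real_differentiable_def by auto
qed

lemma Ck_add: "open_Rn n U \<Longrightarrow> Ck k n U f \<Longrightarrow> Ck k n U g \<Longrightarrow> Ck k n U (\<lambda>u. f u + g u)"
proof (induction k arbitrary: f g)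
  case 0
  then show ?case by (auto intro: continuous_on_add)
next
  case (Suc k)
  show ?case
  proof (rule Ck_SucI[where D = "\<lambda>i u. partial_deriv i f u + partial_deriv i g u"])
    show "((\<lambda>t. f (u(i := t)) + g (u(i := t))) has_real_derivative
        partial_deriv i f u + partial_deriv i g u) (at (u i))" if "i < n" "u \<in> U" for i u
      by (intro DERIV_add has_partial_deriv[OF Suc.prems(2)] has_partial_deriv[OF Suc.prems(3)] that)
  qed (use Suc in \<open>auto intro: continuous_on_add\<close>)
qed

lemma smooth_fun_continuous: "smooth_fun n U f \<Longrightarrow> continuous_on U f"
  unfolding smooth_fun_def by (metis Ck.simps(1))

lemma smooth_fun_Ck: "smooth_fun n U f \<Longrightarrow> Ck k n U f"
  by (simp add: smooth_fun_def)

lemma smooth_fun_partial: "smooth_fun n U f \<Longrightarrow> i < n \<Longrightarrow> smooth_fun n U (partial_deriv i f)"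
  unfolding smooth_fun_def by (metis Ck.simps(2))

lemma smooth_fun_has_partial_deriv:
  "smooth_fun n U f \<Longrightarrow> u \<in> U \<Longrightarrow> i < n \<Longrightarrow>
   ((\<lambda>t. f (u(i := t))) has_real_derivative partial_deriv i f u) (at (u i))"
  using has_partial_deriv smooth_fun_Ck by blast

lemma smooth_fun_cong:
  "open_Rn n U \<Longrightarrow> (\<And>u. u \<in> U \<Longrightarrow> f u = g u) \<Longrightarrow> smooth_fun n U f \<Longrightarrow> smooth_fun n U g"
  unfolding smooth_fun_def using Ck_cong by blast

lemma smooth_fun_const: "open_Rn n U \<Longrightarrow> smooth_fun n U (\<lambda>u. c)"
proof -
  assume U: "open_Rn n U"
  have "Ck k n U (\<lambda>u. c)" for k c
  proof (induction k arbitrary: c)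
    case (Suc k)
    show ?case
      by (rule Ck_SucI[OF U, where D = "\<lambda>_ _. 0"]) (use Suc in auto)
  qed auto
  then show ?thesis by (simp add: smooth_fun_def)
qed

lemma smooth_fun_add:
  "open_Rn n U \<Longrightarrow> smooth_fun n U f \<Longrightarrow> smooth_fun n U g \<Longrightarrow> smooth_fun n U (\<lambda>u. f u + g u)"
  by (simp add: smooth_fun_def Ck_add)

text \<open>The induction on the order k keeps both factors smooth, not just of class k: the Leibniz
  rule pairs a derivative of one factor with the other factor itself, and both pairs again fall
  under the induction hypothesis.\<close>

lemma smooth_fun_mult:
  assumes U: "open_Rn n U" and "smooth_fun n U f" "smooth_fun n U g"
  shows "smooth_fun n U (\<lambda>u. f u * g u)"
proof -
  have "Ck k n U (\<lambda>u. f u * g u)" for k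
    using assms(2,3)
  proof (induction k arbitrary: f g)
    case 0
    then show ?case by (auto intro: continuous_on_mult smooth_fun_continuous)
  next
    case (Suc k)
    show ?case
    proof (rule Ck_SucI[OF U, where D = "\<lambda>i u. partial_deriv i f u * g u + partial_deriv i g u * f u"])
      show "continuous_on U (\<lambda>u. f u * g u)"
        using Suc.prems by (intro continuous_on_mult smooth_fun_continuous)
      show "((\<lambda>t. f (u(i := t)) * g (u(i := t))) has_real_derivative
          partial_deriv i f u * g u + partial_deriv i g u * f u) (at (u i))" if "i < n" "u \<in> U" for i u
        using DERIV_mult[OF smooth_fun_has_partial_deriv[OF Suc.prems(1) that(2,1)]
          smooth_fun_has_partial_deriv[OF Suc.prems(2) that(2,1)]] by (simp only: fun_upd_triv)
      show "Ck k n U (\<lambda>u. partial_deriv i f u * g u + partial_deriv i g u * f u)" if "i < n" for i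
        using Suc.IH Suc.prems that by (intro Ck_add U) (auto intro: smooth_fun_partial)
    qed
  qed
  then show ?thesis by (simp add: smooth_fun_def)
qed

lemma smooth_fun_sum:
  assumes "open_Rn n U" "\<And>i. i \<in> I \<Longrightarrow> smooth_fun n U (f i)"
  shows "smooth_fun n U (\<lambda>u. \<Sum>i\<in>I. f i u)"
  using assms
  by (induction I rule: infinite_finite_induct) (auto intro: smooth_fun_const smooth_fun_add)

lemma smooth_fun_coord: "open_Rn n U \<Longrightarrow> smooth_fun n U (\<lambda>u. u i)"
proof -
  assume U: "open_Rn n U"
  have "Ck k n U (\<lambda>u. u i)" for k
  proof (cases k)
    case 0
    then show ?thesis
      by (simp add: continuous_on_product_then_coordinatewise[OF continuous_on_id])
  next
    case (Suc k)
    have "((\<lambda>t. (u(j := t)) i) has_real_derivative (if j = i then 1 else 0)) (at (u j))" for j u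
      by auto
    then show ?thesis
      unfolding Suc using smooth_fun_const[OF U]
      by (intro Ck_SucI[OF U, where D = "\<lambda>j _. if j = i then 1 else 0"]
          continuous_on_product_then_coordinatewise[OF continuous_on_id]) (auto simp: smooth_fun_def)
  qed
  then show ?thesis by (simp add: smooth_fun_def)
qed

lemma smooth_fun_subset: "smooth_fun n U f \<Longrightarrow> V \<subseteq> U \<Longrightarrow> smooth_fun n V f"
proof -
  assume "smooth_fun n U f" "V \<subseteq> U"
  have "Ck k n U f \<Longrightarrow> Ck k n V f" for k
  proof (induction k arbitrary: f)
    case 0
    then show ?case using \<open>V \<subseteq> U\<close> continuous_on_subset by auto
  next
    case (Suc k)
    then have "continuous_on V f" using \<open>V \<subseteq> U\<close> continuous_on_subset by auto
    moreover have "Ck k n V (partial_deriv i f)" if "i < n" for i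
      using Suc that by simp
    moreover have "(\<lambda>t. f (u(i := t))) differentiable (at (u i))" if "i < n" "u \<in> V" for i u
      using Suc.prems that \<open>V \<subseteq> U\<close> by auto
    ultimately show ?case by simp
  qed
  then show ?thesis using \<open>smooth_fun n U f\<close> by (simp add: smooth_fun_def)
qed

text \<open>Fewer directions mean fewer conditions. Together with \<open>smooth_fun_subset\<close>
  this restricts a smooth function of n + 1 variables to the slice where the last one is 0.\<close>

lemma smooth_fun_Suc: "smooth_fun (Suc n) U f \<Longrightarrow> smooth_fun n U f"
proof -
  have "Ck k (Suc n) U f \<Longrightarrow> Ck k n U f" for k
    by (induction k arbitrary: f) auto
  then show "smooth_fun (Suc n) U f \<Longrightarrow> smooth_fun n U f"
    by (simp add: smooth_fun_def)
qed

lemma smooth_fun_local: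
  assumes U: "open_Rn n U"
    and loc: "\<And>u. u \<in> U \<Longrightarrow> \<exists>V. open_Rn n V \<and> u \<in> V \<and> V \<subseteq> U \<and> smooth_fun n V f"
  shows "smooth_fun n U f"
proof -
  have "Ck k n U f" if "\<forall>u\<in>U. \<exists>V. open_Rn n V \<and> u \<in> V \<and> V \<subseteq> U \<and> Ck k n V f" for k
    using that
  proof (induction k arbitrary: f)
    case 0
    show ?case
      unfolding Ck.simps continuous_on_eq_continuous_within
    proof
      fix u assume "u \<in> U"
      then obtain V where V: "open_Rn n V" "u \<in> V" "V \<subseteq> U" "continuous_on V f"
        using 0 by auto
      then have "continuous (at u within V) f"
        by (simp add: continuous_on_eq_continuous_within)
      then show "continuous (at u within U) f"
        using at_within_open_Rn[OF U V(1-3)] by simp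
    qed
  next
    case (Suc k)
    have "continuous_on U f"
      unfolding continuous_on_eq_continuous_within
    proof
      fix u assume "u \<in> U"
      then obtain V where V: "open_Rn n V" "u \<in> V" "V \<subseteq> U" "continuous_on V f"
        using Suc.prems by auto
      then have "continuous (at u within V) f"
        by (simp add: continuous_on_eq_continuous_within)
      then show "continuous (at u within U) f"
        using at_within_open_Rn[OF U V(1-3)] by simp
    qed
    moreover have "Ck k n U (partial_deriv i f)" if "i < n" for i
      by (rule Suc.IH) (use Suc.prems that in fastforce)
    moreover have "(\<lambda>t. f (u(i := t))) differentiable (at (u i))" if "i < n" "u \<in> U" for i u
      using Suc.prems that by fastforce
    ultimately show ?case by simp
  qed
  moreover have "\<forall>u\<in>U. \<exists>V. open_Rn n V \<and> u \<in> V \<and> V \<subseteq> U \<and> Ck k n V f" for k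
    using loc smooth_fun_Ck by meson
  ultimately show ?thesis
    unfolding smooth_fun_def by blast
qed

lemma open_Rn_vimage:
  assumes f: "smooth_map m W n U f" and W: "open_Rn m W" and U: "U \<subseteq> Rn n" and V: "open_Rn n V"
  shows "open_Rn m {w \<in> W. f w \<in> V}"
  unfolding open_Rn_iff
proof (intro conjI ballI)
  show "{w \<in> W. f w \<in> V} \<subseteq> Rn m"
    using open_Rn_subset[OF W] by auto
  fix w assume w: "w \<in> {w \<in> W. f w \<in> V}"
  then obtain r where r: "r > 0" "cube n (f w) r \<subseteq> V"
    using open_RnD[OF V] by blast
  have "\<exists>s>0. \<forall>y\<in>cube m w s. y \<in> W \<and> \<bar>f y j - f w j\<bar> < r" if "j < n" for j
    using f that w r(1)
    by (intro continuous_on_cube[OF smooth_fun_continuous W]) (auto simp: smooth_map_def)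
  then obtain s' where s': "\<And>j. j < n \<Longrightarrow> s' j > 0"
    "\<And>j y. j < n \<Longrightarrow> y \<in> cube m w (s' j) \<Longrightarrow> \<bar>f y j - f w j\<bar> < r"
    by metis
  obtain s0 where s0: "s0 > 0" "cube m w s0 \<subseteq> W"
    using open_RnD[OF W] w by blast
  define s1 where "s1 = Min (insert s0 (s' ` {..<n}))"
  have s1: "s1 > 0" "s1 \<le> s0" "\<And>j. j < n \<Longrightarrow> s1 \<le> s' j"
    using s0(1) s'(1) by (auto simp: s1_def)
  have "cube m w s1 \<subseteq> {w \<in> W. f w \<in> V}"
  proof
    fix y assume y: "y \<in> cube m w s1"
    have yW: "y \<in> W" using y s0(2) s1(2) by (force simp: cube_def)
    have "y \<in> cube m w (s' j)" if "j < n" for j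
      using y s1(3)[OF that] by (force simp: cube_def)
    then have "f y \<in> cube n (f w) r"
      using s'(2) f yW U by (auto simp: cube_def smooth_map_def image_subset_iff subset_iff)
    then show "y \<in> {w \<in> W. f w \<in> V}"
      using r(2) yW by blast
  qed
  then show "\<exists>r>0. cube m w r \<subseteq> {w \<in> W. f w \<in> V}"
    using s1(1) by blast
qed

section \<open>Mean value theorem and chain rule\<close>

lemma mean_value_segment:
  assumes "\<And>t. min a b \<le> t \<Longrightarrow> t \<le> max a b \<Longrightarrow> (g has_real_derivative g' t) (at t)"
  shows "\<exists>t. min a b \<le> t \<and> t \<le> max a b \<and> g b - g a = g' t * (b - (a::real))"
proof -
  \<comment> \<open>\<open>min\<close> and \<open>max\<close> admit both orders of the endpoints, so
    later uses need not fix the sign of a time or of a coordinate difference.\<close>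
  consider "a < b" | "a = b" | "b < a" by linarith
  then show ?thesis
  proof cases
    case 1
    then obtain t where "a < t" "t < b" "g b - g a = (b - a) * g' t"
      using MVT2[of a b g g'] assms by auto
    then show ?thesis using 1 by (intro exI[of _ t]) (auto simp: mult.commute)
  next
    case 3
    then obtain t where "b < t" "t < a" "g a - g b = (a - b) * g' t"
      using MVT2[of b a g g'] assms by auto
    then show ?thesis using 3 by (intro exI[of _ t]) (auto simp: algebra_simps)
  qed auto
qed

text \<open>The path from y to x changes one coordinate after the other, and each edge is a problem
  in one variable. Each \<open>\<xi> i\<close> is no farther from y than x is, coordinate by
  coordinate; this makes the partial derivatives converge in
  \<open>chain_rule_curve\<close>.\<close>

lemma cube_mean_value:
  assumes f: "Ck (Suc 0) n U f" and U: "cube n a r \<subseteq> U" and x: "x \<in> cube n a r" and y: "y \<in> cube n a r"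
  shows "\<exists>\<xi>. (\<forall>i<n. \<xi> i \<in> cube n a r \<and> (\<forall>j. \<bar>\<xi> i j - y j\<bar> \<le> \<bar>x j - y j\<bar>)) \<and>
    f x - f y = (\<Sum>i<n. partial_deriv i f (\<xi> i) * (x i - y i))"
proof -
  \<comment> \<open>The corners of the path: the first k coordinates are those of x, so
    \<open>w 0\<close> is y and \<open>w n\<close> is x.\<close>
  define w where "w k = (\<lambda>j. if j < k then x j else y j)" for k
  have "\<exists>t. min (y k) (x k) \<le> t \<and> t \<le> max (y k) (x k) \<and>
      f ((w k)(k := x k)) - f ((w k)(k := y k)) = partial_deriv k f ((w k)(k := t)) * (x k - y k)"
    if k: "k < n" for k
  proof (rule mean_value_segment)
    fix t assume "min (y k) (x k) \<le> t" "t \<le> max (y k) (x k)"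
    moreover have "\<bar>x k - a k\<bar> < r" "\<bar>y k - a k\<bar> < r"
      using x y k by (auto simp: cube_def)
    ultimately have "\<bar>t - a k\<bar> < r"
      by linarith
    then have "(w k)(k := t) \<in> U"
      using x y k by (intro subsetD[OF U]) (auto simp: cube_def Rn_iff w_def)
    from has_partial_deriv[OF f this k]
    show "((\<lambda>t. f ((w k)(k := t))) has_real_derivative partial_deriv k f ((w k)(k := t))) (at t)"
      by simp
  qed
  then obtain t where t: "\<And>k. k < n \<Longrightarrow> min (y k) (x k) \<le> t k \<and> t k \<le> max (y k) (x k) \<and>
      f ((w k)(k := x k)) - f ((w k)(k := y k)) = partial_deriv k f ((w k)(k := t k)) * (x k - y k)"
    by metis
  have w: "(w k)(k := x k) = w (Suc k)" "(w k)(k := y k) = w k" for k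
    by (auto simp: w_def)
  have "f x - f y = f (w n) - f (w 0)"
  proof -
    have "w n = x" using x y by (auto simp: w_def cube_def Rn_iff)
    moreover have "w 0 = y" by (auto simp: w_def)
    ultimately show ?thesis by simp
  qed
  also have "\<dots> = (\<Sum>k<n. f (w (Suc k)) - f (w k))"
    by (rule sum_lessThan_telescope[of "\<lambda>k. f (w k)", symmetric])
  also have "\<dots> = (\<Sum>k<n. partial_deriv k f ((w k)(k := t k)) * (x k - y k))"
    using t by (intro sum.cong) (auto simp: w)
  finally have eq: "f x - f y = (\<Sum>k<n. partial_deriv k f ((w k)(k := t k)) * (x k - y k))" .
  show ?thesis
  proof (intro exI[of _ "\<lambda>k. (w k)(k := t k)"] conjI allI impI)
    fix i assume i: "i < n"
    have "\<bar>x i - a i\<bar> < r" "\<bar>y i - a i\<bar> < r"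
      using x y i by (auto simp: cube_def)
    then have "\<bar>t i - a i\<bar> < r"
      using t[OF i] by linarith
    then show "(w i)(i := t i) \<in> cube n a r"
      using x y i by (auto simp: cube_def Rn_iff w_def)
    show "\<bar>((w i)(i := t i)) j - y j\<bar> \<le> \<bar>x j - y j\<bar>" for j
      using t[OF i] by (auto simp: w_def)
  qed (rule eq)
qed

text \<open>By \<open>cube_mean_value\<close> the difference quotient of f along c is a sum of
  partial derivatives at intermediate points times difference quotients of the coordinates of c. The
  intermediate points tend to \<open>c t0\<close>, and the partial derivatives are
  continuous.\<close>

lemma chain_rule_curve:
  assumes U: "open_Rn n U" and f: "Ck (Suc 0) n U f" and c0: "c t0 \<in> U"
    and c: "\<forall>\<^sub>F t in nhds t0. c t \<in> Rn n"
    and d: "\<And>i. i < n \<Longrightarrow> ((\<lambda>t. c t i) has_real_derivative d i) (at t0)"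
  shows "((\<lambda>t. f (c t)) has_real_derivative (\<Sum>i<n. partial_deriv i f (c t0) * d i)) (at t0)"
proof -
  obtain r where r: "r > 0" "cube n (c t0) r \<subseteq> U"
    using open_RnD[OF U c0] by blast
  have near: "\<forall>\<^sub>F t in at t0. c t \<in> cube n (c t0) s" if "s > 0" for s
  proof -
    have "\<forall>\<^sub>F t in at t0. \<bar>c t i - c t0 i\<bar> < s" if "i < n" for i
      using DERIV_isCont[OF d[OF that]] \<open>s > 0\<close> unfolding isCont_def
      by (auto dest!: tendstoD simp: dist_real_def)
    then have "\<forall>\<^sub>F t in at t0. \<forall>i\<in>{..<n}. \<bar>c t i - c t0 i\<bar> < s"
      by (intro eventually_ball_finite) auto
    moreover have "\<forall>\<^sub>F t in at t0. c t \<in> Rn n"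
      using c by (simp add: eventually_nhds_conv_at)
    ultimately show ?thesis
      by eventually_elim (auto simp: cube_def)
  qed
  have c0': "c t0 \<in> cube n (c t0) r"
    using r c0 open_Rn_subset[OF U] by (intro cube_centre) auto
  \<comment> \<open>The choice is meaningful only while \<open>c t\<close> lies in the cube, which
    holds for all t close to \<open>t0\<close>.\<close>
  define \<xi> where "\<xi> t = (SOME \<xi>. (\<forall>i<n. \<xi> i \<in> cube n (c t0) r \<and>
      (\<forall>j. \<bar>\<xi> i j - c t0 j\<bar> \<le> \<bar>c t j - c t0 j\<bar>)) \<and>
      f (c t) - f (c t0) = (\<Sum>i<n. partial_deriv i f (\<xi> i) * (c t i - c t0 i)))" for t
  have \<xi>: "(\<forall>i<n. \<xi> t i \<in> cube n (c t0) r \<and> (\<forall>j. \<bar>\<xi> t i j - c t0 j\<bar> \<le> \<bar>c t j - c t0 j\<bar>)) \<and>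
      f (c t) - f (c t0) = (\<Sum>i<n. partial_deriv i f (\<xi> t i) * (c t i - c t0 i))"
    if "c t \<in> cube n (c t0) r" for t
    using someI_ex[OF cube_mean_value[OF f r(2) that c0']] unfolding \<xi>_def .
  have lim: "((\<lambda>t. partial_deriv i f (\<xi> t i)) \<longlongrightarrow> partial_deriv i f (c t0)) (at t0)" if i: "i < n" for i
  proof (rule tendstoI)
    fix e :: real assume "e > 0"
    moreover have "continuous_on U (partial_deriv i f)"
      using f i by simp
    ultimately obtain s where s: "s > 0"
        "\<And>y. y \<in> cube n (c t0) s \<Longrightarrow> \<bar>partial_deriv i f y - partial_deriv i f (c t0)\<bar> < e"
      using continuous_on_cube[OF _ U c0] by blast
    show "\<forall>\<^sub>F t in at t0. dist (partial_deriv i f (\<xi> t i)) (partial_deriv i f (c t0)) < e"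
      using near[OF s(1)] near[OF r(1)]
    proof eventually_elim
      case (elim t)
      have "\<xi> t i \<in> cube n (c t0) s"
        unfolding cube_def
      proof (intro CollectI conjI allI impI)
        show "\<xi> t i \<in> Rn n" using \<xi>[OF elim(2)] i by (simp add: cube_def)
        fix j assume "j < n"
        then have "\<bar>c t j - c t0 j\<bar> < s" using elim(1) by (simp add: cube_def)
        then show "\<bar>\<xi> t i j - c t0 j\<bar> < s"
          using \<xi>[OF elim(2)] i by (meson le_less_trans)
      qed
      then show ?case using s(2) by (simp add: dist_real_def)
    qed
  qed
  have "((\<lambda>t. \<Sum>i<n. partial_deriv i f (\<xi> t i) * ((c t i - c t0 i) / (t - t0))) \<longlongrightarrow>
      (\<Sum>i<n. partial_deriv i f (c t0) * d i)) (at t0)"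
    using d by (intro tendsto_sum tendsto_mult lim) (auto simp: has_field_derivative_iff)
  moreover have "\<forall>\<^sub>F t in at t0. (\<Sum>i<n. partial_deriv i f (\<xi> t i) * ((c t i - c t0 i) / (t - t0))) =
      (f (c t) - f (c t0)) / (t - t0)"
    using near[OF r(1)] by eventually_elim (use \<xi> in \<open>simp add: sum_divide_distrib\<close>)
  ultimately show ?thesis
    unfolding has_field_derivative_iff by (rule Lim_transform_eventually)
qed


section \<open>Diffeological spaces\<close>

lemma smooth_map_incl:
  assumes "open_Rn n V" "V \<subseteq> U"
  shows "smooth_map n V n U (\<lambda>x. x)"
  using assms by (auto simp: smooth_map_def smooth_fun_coord)

lemma smooth_map_mono:
  "smooth_map m V n U f \<Longrightarrow> V' \<subseteq> V \<Longrightarrow> f ` V' \<subseteq> U' \<Longrightarrow> smooth_map m V' n U' f"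
  unfolding smooth_map_def by (blast intro: smooth_fun_subset)

lemma plot_openD: "diffeological_space X \<Longrightarrow> plot X n U P \<Longrightarrow> open_Rn n U"
  unfolding diffeological_space_def by (drule conjunct1) blast

lemma plot_carrier: "diffeological_space X \<Longrightarrow> plot X n U P \<Longrightarrow> u \<in> U \<Longrightarrow> P u \<in> carrier X"
  unfolding diffeological_space_def by (drule conjunct1) blast

lemma plot_const: "diffeological_space X \<Longrightarrow> open_Rn n U \<Longrightarrow> x \<in> carrier X \<Longrightarrow> plot X n U (\<lambda>_. x)"
  unfolding diffeological_space_def by (drule conjunct2, drule conjunct1) blast

lemma plot_local:
  "diffeological_space X \<Longrightarrow> open_Rn n U \<Longrightarrow> (\<And>u. u \<in> U \<Longrightarrow> \<exists>V. u \<in> V \<and> V \<subseteq> U \<and> plot X n V P) \<Longrightarrow>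
   plot X n U P"
  unfolding diffeological_space_def by (drule conjunct2, drule conjunct2, drule conjunct1) blast

lemma plot_comp:
  "diffeological_space X \<Longrightarrow> plot X n U P \<Longrightarrow> open_Rn m V \<Longrightarrow> smooth_map m V n U f \<Longrightarrow>
   (\<And>v. v \<in> V \<Longrightarrow> Q v = P (f v)) \<Longrightarrow> plot X m V Q"
  unfolding diffeological_space_def by (drule conjunct2, drule conjunct2, drule conjunct2) blast

lemma plot_restrict:
  "diffeological_space X \<Longrightarrow> plot X n U P \<Longrightarrow> open_Rn n V \<Longrightarrow> V \<subseteq> U \<Longrightarrow>
   (\<And>v. v \<in> V \<Longrightarrow> Q v = P v) \<Longrightarrow> plot X n V Q"
  by (rule plot_comp[where f = "\<lambda>x. x"]) (auto intro: smooth_map_incl)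

lemma plot_prod_diff:
  "plot (prod_diff X Y) n U P \<longleftrightarrow> plot X n U (\<lambda>u. fst (P u)) \<and> plot Y n U (\<lambda>u. snd (P u))"
  by (simp add: prod_diff_def)

lemma plot_sub_diff: "plot (sub_diff X A) n U P \<longleftrightarrow> plot X n U P \<and> P ` U \<subseteq> A"
  by (simp add: sub_diff_def)

lemma diffeological_sub_diff:
  assumes X: "diffeological_space X"
  shows "diffeological_space (sub_diff X A)"
  unfolding diffeological_space_def plot_sub_diff
proof (intro conjI allI impI)
  fix n U P assume *: "plot X n U P \<and> P ` U \<subseteq> A"
  show "open_Rn n U" using * plot_openD[OF X] by blast
  show "P ` U \<subseteq> carrier (sub_diff X A)"
    using * plot_carrier[OF X, of n U P] by (auto simp: sub_diff_def)
next
  fix n U x assume *: "open_Rn n U \<and> x \<in> carrier (sub_diff X A)"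
  show "plot X n U (\<lambda>_. x)" using * plot_const[OF X] by (simp add: sub_diff_def)
  show "(\<lambda>_. x) ` U \<subseteq> A" using * by (auto simp: sub_diff_def)
next
  fix n U P assume *: "open_Rn n U \<and> (\<forall>u\<in>U. \<exists>V. u \<in> V \<and> V \<subseteq> U \<and> plot X n V P \<and> P ` V \<subseteq> A)"
  then have "\<And>u. u \<in> U \<Longrightarrow> \<exists>V. u \<in> V \<and> V \<subseteq> U \<and> plot X n V P" by meson
  then show "plot X n U P" using * by (intro plot_local[OF X]) auto
  show "P ` U \<subseteq> A" using * by (meson image_subset_iff)
next
  fix n U P m V f Q
  assume *: "(plot X n U P \<and> P ` U \<subseteq> A) \<and> open_Rn m V \<and> smooth_map m V n U f \<and> (\<forall>v\<in>V. Q v = P (f v))"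
  show "plot X m V Q" by (rule plot_comp[OF X, of n U P m V f]) (use * in auto)
  show "Q ` V \<subseteq> A" using * by (auto simp: smooth_map_def)
qed

lemma dsmooth_plot: "dsmooth X Y f \<Longrightarrow> plot X n U P \<Longrightarrow> plot Y n U (\<lambda>u. f (P u))"
  by (simp add: dsmooth_def)

lemma D_open_plot: "D_open X A \<Longrightarrow> plot X n U P \<Longrightarrow> open_Rn n {u \<in> U. P u \<in> A}"
  by (simp add: D_open_def)

lemma D_open_vimage:
  assumes "diffeological_space X" "dsmooth X Y k" "D_open Y A"
  shows "D_open X {x \<in> carrier X. k x \<in> A}"
  unfolding D_open_def
proof (intro conjI allI impI)
  fix n U P assume P: "plot X n U P"
  have "{u \<in> U. P u \<in> {x \<in> carrier X. k x \<in> A}} = {u \<in> U. k (P u) \<in> A}"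
    using plot_carrier[OF assms(1) P] by auto
  then show "open_Rn n {u \<in> U. P u \<in> {x \<in> carrier X. k x \<in> A}}"
    using D_open_plot[OF assms(3) dsmooth_plot[OF assms(2) P]] by simp
qed auto

lemma smooth_nearI: "D_open X A \<Longrightarrow> x \<in> A \<Longrightarrow> smooth_real_on X A f \<Longrightarrow> smooth_near X x f"
  unfolding smooth_near_def openin_D_topology by blast

lemma smooth_near_comp:
  assumes X: "diffeological_space X" and k: "dsmooth X Y k" and x: "x \<in> carrier X"
    and f: "smooth_near Y (k x) f"
  shows "smooth_near X x (\<lambda>z. f (k z))"
proof -
  obtain A where A: "D_open Y A" "k x \<in> A" "smooth_real_on Y A f"
    using f unfolding smooth_near_def openin_D_topology by blast
  show ?thesis
  proof (rule smooth_nearI[OF D_open_vimage[OF X k A(1)]])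
    show "smooth_real_on X {x \<in> carrier X. k x \<in> A} (\<lambda>z. f (k z))"
      unfolding smooth_real_on_def
    proof (intro allI impI, elim conjE)
      fix n U P assume "plot X n U P" "P ` U \<subseteq> {x \<in> carrier X. k x \<in> A}"
      then have "plot Y n U (\<lambda>u. k (P u))" "(\<lambda>u. k (P u)) ` U \<subseteq> A"
        using dsmooth_plot[OF k] by auto
      then show "smooth_fun n U (\<lambda>u. f (k (P u)))"
        using A(3) unfolding smooth_real_on_def by blast
    qed
  qed (use A x in simp)
qed

lemma smooth_near_Int:
  assumes "smooth_near X x f" "smooth_near X x g"
    and h: "\<And>A. smooth_real_on X A f \<Longrightarrow> smooth_real_on X A g \<Longrightarrow> smooth_real_on X A h"
  shows "smooth_near X x h"
proof -
  obtain A B where AB: "openin (D_topology X) A" "x \<in> A" "smooth_real_on X A f"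
    "openin (D_topology X) B" "x \<in> B" "smooth_real_on X B g"
    using assms(1,2) unfolding smooth_near_def by blast
  moreover have "smooth_real_on X (A \<inter> B) f" "smooth_real_on X (A \<inter> B) g"
    using AB unfolding smooth_real_on_def by auto
  ultimately show ?thesis
    unfolding smooth_near_def using h by (meson IntI openin_Int)
qed

lemma smooth_near_lincomb:
  assumes X: "diffeological_space X" and "smooth_near X x f" "smooth_near X x g"
  shows "smooth_near X x (\<lambda>y. a * f y + b * g y)"
proof (rule smooth_near_Int[OF assms(2,3)])
  fix A assume f: "smooth_real_on X A f" and g: "smooth_real_on X A g"
  show "smooth_real_on X A (\<lambda>y. a * f y + b * g y)"
    unfolding smooth_real_on_def
  proof (intro allI impI)
    fix n U P assume P: "plot X n U P \<and> P ` U \<subseteq> A"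
    have U: "open_Rn n U" by (rule plot_openD[OF X conjunct1[OF P]])
    have "smooth_fun n U (\<lambda>u. f (P u))" "smooth_fun n U (\<lambda>u. g (P u))"
      using f g P unfolding smooth_real_on_def by auto
    then show "smooth_fun n U (\<lambda>u. (\<lambda>y. a * f y + b * g y) (P u))"
      by (intro smooth_fun_add smooth_fun_mult smooth_fun_const U)
  qed
qed

lemma smooth_near_mult:
  assumes X: "diffeological_space X" and "smooth_near X x f" "smooth_near X x g"
  shows "smooth_near X x (\<lambda>y. f y * g y)"
proof (rule smooth_near_Int[OF assms(2,3)])
  fix A assume f: "smooth_real_on X A f" and g: "smooth_real_on X A g"
  show "smooth_real_on X A (\<lambda>y. f y * g y)"
    unfolding smooth_real_on_def
  proof (intro allI impI)
    fix n U P assume P: "plot X n U P \<and> P ` U \<subseteq> A"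
    have U: "open_Rn n U" by (rule plot_openD[OF X conjunct1[OF P]])
    have "smooth_fun n U (\<lambda>u. f (P u))" "smooth_fun n U (\<lambda>u. g (P u))"
      using f g P unfolding smooth_real_on_def by auto
    then show "smooth_fun n U (\<lambda>u. (\<lambda>y. f y * g y) (P u))"
      by (intro smooth_fun_mult U)
  qed
qed

lemma plot_smooth_near:
  assumes X: "diffeological_space X" and P: "plot X n U P" "u \<in> U" and f: "smooth_near X (P u) f"
  shows "\<exists>W. open_Rn n W \<and> u \<in> W \<and> W \<subseteq> U \<and> smooth_fun n W (\<lambda>u. f (P u))"
proof -
  obtain A where A: "D_open X A" "P u \<in> A" "smooth_real_on X A f"
    using f unfolding smooth_near_def openin_D_topology by blast
  have W: "open_Rn n {u \<in> U. P u \<in> A}"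
    using A(1) P(1) by (rule D_open_plot)
  then have "plot X n {u \<in> U. P u \<in> A} P"
    using plot_restrict[OF X P(1) W] by auto
  then have "smooth_fun n {u \<in> U. P u \<in> A} (\<lambda>u. f (P u))"
    using A(3) unfolding smooth_real_on_def by auto
  then show ?thesis using W A(2) P(2) by blast
qed


section \<open>Charts\<close>

lemma chart_plot: "chart X n U F \<Longrightarrow> plot X n U F"
  and chart_inj: "chart X n U F \<Longrightarrow> inj_on F U"
  and chart_D_open: "chart X n U F \<Longrightarrow> D_open X (F ` U)"
  by (simp_all add: chart_def)

lemma chart_smooth:
  "chart X n U F \<Longrightarrow> plot X m V P \<Longrightarrow> (\<And>v. v \<in> V \<Longrightarrow> P v \<in> F ` U) \<Longrightarrow>
   smooth_map m V n U (\<lambda>v. inv_into U F (P v))"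
  unfolding chart_def by blast

lemma chart_coord_smooth_near:
  assumes "chart X n U F" "x \<in> F ` U" "i < n"
  shows "smooth_near X x (\<lambda>y. inv_into U F y i)"
  by (rule smooth_nearI[OF chart_D_open[OF assms(1)] assms(2)])
    (use assms(1,3) in \<open>auto simp: smooth_real_on_def chart_def smooth_map_def\<close>)

text \<open>Where P takes values in the chart, lying in the image of V is a condition on its smooth
  coordinate expression, so the set in question is a preimage of V.\<close>

lemma chart_D_open_image:
  assumes X: "diffeological_space X" and F: "chart X n U F" and V: "open_Rn n V" "V \<subseteq> U"
  shows "D_open X (F ` V)"
  unfolding D_open_def
proof (intro conjI allI impI)
  show "F ` V \<subseteq> carrier X"
    using plot_carrier[OF X chart_plot[OF F]] V by blast
  fix m W P assume P: "plot X m W P"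
  define W' where "W' = {w \<in> W. P w \<in> F ` U}"
  have W': "open_Rn m W'"
    unfolding W'_def by (rule D_open_plot[OF chart_D_open[OF F] P])
  have "plot X m W' P"
    by (rule plot_restrict[OF X P W']) (auto simp: W'_def)
  then have s: "smooth_map m W' n U (\<lambda>w. inv_into U F (P w))"
    by (rule chart_smooth[OF F]) (simp add: W'_def)
  have eq: "{w \<in> W. P w \<in> F ` V} = {w \<in> W'. inv_into U F (P w) \<in> V}"
    using V chart_inj[OF F] by (auto simp: W'_def f_inv_into_f intro!: image_eqI)
  have U: "U \<subseteq> Rn n"
    by (rule open_Rn_subset[OF plot_openD[OF X chart_plot[OF F]]])
  show "open_Rn m {w \<in> W. P w \<in> F ` V}"
    unfolding eq by (rule open_Rn_vimage[OF s W' U V(1)])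
qed


section \<open>Velocities of curves\<close>

abbreviation interval1 :: "real \<Rightarrow> vec set" where
  "interval1 r \<equiv> cube 1 (\<lambda>_. 0) r"

definition line :: "real \<Rightarrow> vec" where
  "line t = (\<lambda>i. if i = 0 then t else 0)"

text \<open>Smoothness for small times is all that \<open>velocity\<close> sees; local integral
  curves and lines in a plot domain are defined only for such times.\<close>

definition smooth_germ :: "'a diffspace \<Rightarrow> (real \<Rightarrow> 'a) \<Rightarrow> bool" where
  "smooth_germ X c \<longleftrightarrow> (\<exists>r>0. plot X 1 (interval1 r) (\<lambda>u. c (u 0)))"

lemma line_0 [simp]: "line t 0 = t"
  by (simp add: line_def)

lemma line_Rn1: "line t \<in> Rn 1"
  by (simp add: Rn_iff line_def)

lemma line_interval1: "line t \<in> interval1 r \<longleftrightarrow> \<bar>t\<bar> < r"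
  by (auto simp: cube_def line_Rn1[simplified])

declare line_interval1 [unfolded One_nat_def, simp]

lemma line_upd [simp]: "(line s)(0 := t) = line t"
  by (auto simp: line_def)

lemma smooth_map_line:
  assumes "open_Rn n U" "smooth_fun n U g" "\<And>u. u \<in> U \<Longrightarrow> line (g u) \<in> V"
  shows "smooth_map n U 1 V (\<lambda>u. line (g u))"
  using assms by (auto simp: smooth_map_def)

lemma smooth_germ_comp:
  assumes "dsmooth X Y k" "smooth_germ X c"
  shows "smooth_germ Y (\<lambda>t. k (c t))"
  using assms dsmooth_plot unfolding smooth_germ_def by blast

lemma smooth_germ_eventually:
  assumes X: "diffeological_space X" and c: "smooth_germ X c" and A: "D_open X A" "c 0 \<in> A"
  shows "\<forall>\<^sub>F t in nhds 0. c t \<in> A"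
proof -
  obtain r where r: "r > 0" "plot X 1 (interval1 r) (\<lambda>u. c (u 0))"
    using c unfolding smooth_germ_def by blast
  have "line 0 \<in> {u \<in> interval1 r. c (u 0) \<in> A}"
    using r A by simp
  from eventually_upd_open_Rn[OF D_open_plot[OF A(1) r(2)] this, of 0] show ?thesis
    by (auto elim: eventually_mono)
qed

text \<open>\<open>velocity\<close> is defined by \<open>deriv\<close>, which is informative only
  once differentiability is known; it comes from smoothness of the germ.\<close>

lemma velocity_has_deriv:
  assumes X: "diffeological_space X" and c: "smooth_germ X c" and f: "smooth_near X (c 0) f"
  shows "((\<lambda>t. f (c t)) has_real_derivative velocity X c f) (at 0)"
proof -
  obtain r where r: "r > 0" "plot X 1 (interval1 r) (\<lambda>u. c (u 0))"
    using c unfolding smooth_germ_def by blast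
  then obtain W where W: "line 0 \<in> W" "smooth_fun 1 W (\<lambda>u. f (c (u 0)))"
    using plot_smooth_near[OF X r(2), of "line 0" f] f by auto
  from smooth_fun_has_partial_deriv[OF W(2,1), of 0]
  have "(\<lambda>t. f (c t)) differentiable (at 0)"
    using real_differentiable_def by auto
  then show ?thesis
    using f by (simp add: velocity_def DERIV_deriv_iff_real_differentiable)
qed

lemma velocity_eqI:
  assumes "smooth_near X (c 0) f" "((\<lambda>t. f (c t)) has_real_derivative d) (at 0)"
  shows "velocity X c f = d"
  using assms by (simp add: velocity_def DERIV_imp_deriv)

lemma smooth_germ_values:
  assumes "diffeological_space X" "smooth_germ X c"
  shows "\<forall>\<^sub>F t in nhds 0. c t \<in> carrier X"
proof -
  obtain r where r: "r > 0" "plot X 1 (interval1 r) (\<lambda>u. c (u 0))"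
    using assms(2) unfolding smooth_germ_def by blast
  have "c t \<in> carrier X" if "dist t 0 < r" for t
    using plot_carrier[OF assms(1) r(2), of "line t"] that by (simp add: dist_real_def)
  then show ?thesis unfolding eventually_nhds_metric using r(1) by blast
qed

lemma velocity_cong_ev:
  assumes "\<forall>\<^sub>F t in nhds 0. c t = c' t"
  shows "velocity X c = velocity X c'"
proof
  fix f
  have "c 0 = c' 0" using assms by (rule eventually_nhds_x_imp_x)
  moreover have "deriv (\<lambda>t. f (c t)) 0 = deriv (\<lambda>t. f (c' t)) 0"
    by (rule deriv_cong_ev[OF eventually_mono[OF assms]]) auto
  ultimately show "velocity X c f = velocity X c' f" by (simp add: velocity_def)
qed

lemma velocity_tangent_space:
  assumes X: "diffeological_space X" and c: "smooth_germ X c"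
  shows "velocity X c \<in> tangent_space X (c 0)"
  unfolding tangent_space_def
proof (intro CollectI conjI allI impI)
  show "velocity X c f = 0" if "\<not> smooth_near X (c 0) f" for f
    using that by (simp add: velocity_def)
next
  fix f g
  assume *: "smooth_near X (c 0) f \<and> smooth_near X (c 0) g \<and>
    (\<exists>A. openin (D_topology X) A \<and> c 0 \<in> A \<and> (\<forall>y\<in>A. f y = g y))"
  then obtain A where A: "D_open X A" "c 0 \<in> A" "\<And>y. y \<in> A \<Longrightarrow> f y = g y"
    unfolding openin_D_topology by blast
  have "\<forall>\<^sub>F t in nhds 0. f (c t) = g (c t)"
    by (rule eventually_mono[OF smooth_germ_eventually[OF X c A(1,2)]]) (rule A(3))
  then have "deriv (\<lambda>t. f (c t)) 0 = deriv (\<lambda>t. g (c t)) 0"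
    by (rule deriv_cong_ev) simp
  then show "velocity X c f = velocity X c g"
    using * by (simp add: velocity_def)
next
  fix f g a b
  assume *: "smooth_near X (c 0) f \<and> smooth_near X (c 0) g"
  note df = velocity_has_deriv[OF X c conjunct1[OF *]] and dg = velocity_has_deriv[OF X c conjunct2[OF *]]
  show "velocity X c (\<lambda>y. a * f y + b * g y) = a * velocity X c f + b * velocity X c g"
    using * X by (intro velocity_eqI smooth_near_lincomb DERIV_add DERIV_cmult df dg) auto
  show "velocity X c (\<lambda>y. f y * g y) = f (c 0) * velocity X c g + velocity X c f * g (c 0)"
    using * X DERIV_mult[OF df dg] by (intro velocity_eqI smooth_near_mult) (auto simp: algebra_simps)
qed

lemma velocity_comp:
  assumes "diffeological_space X" "dsmooth X Y k" "c 0 \<in> carrier X" "smooth_near Y (k (c 0)) f"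
  shows "velocity Y (\<lambda>t. k (c t)) f = velocity X c (\<lambda>z. f (k z))"
  using assms(4) smooth_near_comp[OF assms] by (simp add: velocity_def)

text \<open>This takes the place of the tangent map of k: \<open>velocity_comp\<close> evaluates the
  image velocity at f as the velocity of c at f composed with k, so the rest of c does not
  enter.\<close>

lemma velocity_comp_cong:
  assumes "diffeological_space X" "dsmooth X Y k" "c 0 \<in> carrier X" "c 0 = c' 0"
    and "velocity X c = velocity X c'"
  shows "velocity Y (\<lambda>t. k (c t)) = velocity Y (\<lambda>t. k (c' t))"
proof
  fix f show "velocity Y (\<lambda>t. k (c t)) f = velocity Y (\<lambda>t. k (c' t)) f"
  proof (cases "smooth_near Y (k (c 0)) f")
    case True
    then show ?thesis using velocity_comp[of X Y k _ f] assms by metis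
  next
    case False
    then show ?thesis using assms(4) by (simp add: velocity_def)
  qed
qed

text \<open>The chain rule along t \<mapsto> (ta, tb) gives an expression linear in (a, b),
  evaluated at (1, 1), (1, 0) and (0, 1). If f is not smooth near the common base point, all three
  velocities are 0 by definition.\<close>

lemma velocity_diagonal:
  assumes X: "diffeological_space X" and r: "r > 0"
    and S: "plot X 2 (cube 2 (\<lambda>_. 0) r) (\<lambda>w. S (w 0) (w 1))"
  shows "velocity X (\<lambda>t. S t t) f = velocity X (\<lambda>t. S t 0) f + velocity X (\<lambda>t. S 0 t) f"
proof (cases "smooth_near X (S 0 0) f")
  case True
  have o: "(\<lambda>_. 0) \<in> cube 2 (\<lambda>_. 0) r"
    using r by (intro cube_centre) (auto simp: Rn_iff)
  obtain W where W: "open_Rn 2 W" "(\<lambda>_. 0) \<in> W" "smooth_fun 2 W (\<lambda>w. f (S (w 0) (w 1)))"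
    using plot_smooth_near[OF X S o] True by auto
  define p where "p i = partial_deriv i (\<lambda>w. f (S (w 0) (w 1))) (\<lambda>_. 0)" for i
  have chain: "((\<lambda>t. f (S (t * a) (t * b))) has_real_derivative p 0 * a + p 1 * b) (at 0)" for a b
  proof -
    define c where "c t = (\<lambda>i::nat. if i = 0 then t * a else if i = 1 then t * b else 0)" for t
    have "((\<lambda>t. f (S (c t 0) (c t 1))) has_real_derivative
        (\<Sum>i<2. partial_deriv i (\<lambda>w. f (S (w 0) (w 1))) (c 0) * (if i = 0 then a else b))) (at 0)"
    proof (rule chain_rule_curve[OF W(1) smooth_fun_Ck[OF W(3)]])
      show "c 0 \<in> W" using W(2) by (simp add: c_def if_distrib cong: if_cong)
      show "\<forall>\<^sub>F t in nhds 0. c t \<in> Rn 2" by (simp add: c_def Rn_iff)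
      show "((\<lambda>t. c t i) has_real_derivative (if i = 0 then a else b)) (at 0)" if "i < 2" for i
        using that by (auto simp: c_def intro!: derivative_eq_intros)
    qed
    moreover have "c 0 = (\<lambda>_. 0)" by (auto simp: c_def)
    ultimately show ?thesis
      by (simp add: p_def c_def numeral_2_eq_2)
  qed
  have "velocity X (\<lambda>t. S t t) f = p 0 + p 1"
    using chain[of 1 1] True by (intro velocity_eqI) auto
  moreover have "velocity X (\<lambda>t. S t 0) f = p 0"
    using chain[of 1 0] True by (intro velocity_eqI) auto
  moreover have "velocity X (\<lambda>t. S 0 t) f = p 1"
    using chain[of 0 1] True by (intro velocity_eqI) auto
  ultimately show ?thesis by simp
qed (simp add: velocity_def)


section \<open>Lines in the domain of a plot\<close>

lemma open_Rn_line:
  assumes U: "open_Rn n U" and u: "u \<in> U" and v: "v \<in> Rn n"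
  shows "\<exists>r>0. \<forall>t. \<bar>t\<bar> < r \<longrightarrow> (\<lambda>i. u i + t * v i) \<in> U"
proof -
  obtain e where e: "e > 0" "cube n u e \<subseteq> U"
    using open_RnD[OF U u] by blast
  \<comment> \<open>The summand 1 makes M positive even for v = 0, so that e / M is a valid
    radius.\<close>
  define M where "M = (\<Sum>i<n. \<bar>v i\<bar>) + 1"
  have M: "M > 0" "\<bar>v i\<bar> < M" if "i < n" for i
    using member_le_sum[of i "{..<n}" "\<lambda>i. \<bar>v i\<bar>"] that by (auto simp: M_def sum_nonneg add_nonneg_pos)
  have "M > 0" by (simp add: M_def sum_nonneg add_nonneg_pos)
  have "(\<lambda>i. u i + t * v i) \<in> U" if t: "\<bar>t\<bar> < e / M" for t
  proof (rule subsetD[OF e(2)])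
    have "\<bar>t * v i\<bar> < e" if "i < n" for i
    proof -
      have "\<bar>t * v i\<bar> \<le> \<bar>t\<bar> * M"
        using M(2)[OF that] by (simp add: abs_mult mult_left_mono)
      also have "\<dots> < e" using t \<open>M > 0\<close> by (simp add: pos_less_divide_eq)
      finally show ?thesis .
    qed
    moreover have "u \<in> Rn n" using U u open_Rn_subset by blast
    ultimately show "(\<lambda>i. u i + t * v i) \<in> cube n u e"
      using v by (auto simp: cube_def Rn_iff)
  qed
  then show ?thesis using e(1) \<open>M > 0\<close> by (intro exI[of _ "e / M"]) auto
qed

lemma eventually_open_Rn_line:
  assumes "open_Rn n U" "u \<in> U" "v \<in> Rn n"
  shows "\<forall>\<^sub>F t in nhds 0. (\<lambda>i. u i + t * v i) \<in> U"
  using open_Rn_line[OF assms] unfolding eventually_nhds_metric by (simp add: dist_real_def)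

text \<open>The tangent vector DP(v) at u, as a derivation on X.\<close>

definition dir_velocity :: "'a diffspace \<Rightarrow> (vec \<Rightarrow> 'a) \<Rightarrow> vec \<Rightarrow> vec \<Rightarrow> 'a tvec" where
  "dir_velocity X P u v = velocity X (\<lambda>t. P (\<lambda>i. u i + t * v i))"

lemma smooth_fun_affine: "open_Rn m W \<Longrightarrow> smooth_fun m W g \<Longrightarrow> smooth_fun m W (\<lambda>w. a + g w * b)"
  by (intro smooth_fun_add smooth_fun_mult smooth_fun_const)

lemma smooth_germ_line:
  assumes X: "diffeological_space X" and P: "plot X n U P" "u \<in> U" and v: "v \<in> Rn n"
  shows "smooth_germ X (\<lambda>t. P (\<lambda>i. u i + t * v i))"
proof -
  obtain r where r: "r > 0" "\<And>t. \<bar>t\<bar> < r \<Longrightarrow> (\<lambda>i. u i + t * v i) \<in> U"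
    using open_Rn_line[OF plot_openD[OF X P(1)] P(2) v] by blast
  have "smooth_map 1 (interval1 r) n U (\<lambda>w i. u i + w 0 * v i)"
    unfolding smooth_map_def
  proof (intro conjI allI impI)
    show "(\<lambda>w i. u i + w 0 * v i) ` interval1 r \<subseteq> U"
      using r(2) by (auto simp: cube_def)
  qed (intro smooth_fun_affine smooth_fun_coord open_Rn_cube)
  then have "plot X 1 (interval1 r) (\<lambda>w. P (\<lambda>i. u i + w 0 * v i))"
    by (rule plot_comp[OF X P(1) open_Rn_cube]) simp
  then show ?thesis
    unfolding smooth_germ_def using r(1) by (intro exI conjI)
qed

text \<open>Used for a plot in the zero level and a component of the moment map: the component has
  zero derivative along every curve in the level.\<close>

lemma dir_velocity_vanish:
  assumes X: "diffeological_space X" and P: "plot X n U P" "u \<in> U" "v \<in> Rn n" and f: "\<And>w. w \<in> U \<Longrightarrow> f (P w) = 0"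
  shows "dir_velocity X P u v f = 0"
proof -
  have "\<forall>\<^sub>F t in nhds 0. f (P (\<lambda>i. u i + t * v i)) = 0"
    by (rule eventually_mono[OF eventually_open_Rn_line[OF plot_openD[OF X P(1)] P(2,3)]]) (rule f)
  then have "deriv (\<lambda>t. f (P (\<lambda>i. u i + t * v i))) 0 = deriv (\<lambda>t. 0) 0"
    by (rule deriv_cong_ev) simp
  then show ?thesis by (simp add: dir_velocity_def velocity_def)
qed


section \<open>Ordinary differential equations\<close>

text \<open>The function h below dominates all first partial derivatives at once and, by continuity,
  exceeds its value at \<open>x0\<close> by less than 1 on a small cube. The bound m stands for the
  maximum norm of x - y; summing over n coordinates gives the constant n K.\<close>

lemma smooth_lipschitz_cube:
  assumes U: "open_Rn n U" and f: "\<And>i. i < n \<Longrightarrow> smooth_fun n U (f i)" and x0: "x0 \<in> U"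
  shows "\<exists>\<delta>>0. \<exists>L\<ge>0. cube n x0 \<delta> \<subseteq> U \<and>
    (\<forall>i<n. \<forall>x\<in>cube n x0 \<delta>. \<forall>y\<in>cube n x0 \<delta>. \<forall>m. (\<forall>j<n. \<bar>x j - y j\<bar> \<le> m) \<longrightarrow>
       \<bar>f i x - f i y\<bar> \<le> L * m)"
proof -
  define h where "h x = (\<Sum>i<n. \<Sum>j<n. \<bar>partial_deriv j (f i) x\<bar>)" for x
  have "continuous_on U h"
    unfolding h_def using f
    by (intro continuous_on_sum continuous_on_rabs smooth_fun_continuous smooth_fun_partial) auto
  from continuous_on_cube[OF this U x0, of 1] obtain \<delta> where \<delta>: "\<delta> > 0"
    "\<And>y. y \<in> cube n x0 \<delta> \<Longrightarrow> y \<in> U" "\<And>y. y \<in> cube n x0 \<delta> \<Longrightarrow> \<bar>h y - h x0\<bar> < 1"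
    by auto
  define K where "K = h x0 + 1"
  have pK: "\<bar>partial_deriv j (f i) y\<bar> \<le> K" if "y \<in> cube n x0 \<delta>" "i < n" "j < n" for i j y
  proof -
    have "\<bar>partial_deriv j (f i) y\<bar> \<le> (\<Sum>j<n. \<bar>partial_deriv j (f i) y\<bar>)"
      using that by (intro member_le_sum[of j]) auto
    also have "\<dots> \<le> h y"
      unfolding h_def using that
      by (intro member_le_sum[of i _ "\<lambda>i. \<Sum>j<n. \<bar>partial_deriv j (f i) y\<bar>"]) (auto intro: sum_nonneg)
    also have "\<dots> \<le> K" using \<delta>(3)[OF that(1)] by (simp add: K_def)
    finally show ?thesis .
  qed
  have "h x0 \<ge> 0" unfolding h_def by (intro sum_nonneg) auto
  then have "K \<ge> 0" by (simp add: K_def)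
  have sub: "cube n x0 \<delta> \<subseteq> U" using \<delta>(2) by blast
  have "\<bar>f i x - f i y\<bar> \<le> (real n * K) * m"
    if i: "i < n" and x: "x \<in> cube n x0 \<delta>" and y: "y \<in> cube n x0 \<delta>"
      and m: "\<forall>j<n. \<bar>x j - y j\<bar> \<le> m" for i x y m
  proof -
    obtain \<xi> where \<xi>: "\<And>j. j < n \<Longrightarrow> \<xi> j \<in> cube n x0 \<delta>"
      "f i x - f i y = (\<Sum>j<n. partial_deriv j (f i) (\<xi> j) * (x j - y j))"
      using cube_mean_value[OF smooth_fun_Ck[OF f[OF i]] sub x y] by blast
    have "\<bar>f i x - f i y\<bar> \<le> (\<Sum>j<n. \<bar>partial_deriv j (f i) (\<xi> j) * (x j - y j)\<bar>)"
      unfolding \<xi>(2) by (rule sum_abs)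
    also have "\<dots> \<le> (\<Sum>j<n. K * m)"
      using \<xi>(1) i m \<open>K \<ge> 0\<close> pK by (intro sum_mono) (auto simp: abs_mult intro!: mult_mono)
    finally show ?thesis by simp
  qed
  then show ?thesis
    using \<delta>(1) sub \<open>K \<ge> 0\<close> by (intro exI[of _ \<delta>] conjI exI[of _ "real n * K"]) auto
qed

text \<open>Take a time s at which the sum D of the coordinate distances is largest. The mean value
  theorem between 0 and s bounds each coordinate distance at s by L a D(s), hence D(s) \<le> n L a
  D(s), and n L a < 1 forces D(s) = 0.\<close>

lemma ode_unique:
  fixes x y :: "real \<Rightarrow> vec"
  assumes lip: "\<And>i u v m. i < n \<Longrightarrow> u \<in> V \<Longrightarrow> v \<in> V \<Longrightarrow> (\<And>j. j < n \<Longrightarrow> \<bar>u j - v j\<bar> \<le> m) \<Longrightarrow>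
      \<bar>f i u - f i v\<bar> \<le> L * m"
    and L: "L \<ge> 0" "real n * L * a < 1" and V: "V \<subseteq> Rn n" and init: "x 0 = y 0"
    and x: "\<And>t. \<bar>t\<bar> \<le> a \<Longrightarrow> x t \<in> V" "\<And>i t. i < n \<Longrightarrow> \<bar>t\<bar> \<le> a \<Longrightarrow> ((\<lambda>t. x t i) has_real_derivative f i (x t)) (at t)"
    and y: "\<And>t. \<bar>t\<bar> \<le> a \<Longrightarrow> y t \<in> V" "\<And>i t. i < n \<Longrightarrow> \<bar>t\<bar> \<le> a \<Longrightarrow> ((\<lambda>t. y t i) has_real_derivative f i (y t)) (at t)"
    and t: "\<bar>t\<bar> \<le> a"
  shows "x t = y t"
proof -
  define D where "D t = (\<Sum>i<n. \<bar>x t i - y t i\<bar>)" for t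
  have "a \<ge> 0" using t by linarith
  have "continuous_on {-a..a} (\<lambda>t. x t i)" "continuous_on {-a..a} (\<lambda>t. y t i)" if "i < n" for i
    using x(2)[OF that] y(2)[OF that]
    by (intro continuous_at_imp_continuous_on ballI DERIV_isCont[OF x(2)[OF that]]
        DERIV_isCont[OF y(2)[OF that]]; simp add: abs_le_iff)+
  then have "continuous_on {-a..a} D"
    unfolding D_def by (intro continuous_on_sum continuous_on_rabs continuous_on_diff) auto
  then obtain s where s: "\<bar>s\<bar> \<le> a" "\<And>t. \<bar>t\<bar> \<le> a \<Longrightarrow> D t \<le> D s"
    using continuous_attains_sup[of "{-a..a}" D] \<open>a \<ge> 0\<close> by (force simp: abs_le_iff)
  have le: "\<bar>x t i - y t i\<bar> \<le> D s" if "i < n" "\<bar>t\<bar> \<le> a" for i t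
  proof -
    have "\<bar>x t i - y t i\<bar> \<le> D t"
      unfolding D_def using that by (intro member_le_sum[of i]) auto
    then show ?thesis using s(2)[OF that(2)] by linarith
  qed
  have D0: "D s \<ge> 0" unfolding D_def by (intro sum_nonneg) auto
  have "\<bar>x s i - y s i\<bar> \<le> L * a * D s" if i: "i < n" for i
  proof -
    have "\<exists>r. min 0 s \<le> r \<and> r \<le> max 0 s \<and>
        (x s i - y s i) - (x 0 i - y 0 i) = (f i (x r) - f i (y r)) * (s - 0)"
      using s(1) by (intro mean_value_segment DERIV_diff x(2) y(2) i) auto
    then obtain r where r: "\<bar>r\<bar> \<le> a" "x s i - y s i = (f i (x r) - f i (y r)) * s"
    proof (elim exE)
      fix r assume r: "min 0 s \<le> r \<and> r \<le> max 0 s \<and>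
        (x s i - y s i) - (x 0 i - y 0 i) = (f i (x r) - f i (y r)) * (s - 0)"
      then have "\<bar>r\<bar> \<le> a" using s(1) by linarith
      then show thesis using r init that by simp
    qed
    have "\<bar>f i (x r) - f i (y r)\<bar> \<le> L * D s"
      by (intro lip i x(1) y(1) r(1) le)
    then have "\<bar>x s i - y s i\<bar> \<le> (L * D s) * a"
      unfolding r(2) abs_mult using s(1) L D0 by (intro mult_mono) auto
    then show ?thesis by (simp add: mult_ac)
  qed
  then have "D s \<le> (\<Sum>i<n. L * a * D s)"
    unfolding D_def[of s] by (intro sum_mono) (simp add: D_def)
  then have "D s * (1 - real n * L * a) \<le> 0"
    by (simp add: algebra_simps)
  then have "D s = 0"
    using L(2) D0 by (metis diff_gt_0_iff_gt mult_pos_pos not_less order_le_less)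
  then have "x t i = y t i" if "i < n" for i
    using le[OF that t] by simp
  moreover have "x t i = y t i" if "\<not> i < n" for i
    using x(1)[OF t] y(1)[OF t] V that unfolding subset_iff Rn_iff by (metis not_less)
  ultimately show ?thesis by blast
qed

text \<open>Near a point of the product the discrete coordinate is constant.\<close>

lemma continuous_on_discrete_prod:
  fixes G :: "'a discrete \<Rightarrow> 'b::t2_space \<Rightarrow> 'c::topological_space"
  assumes "\<And>i. continuous_on UNIV (G i)"
  shows "continuous_on UNIV (\<lambda>p. G (fst p) (snd p))"
proof -
  have "isCont (\<lambda>p. G (fst p) (snd p)) p" for p
  proof -
    have "\<forall>\<^sub>F q in nhds p. q \<in> {fst p} \<times> UNIV"
      by (rule eventually_nhds_in_open) (auto intro: open_Times open_discrete simp: mem_Times_iff)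
    then have "\<forall>\<^sub>F q in at p. G (fst p) (snd q) = G (fst q) (snd q)"
      unfolding eventually_at_filter by eventually_elim auto
    moreover have "isCont (\<lambda>q. G (fst p) (snd q)) p"
      using assms[of "fst p"] by (intro isCont_o2[OF isCont_snd]) (auto simp: continuous_on_eq_continuous_at)
    ultimately show ?thesis
      unfolding isCont_def by (rule Lim_transform_eventually[rotated])
  qed
  then show ?thesis by (simp add: continuous_at_imp_continuous_on)
qed

text \<open>Picard iteration with \<open>f\<close> made globally Lipschitz by clamping its argument to a smaller cube.
  The dimension \<open>n\<close> is not a type, so a curve in \<open>\<real>\<^sup>n\<close> is one bounded function of the index and the
  time; the index is a \<open>discrete\<close> because completeness of \<open>\<Rightarrow>\<^sub>C\<close> is available on metric spaces only.\<close>

lemma ode_exists: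
  assumes \<delta>: "\<delta> > 0" and x0: "x0 \<in> Rn n" and L: "L \<ge> 0"
    and lip: "\<And>i u v m. i < n \<Longrightarrow> u \<in> cube n x0 \<delta> \<Longrightarrow> v \<in> cube n x0 \<delta> \<Longrightarrow>
      (\<And>j. j < n \<Longrightarrow> \<bar>u j - v j\<bar> \<le> m) \<Longrightarrow> \<bar>f i u - f i v\<bar> \<le> L * m"
    and cont: "\<And>i. i < n \<Longrightarrow> continuous_on (cube n x0 \<delta>) (f i)"
  shows "\<exists>a>0. \<exists>x. x 0 = x0 \<and> (\<forall>t. \<bar>t\<bar> < a \<longrightarrow> x t \<in> cube n x0 \<delta> \<and>
    (\<forall>i<n. ((\<lambda>t. x t i) has_real_derivative f i (x t)) (at t)))"
proof -
  \<comment> \<open>Half the radius, because \<open>cube\<close> is open and the clamped point must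
    lie strictly inside it.\<close>
  define clamp where "clamp v = (\<lambda>i. if i < n then max (x0 i - \<delta>/2) (min (x0 i + \<delta>/2) (v i)) else 0)" for v :: vec
  have clamp: "clamp v \<in> cube n x0 \<delta>" for v
    using \<delta> by (auto simp: clamp_def cube_def Rn_iff abs_less_iff max_def min_def)
  have clamp_lip: "\<bar>clamp v j - clamp w j\<bar> \<le> \<bar>v j - w j\<bar>" for v w j
    by (simp add: clamp_def max_def min_def)
  define g where "g i v = f i (clamp v)" for i v
  \<comment> \<open>The value at the centre plus the largest Lipschitz variation over the cube
    bounds the clamped field; the summand 1 makes M positive.\<close>
  define M where "M = (\<Sum>i<n. \<bar>f i x0\<bar>) + L * \<delta> + 1"
  have M: "M > 0" unfolding M_def using L \<delta> by (intro add_nonneg_pos add_nonneg_nonneg sum_nonneg) auto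
  have gM: "\<bar>g i v\<bar> \<le> M" if i: "i < n" for i v
  proof -
    have x0c: "x0 \<in> cube n x0 \<delta>" using x0 \<delta> by (rule cube_centre)
    have "\<bar>clamp v j - x0 j\<bar> \<le> \<delta>" if "j < n" for j
      using clamp[of v] that by (auto simp: cube_def intro: less_imp_le)
    then have "\<bar>g i v - f i x0\<bar> \<le> L * \<delta>"
      unfolding g_def by (rule lip[OF i clamp x0c])
    moreover have "\<bar>f i x0\<bar> \<le> (\<Sum>i<n. \<bar>f i x0\<bar>)"
      using i by (intro member_le_sum[of i]) auto
    ultimately show ?thesis unfolding M_def by linarith
  qed
  have glip: "\<bar>g i v - g i w\<bar> \<le> L * m" if "i < n" "\<And>j. \<bar>v j - w j\<bar> \<le> m" for i v w m
    unfolding g_def by (rule lip[OF that(1) clamp clamp]) (rule order_trans[OF clamp_lip that(2)])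
  \<comment> \<open>The first bound keeps the solution within \<delta>/2 of \<open>x0\<close>, where
    clamping has no effect. The second gives 4 a L \<le> 1/2, the contraction factor: two integrals
    enter, each over an interval of length at most 2 a.\<close>
  define a where "a = min (\<delta> / (4 * M)) (1 / (8 * (L + 1)))"
  have a: "a > 0" "a * M < \<delta> / 2" "4 * a * L \<le> 1 / 2"
  proof -
    show "a > 0" unfolding a_def using \<delta> M L by simp
    have "a * M \<le> \<delta> / (4 * M) * M" unfolding a_def using M by (intro mult_right_mono) auto
    also have "\<dots> < \<delta> / 2" using M \<delta> by (simp add: field_simps)
    finally show "a * M < \<delta> / 2" .
    have "4 * a * L \<le> 4 * (1 / (8 * (L + 1))) * L" unfolding a_def using L by (intro mult_right_mono mult_left_mono) auto
    also have "\<dots> \<le> 1 / 2" using L by (simp add: field_simps)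
    finally show "4 * a * L \<le> 1 / 2" .
  qed
  \<comment> \<open>Freezing time outside [-a, a] makes the iterates bounded continuous functions on
    the whole line.\<close>
  define cl where "cl t = max (-a) (min a t)" for t
  have cl: "-a \<le> cl t" "cl t \<le> a" for t using a(1) by (auto simp: cl_def)
  define h where "h u i s = g i (\<lambda>j. apply_bcontfun u (discrete j, s))" for u :: "(nat discrete \<times> real) \<Rightarrow>\<^sub>C real" and i s
  have hcont: "continuous_on S (h u i)" if i: "i < n" for u i S
  proof -
    have cu: "continuous_on S (\<lambda>s. apply_bcontfun u (discrete j, s))" for j
      by (rule continuous_on_compose2[OF continuous_on_apply_bcontfun[of UNIV]]) (auto intro!: continuous_intros)
    have "continuous_on S (\<lambda>s. clamp (\<lambda>j. apply_bcontfun u (discrete j, s)) k)" for k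
      unfolding clamp_def by (cases "k < n") (auto intro!: continuous_intros cu)
    then have "continuous_on S (\<lambda>s. clamp (\<lambda>j. apply_bcontfun u (discrete j, s)))"
      by (rule continuous_on_coordinatewise_then_product)
    then have "continuous_on S (\<lambda>s. f i (clamp (\<lambda>j. apply_bcontfun u (discrete j, s))))"
      using clamp by (intro continuous_on_compose2[OF cont[OF i]]) auto
    then show ?thesis unfolding h_def g_def .
  qed
  have hM: "\<bar>h u i s\<bar> \<le> M" if "i < n" for u i s
    unfolding h_def by (rule gM[OF that])
  \<comment> \<open>The integral of the field from 0 to the clamped time, written as a difference of
    integrals from -a so that negative times are covered. Indices from n on get 0, which keeps the
    curve in R^n.\<close>
  define G where "G u i t = (if i < n then x0 i + (integral {-a..cl t} (h u i) - integral {-a..0} (h u i)) else 0)" for u i t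
  have Ibound: "\<bar>integral {-a..s} k\<bar> \<le> B * (2 * a)"
    if "continuous_on {-a..s} k" "\<And>t. \<bar>k t\<bar> \<le> B" "s \<in> {-a..a}" for k s and B :: real
  proof -
    have "norm (integral {-a..s} k) \<le> B * (s - (- a))"
      using that by (intro integral_bound) auto
    also have "\<dots> \<le> B * (2 * a)"
      using that(2)[of 0] that(3) by (intro mult_left_mono) auto
    finally show ?thesis by simp
  qed
  have Gcont: "continuous_on UNIV (G u i)" for u i
  proof (cases "i < n")
    case True
    have "continuous_on {-a..a} (\<lambda>s. integral {-a..s} (h u i))"
      by (intro indefinite_integral_continuous_1 integrable_continuous_interval hcont True)
    then have "continuous_on UNIV (\<lambda>t. integral {-a..cl t} (h u i))"
      using cl by (rule_tac continuous_on_compose2[where g = "\<lambda>s. integral {-a..s} (h u i)" and f = cl])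
        (auto simp: cl_def intro!: continuous_intros)
    then show ?thesis unfolding G_def using True by (auto intro!: continuous_intros)
  qed (simp add: G_def)
  have Gbound: "\<bar>G u i t\<bar> \<le> (\<Sum>i<n. \<bar>x0 i\<bar>) + 4 * a * M" for u i t
  proof (cases "i < n")
    case True
    have "\<bar>integral {-a..cl t} (h u i)\<bar> \<le> M * (2 * a)" "\<bar>integral {-a..0} (h u i)\<bar> \<le> M * (2 * a)"
      using cl a by (auto intro!: Ibound hcont hM True)
    moreover have "\<bar>x0 i\<bar> \<le> (\<Sum>i<n. \<bar>x0 i\<bar>)"
      using True by (intro member_le_sum[of i]) auto
    ultimately show ?thesis using True by (simp add: G_def algebra_simps)
  next
    case False
    have "0 \<le> (\<Sum>i<n. \<bar>x0 i\<bar>)" by (intro sum_nonneg) auto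
    then show ?thesis using False a M by (simp add: G_def)
  qed
  define T where "T u = Bcontfun (\<lambda>p. G u (of_discrete (fst p)) (snd p))" for u
  have T: "apply_bcontfun (T u) = (\<lambda>p. G u (of_discrete (fst p)) (snd p))" for u
    unfolding T_def
    by (intro Bcontfun_inverse bcontfun_normI continuous_on_discrete_prod[where G = "\<lambda>i. G u (of_discrete i)" for u] Gcont) (auto intro: Gbound)
  have "dist (T u) (T v) \<le> 1 / 2 * dist u v" for u v
  proof (rule dist_bound)
    fix p :: "nat discrete \<times> real"
    obtain i t where p: "p = (discrete i, t)" by (metis of_discrete_inverse surj_pair)
    show "dist (apply_bcontfun (T u) p) (apply_bcontfun (T v) p) \<le> 1 / 2 * dist u v"
    proof (cases "i < n")
      case True
      have hd: "\<bar>h u i s - h v i s\<bar> \<le> L * dist u v" for s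
        unfolding h_def using dist_bounded[of u _ v] by (intro glip True) (auto simp: dist_real_def)
      have I: "\<bar>integral {-a..s} (h u i) - integral {-a..s} (h v i)\<bar> \<le> (L * dist u v) * (2 * a)"
        if "s \<in> {-a..a}" for s
      proof -
        have "integral {-a..s} (h u i) - integral {-a..s} (h v i) = integral {-a..s} (\<lambda>r. h u i r - h v i r)"
          by (intro integral_diff[symmetric] integrable_continuous_interval hcont True)
        also have "\<bar>\<dots>\<bar> \<le> (L * dist u v) * (2 * a)"
          using that by (intro Ibound continuous_on_diff hcont True hd)
        finally show ?thesis .
      qed
      have "dist (G u i t) (G v i t) \<le> 2 * ((L * dist u v) * (2 * a))"
        using I[of "cl t"] I[of 0] cl a(1) True by (simp add: G_def dist_real_def)
      also have "\<dots> = (4 * a * L) * dist u v" by simp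
      also have "\<dots> \<le> 1 / 2 * dist u v" using a(3) by (intro mult_right_mono) auto
      finally show ?thesis by (simp add: T p discrete_inverse)
    qed (simp add: T p G_def discrete_inverse)
  qed
  then obtain u where u: "T u = u"
    using banach_fix_type[of "1/2" T] by auto
  define x where "x t = (\<lambda>i. apply_bcontfun u (discrete i, t))" for t
  have xG: "x t i = G u i t" for t i
    unfolding x_def by (subst u[symmetric], subst T) (simp add: discrete_inverse)
  have hx: "h u i t = g i (x t)" for i t
    by (simp add: h_def x_def)
  have init: "x 0 = x0"
    using a(1) x0 by (auto simp: xG G_def cl_def Rn_iff)
  have deriv: "((\<lambda>t. x t i) has_real_derivative g i (x t)) (at t)" if i: "i < n" and t: "\<bar>t\<bar> < a" for i t
  proof -
    have ti: "t \<in> {-a<..<a}" using t by auto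
    have "((\<lambda>s. integral {-a..s} (h u i)) has_real_derivative h u i t) (at t within {-a..a})"
      using ti by (intro integral_has_real_derivative hcont i) auto
    then have "((\<lambda>s. integral {-a..s} (h u i)) has_real_derivative h u i t) (at t)"
      using ti by (simp add: at_within_Icc_at)
    then have "((\<lambda>s. x0 i + (integral {-a..s} (h u i) - integral {-a..0} (h u i))) has_real_derivative h u i t) (at t)"
      by (auto intro!: derivative_eq_intros)
    then have "((\<lambda>t. x t i) has_real_derivative h u i t) (at t)"
      by (rule has_field_derivative_transform_within_open[OF _ open_greaterThanLessThan ti])
        (auto simp: xG G_def i cl_def)
    then show ?thesis by (simp add: hx)
  qed
  have near: "\<bar>x t i - x0 i\<bar> < \<delta> / 2" if i: "i < n" and t: "\<bar>t\<bar> < a" for i t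
  proof -
    have "\<exists>r. min 0 t \<le> r \<and> r \<le> max 0 t \<and> x t i - x 0 i = g i (x r) * (t - 0)"
      using t by (intro mean_value_segment deriv i) auto
    then obtain r where "x t i - x0 i = g i (x r) * t"
      by (auto simp: init)
    then have "\<bar>x t i - x0 i\<bar> \<le> M * a"
      using gM[OF i] t M by (auto simp: abs_mult intro!: mult_mono)
    then show ?thesis using a(2) by (simp add: mult.commute)
  qed
  \<comment> \<open>The solution of the clamped equation stays where clamping is the identity, hence
    it solves the original equation.\<close>
  have xcl: "clamp (x t) = x t" if "\<bar>t\<bar> < a" for t
  proof
    fix i show "clamp (x t) i = x t i"
    proof (cases "i < n")
      case True
      have "x0 i - \<delta>/2 \<le> x t i" "x t i \<le> x0 i + \<delta>/2"
        using near[OF True that] by linarith+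
      then show ?thesis using True by (simp add: clamp_def)
    qed (simp add: clamp_def xG G_def)
  qed
  show ?thesis
  proof (intro exI[of _ a] conjI exI[of _ x] allI impI)
    show "x t \<in> cube n x0 \<delta>" if "\<bar>t\<bar> < a" for t
      using clamp[of "x t"] xcl[OF that] by simp
    show "((\<lambda>t. x t i) has_real_derivative f i (x t)) (at t)" if "\<bar>t\<bar> < a" "i < n" for t i
      using deriv[OF that(2,1)] xcl[OF that(1)] by (simp add: g_def)
  qed (use a init in auto)
qed

text \<open>The derivative of \<open>g \<circ> x\<close> is \<open>h \<circ> x\<close> with \<open>h = \<Sum>\<^sub>i \<partial>\<^sub>i g \<cdot> f\<^sub>i\<close> smooth, which is why the statement is about
  all \<open>g\<close>.\<close>

lemma ode_smooth:
  assumes U: "open_Rn n U" and f: "\<And>i. i < n \<Longrightarrow> smooth_fun n U (f i)"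
    and x: "\<And>t. \<bar>t\<bar> < a \<Longrightarrow> x t \<in> U"
      "\<And>i t. i < n \<Longrightarrow> \<bar>t\<bar> < a \<Longrightarrow> ((\<lambda>t. x t i) has_real_derivative f i (x t)) (at t)"
    and g: "smooth_fun n U g"
  shows "smooth_fun 1 (interval1 a) (\<lambda>u. g (x (u 0)))"
proof -
  have dg: "((\<lambda>t. g (x t)) has_real_derivative (\<Sum>i<n. partial_deriv i g (x t) * f i (x t))) (at t)"
    if "smooth_fun n U g" "\<bar>t\<bar> < a" for g t
  proof (rule chain_rule_curve[OF U smooth_fun_Ck[OF that(1)] x(1)[OF that(2)] _ x(2)[OF _ that(2)]])
    have "t \<in> {-a<..<a}" using that(2) by auto
    then have "\<forall>\<^sub>F s in nhds t. s \<in> {-a<..<a}"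
      by (intro eventually_nhds_in_open) auto
    then show "\<forall>\<^sub>F s in nhds t. x s \<in> Rn n"
      using x(1) open_Rn_subset[OF U] by (elim eventually_mono) (auto simp: abs_less_iff)
  qed
  have co: "continuous_on (interval1 a) (\<lambda>u. g (x (u 0)))" if "smooth_fun n U g" for g
  proof -
    have "continuous_on {-a<..<a} (\<lambda>t. g (x t))"
      by (intro continuous_at_imp_continuous_on ballI DERIV_isCont[OF dg[OF that]]) (auto simp: abs_less_iff)
    then show ?thesis
      by (rule continuous_on_compose2)
        (auto simp: cube_def intro!: continuous_on_product_then_coordinatewise[OF continuous_on_id])
  qed
  have "Ck k 1 (interval1 a) (\<lambda>u. g (x (u 0)))" for k
    using g
  proof (induction k arbitrary: g)
    case 0
    then show ?case using co by simp
  next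
    case (Suc k)
    show ?case
    proof (rule Ck_SucI[OF open_Rn_cube co[OF Suc.prems], where D = "\<lambda>_ u. \<Sum>i<n. partial_deriv i g (x (u 0)) * f i (x (u 0))"])
      fix i :: nat and u assume "i < 1" "u \<in> interval1 a"
      then show "((\<lambda>t. g (x ((u(i := t)) 0))) has_real_derivative
          (\<Sum>i<n. partial_deriv i g (x (u 0)) * f i (x (u 0)))) (at (u i))"
        using dg[OF Suc.prems, of "u 0"] by (simp add: cube_def)
    next
      show "Ck k 1 (interval1 a) (\<lambda>u. \<Sum>i<n. partial_deriv i g (x (u 0)) * f i (x (u 0)))"
        by (rule Suc.IH[of "\<lambda>z. \<Sum>i<n. partial_deriv i g z * f i z"])
          (use Suc.prems f in \<open>auto intro!: smooth_fun_sum smooth_fun_mult smooth_fun_partial U\<close>)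
    qed
  qed
  then show ?thesis by (simp add: smooth_fun_def)
qed


section \<open>One-parameter subgroups\<close>

lemma lie_group_facts:
  assumes "lie_group G DG"
  shows "group G" "carrier DG = carrier G" "diffeological_space DG"
    "dsmooth (prod_diff DG DG) DG (\<lambda>(g, h). g \<otimes>\<^bsub>G\<^esub> h)"
  using assms by (auto simp: lie_group_def manifold_def)

lemma plot_mult:
  assumes "lie_group G DG" "plot DG n U P" "plot DG n U Q"
  shows "plot DG n U (\<lambda>u. P u \<otimes>\<^bsub>G\<^esub> Q u)"
  using dsmooth_plot[OF lie_group_facts(4)[OF assms(1)], of n U "\<lambda>u. (P u, Q u)"] assms(2,3)
  by (simp add: plot_prod_diff)

lemma dsmooth_mult_left:
  assumes G: "lie_group G DG" and g: "g \<in> carrier G"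
  shows "dsmooth DG DG (\<lambda>h. g \<otimes>\<^bsub>G\<^esub> h)"
  unfolding dsmooth_def
proof (intro conjI allI impI)
  interpret group G by (rule lie_group_facts[OF G])
  show "(\<lambda>h. g \<otimes>\<^bsub>G\<^esub> h) ` carrier DG \<subseteq> carrier DG"
    using g by (auto simp: lie_group_facts(2)[OF G])
  fix n U P assume P: "plot DG n U P"
  have "plot DG n U (\<lambda>_. g)"
    by (rule plot_const[OF lie_group_facts(3)[OF G] plot_openD[OF lie_group_facts(3)[OF G] P]])
      (simp add: g lie_group_facts(2)[OF G])
  then show "plot DG n U (\<lambda>u. g \<otimes>\<^bsub>G\<^esub> P u)"
    by (rule plot_mult[OF G _ P])
qed

context
  fixes G :: "('g, 'b) monoid_scheme" and DG :: "'g diffspace" and c :: "real \<Rightarrow> 'g"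
    and n U F
  assumes G: "lie_group G DG" and c: "smooth_germ DG c" "c 0 = \<one>\<^bsub>G\<^esub>"
    and F: "chart DG n U F"
begin

interpretation group G by (rule lie_group_facts[OF G])

lemmas diffeological_DG = lie_group_facts(3)[OF G] and carrier_DG = lie_group_facts(2)[OF G]

text \<open>The left-invariant vector field with value \<open>c'(0)\<close> at the unit.\<close>

definition left_field :: "'g \<Rightarrow> 'g tvec" where
  "left_field g = velocity DG (\<lambda>s. g \<otimes>\<^bsub>G\<^esub> c s)"

lemma chart_in_carrier: "x \<in> U \<Longrightarrow> F x \<in> carrier G"
  using plot_carrier[OF diffeological_DG chart_plot[OF F]] carrier_DG by auto

lemma open_chart_domain: "open_Rn n U"
  by (rule plot_openD[OF diffeological_DG chart_plot[OF F]])

text \<open>In chart coordinates, (x, s) \<mapsto> F(x) c(s) is a smooth function of n + 1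
  variables. Its partial derivative in s at s = 0 is the field, so smoothness of partial derivatives
  gives the claim.\<close>

lemma smooth_left_field:
  assumes i: "i < n"
  shows "smooth_fun n U (\<lambda>x. left_field (F x) (\<lambda>y. inv_into U F y i))"
proof -
  obtain e where e: "e > 0" "plot DG 1 (interval1 e) (\<lambda>u. c (u 0))"
    using c(1) unfolding smooth_germ_def by blast
  \<comment> \<open>Coordinate number n carries the time s, and \<open>w(n := 0)\<close> is the
    point of the chart domain.\<close>
  define W0 where "W0 = {w \<in> Rn (Suc n). w(n := 0) \<in> U \<and> \<bar>w n\<bar> < e}"
  define p where "p w = F (w(n := 0)) \<otimes>\<^bsub>G\<^esub> c (w n)" for w
  have W0: "open_Rn (Suc n) W0"
    unfolding open_Rn_iff
  proof (intro conjI ballI)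
    fix w assume w: "w \<in> W0"
    then obtain r where r: "r > 0" "cube n (w(n := 0)) r \<subseteq> U"
      using open_RnD[OF open_chart_domain] by (auto simp: W0_def)
    have "v \<in> W0" if v: "v \<in> cube (Suc n) w (min r (e - \<bar>w n\<bar>))" for v
    proof -
      have "v(n := 0) \<in> cube n (w(n := 0)) r"
        using v by (auto simp: cube_def Rn_iff)
      moreover have "\<bar>v n - w n\<bar> < e - \<bar>w n\<bar>"
        using v by (auto simp: cube_def)
      then have "\<bar>v n\<bar> < e" by linarith
      ultimately show ?thesis using v r(2) by (auto simp: W0_def cube_def)
    qed
    then show "\<exists>r>0. cube (Suc n) w r \<subseteq> W0"
      using r(1) w by (intro exI[of _ "min r (e - \<bar>w n\<bar>)"]) (auto simp: W0_def)
  qed (auto simp: W0_def)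
  have "smooth_map (Suc n) W0 n U (\<lambda>w. w(n := 0))"
    using smooth_fun_coord[OF W0] by (auto simp: smooth_map_def W0_def)
  then have "plot DG (Suc n) W0 (\<lambda>w. F (w(n := 0)))"
    by (rule plot_comp[OF diffeological_DG chart_plot[OF F] W0]) simp
  moreover have "smooth_map (Suc n) W0 1 (interval1 e) (\<lambda>w. line (w n))"
    by (rule smooth_map_line[OF W0 smooth_fun_coord[OF W0]]) (simp add: W0_def)
  then have "plot DG (Suc n) W0 (\<lambda>w. c (w n))"
    by (rule plot_comp[OF diffeological_DG e(2) W0]) simp
  ultimately have p: "plot DG (Suc n) W0 p"
    unfolding p_def by (rule plot_mult[OF G])
  define W where "W = {w \<in> W0. p w \<in> F ` U}"
  have W: "open_Rn (Suc n) W"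
    unfolding W_def by (rule D_open_plot[OF chart_D_open[OF F] p])
  have pW: "plot DG (Suc n) W p"
    by (rule plot_restrict[OF diffeological_DG p W]) (auto simp: W_def)
  have "smooth_map (Suc n) W n U (\<lambda>w. inv_into U F (p w))"
    by (rule chart_smooth[OF F pW]) (simp add: W_def)
  then have "smooth_fun (Suc n) W (\<lambda>w. inv_into U F (p w) i)"
    using i by (simp add: smooth_map_def)
  then have "smooth_fun (Suc n) W (partial_deriv n (\<lambda>w. inv_into U F (p w) i))"
    by (rule smooth_fun_partial) simp
  then have s: "smooth_fun n W (partial_deriv n (\<lambda>w. inv_into U F (p w) i))"
    by (rule smooth_fun_Suc)
  have Un: "x n = 0" "x(n := 0) = x" if "x \<in> U" for x
  proof -
    show "x n = 0" using that open_Rn_subset[OF open_chart_domain] unfolding subset_iff Rn_iff by blast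
    then show "x(n := 0) = x" by auto
  qed
  \<comment> \<open>Points of U have coordinate n equal to 0, so U is the slice s = 0, on which
    \<open>p\<close> agrees with F and stays in the chart.\<close>
  have "U \<subseteq> W"
  proof
    fix x assume x: "x \<in> U"
    then have "p x = F x"
      using Un[OF x] c(2) chart_in_carrier[OF x] by (simp add: p_def)
    then show "x \<in> W"
      using x e(1) open_Rn_subset[OF open_chart_domain] unfolding W_def W0_def subset_iff Rn_iff by (auto simp: Un)
  qed
  then have sU: "smooth_fun n U (partial_deriv n (\<lambda>w. inv_into U F (p w) i))"
    by (rule smooth_fun_subset[OF s])
  show ?thesis
  proof (rule smooth_fun_cong[OF open_chart_domain _ sU])
    show "partial_deriv n (\<lambda>w. inv_into U F (p w) i) x = left_field (F x) (\<lambda>y. inv_into U F y i)"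
      if "x \<in> U" for x
      using chart_coord_smooth_near[OF F _ i, of "F x"] that c(2) chart_in_carrier[OF that]
      by (simp add: partial_deriv_def left_field_def velocity_def p_def Un[OF that])
  qed
qed

lemma smooth_germ_mult_left: "g \<in> carrier G \<Longrightarrow> smooth_germ DG (\<lambda>s. g \<otimes>\<^bsub>G\<^esub> c s)"
  by (rule smooth_germ_comp[OF dsmooth_mult_left[OF G] c(1)])

text \<open>Left invariance, tested on functions. It is associativity, applied only for the small s
  at which \<open>c s\<close> is known to lie in the group.\<close>

lemma left_field_mult:
  assumes g: "g \<in> carrier G" and h: "h \<in> carrier G" and q: "smooth_near DG (g \<otimes>\<^bsub>G\<^esub> h) q"
  shows "left_field h (\<lambda>y. q (g \<otimes>\<^bsub>G\<^esub> y)) = left_field (g \<otimes>\<^bsub>G\<^esub> h) q"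
proof -
  have "left_field h (\<lambda>y. q (g \<otimes>\<^bsub>G\<^esub> y)) = velocity DG (\<lambda>s. g \<otimes>\<^bsub>G\<^esub> (h \<otimes>\<^bsub>G\<^esub> c s)) q"
    unfolding left_field_def using g h q c(2) carrier_DG
    by (intro velocity_comp[OF diffeological_DG dsmooth_mult_left[OF G g], symmetric]) auto
  also have "\<dots> = velocity DG (\<lambda>s. (g \<otimes>\<^bsub>G\<^esub> h) \<otimes>\<^bsub>G\<^esub> c s) q"
  proof (rule fun_cong[OF velocity_cong_ev])
    show "\<forall>\<^sub>F s in nhds 0. g \<otimes>\<^bsub>G\<^esub> (h \<otimes>\<^bsub>G\<^esub> c s) = g \<otimes>\<^bsub>G\<^esub> h \<otimes>\<^bsub>G\<^esub> c s"
      using smooth_germ_values[OF diffeological_DG c(1)]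
      by eventually_elim (simp add: g h m_assoc carrier_DG)
  qed
  finally show ?thesis by (simp add: left_field_def)
qed

text \<open>Passes from coordinate functions to every q smooth near the point: q along the integral
  curve at t and q along s \<mapsto> F(x(t)) c(s) at 0 have the same chain rule expansion, because
  the coordinate velocities agree.\<close>

lemma integral_curve_deriv:
  assumes x: "x t \<in> U" "\<forall>\<^sub>F s in nhds t. x s \<in> U"
    and d: "\<And>i. i < n \<Longrightarrow>
      ((\<lambda>t. x t i) has_real_derivative left_field (F (x t)) (\<lambda>y. inv_into U F y i)) (at t)"
    and q: "smooth_near DG (F (x t)) q"
  shows "((\<lambda>t. q (F (x t))) has_real_derivative left_field (F (x t)) q) (at t)"
proof -
  define g where "g = F (x t)"
  have g: "g \<in> carrier G" "g \<in> F ` U"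
    using x(1) chart_in_carrier by (auto simp: g_def)
  obtain W where W: "open_Rn n W" "x t \<in> W" "W \<subseteq> U" "smooth_fun n W (\<lambda>u. q (F u))"
    using plot_smooth_near[OF diffeological_DG chart_plot[OF F] x(1) q] by blast
  have UR: "u \<in> U \<Longrightarrow> u \<in> Rn n" for u using open_Rn_subset[OF open_chart_domain] by blast
  have 1: "((\<lambda>t. q (F (x t))) has_real_derivative
      (\<Sum>i<n. partial_deriv i (\<lambda>u. q (F u)) (x t) * left_field g (\<lambda>y. inv_into U F y i))) (at t)"
    unfolding g_def using x(2)
    by (intro chain_rule_curve[OF W(1) smooth_fun_Ck[OF W(4)] W(2) _ d]) (auto elim: eventually_mono intro: UR)
  \<comment> \<open>Chart coordinates of the translate of \<open>c\<close> that represents the field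
    at g.\<close>
  define y where "y s = inv_into U F (g \<otimes>\<^bsub>G\<^esub> c s)" for s
  have y0: "y 0 = x t"
    using x(1) c(2) chart_inj[OF F] chart_in_carrier by (simp add: y_def g_def)
  have ev: "\<forall>\<^sub>F s in nhds 0. g \<otimes>\<^bsub>G\<^esub> c s \<in> F ` U"
    using g c(2) by (intro smooth_germ_eventually[OF diffeological_DG smooth_germ_mult_left chart_D_open[OF F]]) auto
  have dy: "((\<lambda>s. y s i) has_real_derivative left_field g (\<lambda>y. inv_into U F y i)) (at 0)" if "i < n" for i
    unfolding y_def left_field_def using g c(2)
    by (intro velocity_has_deriv[OF diffeological_DG smooth_germ_mult_left] chart_coord_smooth_near[OF F _ that]) auto
  have "\<forall>\<^sub>F s in nhds 0. y s \<in> Rn n"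
    using ev by eventually_elim (auto simp: y_def intro!: UR inv_into_into)
  then have "((\<lambda>s. q (F (y s))) has_real_derivative
      (\<Sum>i<n. partial_deriv i (\<lambda>u. q (F u)) (y 0) * left_field g (\<lambda>y. inv_into U F y i))) (at 0)"
    using W(2) dy by (intro chain_rule_curve[OF W(1) smooth_fun_Ck[OF W(4)]]) (auto simp: y0)
  moreover have "\<forall>\<^sub>F s in nhds 0. q (F (y s)) = q (g \<otimes>\<^bsub>G\<^esub> c s)"
    using ev by eventually_elim (auto simp: y_def f_inv_into_f)
  ultimately have "((\<lambda>s. q (g \<otimes>\<^bsub>G\<^esub> c s)) has_real_derivative
      (\<Sum>i<n. partial_deriv i (\<lambda>u. q (F u)) (x t) * left_field g (\<lambda>y. inv_into U F y i))) (at 0)"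
    using DERIV_cong_ev[OF refl _ refl] y0 by fastforce
  then have "left_field g q = (\<Sum>i<n. partial_deriv i (\<lambda>u. q (F u)) (x t) * left_field g (\<lambda>y. inv_into U F y i))"
    unfolding left_field_def using q g c(2) by (intro velocity_eqI) (auto simp: g_def)
  with 1 show ?thesis by (simp add: g_def)
qed

text \<open>For fixed \<open>s\<close>, both \<open>t \<mapsto> \<gamma> (s + t)\<close> and \<open>t \<mapsto> \<gamma> s \<otimes> \<gamma> t\<close> are integral curves of the left-invariant
  field that start at \<open>\<gamma> s\<close>. The cube on which the field is Lipschitz does not depend on \<open>s\<close>, so the
  length of the interval on which they agree does not either.\<close>

lemma local_one_param_subgroup:
  assumes one: "\<one>\<^bsub>G\<^esub> \<in> F ` U"
  shows "\<exists>a>0. \<exists>\<gamma>. plot DG 1 (interval1 a) (\<lambda>u. \<gamma> (u 0)) \<and> velocity DG \<gamma> = velocity DG c \<and>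
    (\<forall>s t. \<bar>s\<bar> \<le> a \<longrightarrow> \<bar>t\<bar> \<le> a \<longrightarrow> \<gamma> s \<in> carrier G \<and> \<gamma> (s + t) = \<gamma> s \<otimes>\<^bsub>G\<^esub> \<gamma> t)"
proof -
  obtain x0 where x0: "x0 \<in> U" "F x0 = \<one>\<^bsub>G\<^esub>" using one by force
  define f where "f i x = left_field (F x) (\<lambda>y. inv_into U F y i)" for i x
  have f: "smooth_fun n U (f i)" if "i < n" for i
    unfolding f_def by (rule smooth_left_field[OF that])
  obtain \<delta> L where \<delta>: "\<delta> > 0" "L \<ge> 0" "cube n x0 \<delta> \<subseteq> U" and
    lip: "\<And>i u v m. i < n \<Longrightarrow> u \<in> cube n x0 \<delta> \<Longrightarrow> v \<in> cube n x0 \<delta> \<Longrightarrow>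
      (\<And>j. j < n \<Longrightarrow> \<bar>u j - v j\<bar> \<le> m) \<Longrightarrow> \<bar>f i u - f i v\<bar> \<le> L * m"
    using smooth_lipschitz_cube[where f = f, OF open_chart_domain f x0(1)] by metis
  have x0R: "x0 \<in> Rn n" using x0 open_Rn_subset[OF open_chart_domain] by blast
  have "continuous_on (cube n x0 \<delta>) (f i)" if "i < n" for i
    using continuous_on_subset[OF smooth_fun_continuous[OF f[OF that]] \<delta>(3)] .
  then have "\<exists>a>0. \<exists>x. x 0 = x0 \<and> (\<forall>t. \<bar>t\<bar> < a \<longrightarrow> x t \<in> cube n x0 \<delta> \<and>
      (\<forall>i<n. ((\<lambda>t. x t i) has_real_derivative f i (x t)) (at t)))"
    by (intro ode_exists[where f = f, OF \<delta>(1) x0R \<delta>(2)] lip)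
  then obtain a0 x where a0: "a0 > 0" and
    x: "x 0 = x0" "\<And>t. \<bar>t\<bar> < a0 \<Longrightarrow> x t \<in> cube n x0 \<delta>"
      "\<And>i t. i < n \<Longrightarrow> \<bar>t\<bar> < a0 \<Longrightarrow> ((\<lambda>t. x t i) has_real_derivative f i (x t)) (at t)"
    by metis
  define \<gamma> where "\<gamma> t = F (x t)" for t
  have xU: "x t \<in> U" if "\<bar>t\<bar> < a0" for t using x(2)[OF that] \<delta>(3) by blast
  have \<gamma>0: "\<gamma> 0 = \<one>\<^bsub>G\<^esub>" by (simp add: \<gamma>_def x x0)
  have \<gamma>G: "\<gamma> t \<in> carrier G" if "\<bar>t\<bar> < a0" for t
    unfolding \<gamma>_def by (rule chart_in_carrier[OF xU[OF that]])
  have ev: "\<forall>\<^sub>F s in nhds t. \<bar>s\<bar> < a0" if "\<bar>t\<bar> < a0" for t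
  proof -
    have "\<forall>\<^sub>F s in nhds t. s \<in> {-a0<..<a0}"
      using that by (intro eventually_nhds_in_open) (auto simp: abs_less_iff)
    then show ?thesis by eventually_elim auto
  qed
  have \<gamma>d: "((\<lambda>t. q (\<gamma> t)) has_real_derivative left_field (\<gamma> t) q) (at t)"
    if "\<bar>t\<bar> < a0" "smooth_near DG (\<gamma> t) q" for t q
    unfolding \<gamma>_def
    by (rule integral_curve_deriv[where x = x, OF xU[OF that(1)] eventually_mono[OF ev[OF that(1)] xU]])
      (use that x(3) in \<open>auto simp: f_def \<gamma>_def\<close>)
  have "smooth_fun 1 (interval1 a0) (\<lambda>u. x (u 0) i)" for i
    by (rule ode_smooth[OF open_chart_domain f xU x(3) smooth_fun_coord[OF open_chart_domain]])
  then have "smooth_map 1 (interval1 a0) n U (\<lambda>u. x (u 0))"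
    using xU by (auto simp: smooth_map_def cube_def)
  then have plot_\<gamma>: "plot DG 1 (interval1 a0) (\<lambda>u. \<gamma> (u 0))"
    unfolding \<gamma>_def by (rule plot_comp[OF diffeological_DG chart_plot[OF F] open_Rn_cube]) simp
  \<comment> \<open>At time 0 the integral curve is at the unit, where the field is the velocity of
    \<open>c\<close>.\<close>
  have vel: "velocity DG \<gamma> = velocity DG c"
  proof
    fix q show "velocity DG \<gamma> q = velocity DG c q"
    proof (cases "smooth_near DG \<one>\<^bsub>G\<^esub> q")
      case True
      have "velocity DG \<gamma> q = left_field \<one>\<^bsub>G\<^esub> q"
        using \<gamma>d[of 0 q] True a0 \<gamma>0 by (intro velocity_eqI) auto
      also have "\<dots> = velocity DG c q"
        unfolding left_field_def
        by (rule fun_cong[OF velocity_cong_ev[OF eventually_mono[OF smooth_germ_values[OF diffeological_DG c(1)]]]])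
          (simp add: carrier_DG)
      finally show ?thesis .
    next
      case False
      then show ?thesis using \<gamma>0 c(2) by (simp add: velocity_def)
    qed
  qed
  define V where "V = cube n x0 \<delta>"
  have V: "open_Rn n V" "V \<subseteq> U" "x0 \<in> V" "V \<subseteq> Rn n"
    using \<delta> x0R by (auto simp: V_def open_Rn_cube cube_centre) (auto simp: cube_def)
  define Q where "Q w = \<gamma> (w 0) \<otimes>\<^bsub>G\<^esub> \<gamma> (w 1)" for w :: vec
  have "smooth_map 2 (cube 2 (\<lambda>_. 0) a0) 1 (interval1 a0) (\<lambda>w. line (w j))" if "j < 2" for j
    by (rule smooth_map_line[OF open_Rn_cube smooth_fun_coord[OF open_Rn_cube]])
      (use that in \<open>auto simp: cube_def line_Rn1[simplified]\<close>)
  then have "plot DG 2 (cube 2 (\<lambda>_. 0) a0) (\<lambda>w. \<gamma> (w j))" if "j < 2" for j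
    by (rule plot_comp[OF diffeological_DG plot_\<gamma> open_Rn_cube]) (use that in auto)
  then have "plot DG 2 (cube 2 (\<lambda>_. 0) a0) Q"
    unfolding Q_def by (intro plot_mult[OF G]) auto
  from D_open_plot[OF chart_D_open_image[OF diffeological_DG F V(1,2)] this]
  have "open_Rn 2 {w \<in> cube 2 (\<lambda>_. 0) a0. Q w \<in> F ` V}" .
  moreover have "(\<lambda>_. 0) \<in> {w \<in> cube 2 (\<lambda>_. 0) a0. Q w \<in> F ` V}"
    using a0 V(3) x0 by (auto simp: Q_def \<gamma>0 cube_def Rn_iff intro: image_eqI[of _ _ x0])
  ultimately obtain b where b: "b > 0" "cube 2 (\<lambda>_. 0) b \<subseteq> {w \<in> cube 2 (\<lambda>_. 0) a0. Q w \<in> F ` V}"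
    using open_RnD by blast
  define a where "a = min (min (a0 / 4) (b / 2)) (1 / (2 * (real n * L + 1)))"
  have nL: "real n * L \<ge> 0" using \<delta>(2) by simp
  have a: "a > 0" "2 * a < a0" "a < b" "real n * L * a < 1"
  proof -
    show "a > 0" unfolding a_def using a0 b(1) nL by simp
    show "2 * a < a0" unfolding a_def using a0 by linarith
    show "a < b" unfolding a_def using b(1) by linarith
    have "real n * L * a \<le> real n * L * (1 / (2 * (real n * L + 1)))"
      unfolding a_def using nL by (intro mult_left_mono) auto
    also have "\<dots> < 1" using nL by (simp add: field_simps)
    finally show "real n * L * a < 1" .
  qed
  have inV: "\<gamma> s \<otimes>\<^bsub>G\<^esub> \<gamma> t \<in> F ` V" if "\<bar>s\<bar> \<le> a" "\<bar>t\<bar> \<le> a" for s t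
  proof -
    have "(\<lambda>i::nat. if i = 0 then s else if i = 1 then t else 0) \<in> cube 2 (\<lambda>_. 0) b"
      using that a by (auto simp: cube_def Rn_iff)
    then show ?thesis using b(2) by (auto simp: Q_def)
  qed
  have hom: "\<gamma> (s + t) = \<gamma> s \<otimes>\<^bsub>G\<^esub> \<gamma> t" if s: "\<bar>s\<bar> \<le> a" and t: "\<bar>t\<bar> \<le> a" for s t
  proof -
    define y where "y t = inv_into U F (\<gamma> s \<otimes>\<^bsub>G\<^esub> \<gamma> t)" for t
    have Fy: "F (y t) = \<gamma> s \<otimes>\<^bsub>G\<^esub> \<gamma> t" "y t \<in> V" if "\<bar>t\<bar> \<le> a" for t
      using inV[OF s that] V(2) chart_inj[OF F] by (auto simp: y_def f_inv_into_f inv_into_f_f subset_iff)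
    have "x (s + t) = y t"
    proof (rule ode_unique[where V = V and f = f and L = L and n = n and a = a and x = "\<lambda>t. x (s + t)" and y = y])
      show "\<bar>f i u - f i v\<bar> \<le> L * m"
        if "i < n" "u \<in> V" "v \<in> V" "\<And>j. j < n \<Longrightarrow> \<bar>u j - v j\<bar> \<le> m" for i u v m
        using lip that unfolding V_def by blast
      have s0: "\<bar>s\<bar> < a0" using s a by linarith
      show "x (s + 0) = y 0"
        using \<gamma>0 \<gamma>G[OF s0] xU[OF s0] chart_inj[OF F] by (simp add: y_def \<gamma>_def)
      fix t assume t: "\<bar>t\<bar> \<le> a"
      have st: "\<bar>s + t\<bar> < a0" and t0: "\<bar>t\<bar> < a0" using s t a by linarith+
      show "x (s + t) \<in> V" unfolding V_def by (rule x(2)[OF st])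
      show "y t \<in> V" by (rule Fy(2)[OF t])
      fix i assume i: "i < n"
      show "((\<lambda>t. x (s + t) i) has_real_derivative f i (x (s + t))) (at t)"
        using x(3)[OF i st] unfolding add.commute[of s]
        by (rule iffD1[OF DERIV_shift[where f = "\<lambda>t. x t i"]])
      \<comment> \<open>To differentiate y, \<open>\<gamma>d\<close> is applied to the coordinate
        function composed with left translation by \<open>\<gamma> s\<close>; left invariance then
        turns the result into the field at \<open>y t\<close>.\<close>
      have near: "smooth_near DG (\<gamma> s \<otimes>\<^bsub>G\<^esub> \<gamma> t) (\<lambda>z. inv_into U F z i)"
        using inV[OF s t] V(2) by (intro chart_coord_smooth_near[OF F _ i]) auto
      have "smooth_near DG (\<gamma> t) (\<lambda>z. inv_into U F (\<gamma> s \<otimes>\<^bsub>G\<^esub> z) i)"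
        by (rule smooth_near_comp[OF diffeological_DG dsmooth_mult_left[OF G \<gamma>G[OF s0]] _ near])
          (simp add: \<gamma>G[OF t0] carrier_DG)
      from \<gamma>d[OF t0 this]
      have "((\<lambda>t. y t i) has_real_derivative left_field (\<gamma> t) (\<lambda>z. inv_into U F (\<gamma> s \<otimes>\<^bsub>G\<^esub> z) i)) (at t)"
        by (simp add: y_def)
      also have "left_field (\<gamma> t) (\<lambda>z. inv_into U F (\<gamma> s \<otimes>\<^bsub>G\<^esub> z) i) = f i (y t)"
        unfolding f_def Fy(1)[OF t]
        by (rule left_field_mult[OF \<gamma>G[OF s0] \<gamma>G[OF t0] near])
      finally show "((\<lambda>t. y t i) has_real_derivative f i (y t)) (at t)" .
    qed (use \<delta>(2) a(4) V(4) t in auto)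
    then show ?thesis using Fy(1)[OF t] by (simp add: \<gamma>_def)
  qed
  have "plot DG 1 (interval1 a) (\<lambda>u. \<gamma> (u 0))"
    by (rule plot_restrict[OF diffeological_DG plot_\<gamma> open_Rn_cube]) (use a in \<open>auto simp: cube_def\<close>)
  then show ?thesis
    using a(1,2) vel hom \<gamma>G by (intro exI[of _ a] conjI exI[of _ \<gamma>] allI impI) auto
qed

end

text \<open>The extension is the N-th power of \<gamma>(t/N) with N so large that t/N is in the
  local range. Two such N and M are compared through N M. The powers multiply correctly because the
  local values commute.\<close>

lemma extend_local_one_param_subgroup:
  assumes G: "lie_group G DG" and a: "a > 0"
    and \<gamma>: "plot DG 1 (interval1 a) (\<lambda>u. \<gamma> (u 0))"
    and G\<gamma>: "\<And>s. \<bar>s\<bar> \<le> a \<Longrightarrow> \<gamma> s \<in> carrier G"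
    and hom: "\<And>s t. \<bar>s\<bar> \<le> a \<Longrightarrow> \<bar>t\<bar> \<le> a \<Longrightarrow> \<gamma> (s + t) = \<gamma> s \<otimes>\<^bsub>G\<^esub> \<gamma> t"
  shows "\<exists>\<Gamma>. one_param_subgroup G DG \<Gamma> \<and> (\<forall>t. \<bar>t\<bar> \<le> a \<longrightarrow> \<Gamma> t = \<gamma> t)"
proof -
  interpret group G by (rule lie_group_facts[OF G])
  note DG = lie_group_facts(3)[OF G] and carrier_DG = lie_group_facts(2)[OF G]
  have g0: "\<gamma> 0 = \<one>\<^bsub>G\<^esub>"
    using hom[of 0 0] G\<gamma>[of 0] a by (simp add: l_cancel_one)
  have pow: "\<gamma> (real k * t) = \<gamma> t [^]\<^bsub>G\<^esub> k" if "\<bar>t\<bar> \<le> a" "real k * \<bar>t\<bar> \<le> a" for k t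
    using that(2)
  proof (induction k)
    case (Suc k)
    have "real k * \<bar>t\<bar> \<le> a" using Suc.prems by (simp add: algebra_simps)
    then show ?case
      using hom[of "real k * t" t] Suc.IH that(1) by (simp add: algebra_simps abs_mult)
  qed (simp add: g0)
  \<comment> \<open>The summand 1 makes N positive also at t = 0.\<close>
  define \<Gamma> where "\<Gamma> t = (let N = nat \<lceil>\<bar>t\<bar> / a\<rceil> + 1 in \<gamma> (t / real N) [^]\<^bsub>G\<^esub> N)" for t
  have indep: "\<gamma> (t / real N) [^]\<^bsub>G\<^esub> N = \<gamma> (t / real M) [^]\<^bsub>G\<^esub> M"
    if "N > 0" "M > 0" "\<bar>t\<bar> \<le> a * real N" "\<bar>t\<bar> \<le> a * real M" for t N M
  proof -
    have *: "\<gamma> (t / real N) [^]\<^bsub>G\<^esub> N = \<gamma> (t / (real N * real M)) [^]\<^bsub>G\<^esub> (N * M)"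
      if "N > 0" "M > 0" "\<bar>t\<bar> \<le> a * real N" for N M
    proof -
      have le: "\<bar>t / real N\<bar> \<le> a" using that by (simp add: field_simps)
      have "\<bar>t / (real N * real M)\<bar> \<le> \<bar>t / real N\<bar>"
        using that by (simp add: field_simps mult_le_cancel_left1)
      then have le': "\<bar>t / (real N * real M)\<bar> \<le> a" using le by linarith
      have "\<gamma> (real M * (t / (real N * real M))) = \<gamma> (t / (real N * real M)) [^]\<^bsub>G\<^esub> M"
        using le le' that by (intro pow) (auto simp: abs_mult)
      then have "\<gamma> (t / real N) = \<gamma> (t / (real N * real M)) [^]\<^bsub>G\<^esub> M"
        using that by simp
      then show ?thesis
        using G\<gamma>[OF le'] by (simp add: nat_pow_pow mult.commute)
    qed
    show ?thesis
      using *[of N M] *[of M N] that by (simp add: mult.commute)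
  qed
  have \<Gamma>: "\<Gamma> t = \<gamma> (t / real N) [^]\<^bsub>G\<^esub> N" if "N > 0" "\<bar>t\<bar> \<le> a * real N" for t N
  proof -
    have "\<bar>t\<bar> / a \<le> real (nat \<lceil>\<bar>t\<bar> / a\<rceil> + 1)" by linarith
    then have "\<bar>t\<bar> \<le> a * real (nat \<lceil>\<bar>t\<bar> / a\<rceil> + 1)" using a by (simp add: field_simps)
    then show ?thesis unfolding \<Gamma>_def Let_def using that by (intro indep) auto
  qed
  have \<Gamma>\<gamma>: "\<Gamma> t = \<gamma> t" if "\<bar>t\<bar> \<le> a" for t
    using \<Gamma>[of 1 t] that G\<gamma>[OF that] by simp
  have bound: "\<exists>N>0. \<bar>s\<bar> + \<bar>t\<bar> \<le> a * real N" for s t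
    using reals_Archimedean3[OF a, rule_format, of "\<bar>s\<bar> + \<bar>t\<bar> + a"] a
    by (metis add_nonneg_pos abs_ge_zero add_nonneg_nonneg gr_zeroI less_add_same_cancel1 less_le_not_le
        less_trans mult.commute mult_zero_right nless_le of_nat_0 order_less_trans linorder_not_le)
  have \<Gamma>hom: "\<Gamma> (s + t) = \<Gamma> s \<otimes>\<^bsub>G\<^esub> \<Gamma> t" for s t
  proof -
    obtain N where N: "N > 0" "\<bar>s\<bar> + \<bar>t\<bar> \<le> a * real N" using bound by blast
    have le: "\<bar>s / real N\<bar> \<le> a" "\<bar>t / real N\<bar> \<le> a" using N by (simp_all add: field_simps)
    have "\<gamma> ((s + t) / real N) = \<gamma> (s / real N) \<otimes>\<^bsub>G\<^esub> \<gamma> (t / real N)"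
      using hom[OF le] by (simp add: add_divide_distrib)
    \<comment> \<open>Both products equal \<gamma> at (s + t)/N; this commutation is what allows the
      N-th power of the product to be split.\<close>
    moreover have "\<gamma> (s / real N) \<otimes>\<^bsub>G\<^esub> \<gamma> (t / real N) = \<gamma> (t / real N) \<otimes>\<^bsub>G\<^esub> \<gamma> (s / real N)"
      using hom[OF le] hom[OF le(2,1)] by (simp add: add.commute)
    ultimately have "\<gamma> ((s + t) / real N) [^]\<^bsub>G\<^esub> N =
        \<gamma> (s / real N) [^]\<^bsub>G\<^esub> N \<otimes>\<^bsub>G\<^esub> \<gamma> (t / real N) [^]\<^bsub>G\<^esub> N"
      using pow_mult_distrib G\<gamma>[OF le(1)] G\<gamma>[OF le(2)] by metis
    moreover have "\<bar>s\<bar> \<le> a * real N" "\<bar>t\<bar> \<le> a * real N" "\<bar>s + t\<bar> \<le> a * real N"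
      using N(2) by linarith+
    ultimately show ?thesis
      using \<Gamma>[OF N(1)] by simp
  qed
  have \<Gamma>G: "\<Gamma> t \<in> carrier G" for t
  proof -
    obtain N where N: "N > 0" "\<bar>0\<bar> + \<bar>t\<bar> \<le> a * real N" using bound by blast
    then have "\<bar>t / real N\<bar> \<le> a" by (simp add: field_simps)
    then show ?thesis using N \<Gamma>[of N t] G\<gamma> by simp
  qed
  have "plot DG 1 (Rn 1) (\<lambda>u. \<Gamma> (u 0))"
  proof (rule plot_local[OF DG])
    show "open_Rn 1 (Rn 1)" by (rule openin_topspace)
    fix u assume u: "u \<in> Rn 1"
    \<comment> \<open>Around any time the global curve is a left translate of the local one, so
      smoothness at 0 spreads to the whole line.\<close>
    have "smooth_map 1 (cube 1 u a) 1 (interval1 a) (\<lambda>w. line (w 0 + - u 0))"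
      by (intro smooth_map_line smooth_fun_add smooth_fun_coord smooth_fun_const open_Rn_cube)
        (simp add: cube_def line_Rn1[simplified])
    then have "plot DG 1 (cube 1 u a) (\<lambda>w. \<gamma> (w 0 + - u 0))"
      by (rule plot_comp[OF DG \<gamma> open_Rn_cube]) simp
    from dsmooth_plot[OF dsmooth_mult_left[OF G \<Gamma>G[of "u 0"]] this]
    have "plot DG 1 (cube 1 u a) (\<lambda>w. \<Gamma> (u 0) \<otimes>\<^bsub>G\<^esub> \<gamma> (w 0 + - u 0))" .
    then have "plot DG 1 (cube 1 u a) (\<lambda>w. \<Gamma> (w 0))"
    proof (rule plot_restrict[OF DG _ open_Rn_cube])
      fix w assume "w \<in> cube 1 u a"
      then have "\<bar>w 0 + - u 0\<bar> \<le> a" by (auto simp: cube_def)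
      then show "\<Gamma> (w 0) = \<Gamma> (u 0) \<otimes>\<^bsub>G\<^esub> \<gamma> (w 0 + - u 0)"
        using \<Gamma>hom[of "u 0" "w 0 + - u 0"] \<Gamma>\<gamma> by simp
    qed auto
    then show "\<exists>V. u \<in> V \<and> V \<subseteq> Rn 1 \<and> plot DG 1 V (\<lambda>u. \<Gamma> (u 0))"
      using cube_centre[OF u a] open_Rn_subset[OF open_Rn_cube] by blast
  qed
  then show ?thesis
    unfolding one_param_subgroup_def using \<Gamma>hom \<Gamma>\<gamma> by blast
qed

text \<open>With existence proved, the choice in \<open>exp_curve\<close> has its defining property.
  The local subgroup and its extension agree near 0, hence have the same velocity.\<close>

lemma exp_curve:
  assumes G: "lie_group G DG" and c: "smooth_germ DG c" "c 0 = \<one>\<^bsub>G\<^esub>"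
  shows "one_param_subgroup G DG (exp_curve G DG (velocity DG c))"
    and "velocity DG (exp_curve G DG (velocity DG c)) = velocity DG c"
proof -
  interpret group G by (rule lie_group_facts[OF G])
  obtain n U F where F: "chart DG n U F" "\<one>\<^bsub>G\<^esub> \<in> F ` U"
    using G lie_group_facts(2)[OF G] unfolding lie_group_def manifold_def by (metis one_closed)
  obtain a \<gamma> where \<gamma>: "a > 0" "plot DG 1 (interval1 a) (\<lambda>u. \<gamma> (u 0))" "velocity DG \<gamma> = velocity DG c"
    "\<And>s. \<bar>s\<bar> \<le> a \<Longrightarrow> \<gamma> s \<in> carrier G"
    "\<And>s t. \<bar>s\<bar> \<le> a \<Longrightarrow> \<bar>t\<bar> \<le> a \<Longrightarrow> \<gamma> (s + t) = \<gamma> s \<otimes>\<^bsub>G\<^esub> \<gamma> t"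
    using local_one_param_subgroup[OF G c F] by (metis abs_zero less_imp_le)
  from extend_local_one_param_subgroup[OF G \<gamma>(1,2,4,5)]
  obtain \<Gamma> where \<Gamma>: "one_param_subgroup G DG \<Gamma>" "\<And>t. \<bar>t\<bar> \<le> a \<Longrightarrow> \<Gamma> t = \<gamma> t"
    by blast
  have "\<forall>\<^sub>F t in nhds 0. \<Gamma> t = \<gamma> t"
    unfolding eventually_nhds_metric using \<gamma>(1) \<Gamma>(2) by (auto simp: dist_real_def)
  then have "velocity DG \<Gamma> = velocity DG c"
    using \<gamma>(3) velocity_cong_ev by metis
  with \<Gamma>(1) have "\<exists>\<Gamma>. one_param_subgroup G DG \<Gamma> \<and> velocity DG \<Gamma> = velocity DG c" by blast
  from someI_ex[OF this] show "one_param_subgroup G DG (exp_curve G DG (velocity DG c))"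
    "velocity DG (exp_curve G DG (velocity DG c)) = velocity DG c"
    unfolding exp_curve_def by blast+
qed


section \<open>Forms\<close>

lemma jacobian_Rn:
  assumes f: "smooth_map m V n U f" and V: "open_Rn m V" and U: "U \<subseteq> Rn n" and v: "v \<in> V" and w: "w \<in> Rn m"
  shows "jacobian f v w \<in> Rn n"
  unfolding Rn_iff
proof (intro allI impI)
  fix j assume j: "n \<le> j"
  have "\<forall>\<^sub>F t in nhds 0. f (\<lambda>i. v i + t * w i) j = 0"
    using eventually_open_Rn_line[OF V v w]
  proof eventually_elim
    case (elim t)
    then have "f (\<lambda>i. v i + t * w i) \<in> Rn n" using f U unfolding smooth_map_def by blast
    then show ?case using j by (simp add: Rn_iff)
  qed
  then have "deriv (\<lambda>t. f (\<lambda>i. v i + t * w i) j) 0 = deriv (\<lambda>t. 0) 0"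
    by (rule deriv_cong_ev) simp
  then show "jacobian f v w j = 0"
    by (simp add: jacobian_def dir_deriv_def)
qed

lemma jacobian_ident: "jacobian (\<lambda>x. x) v w = w"
proof
  fix j
  have "((\<lambda>t. v j + t * w j) has_real_derivative w j) (at 0)"
    by (auto intro!: derivative_eq_intros)
  then show "jacobian (\<lambda>x. x) v w j = w j"
    by (simp add: jacobian_def dir_deriv_def DERIV_imp_deriv)
qed

lemma diff_form_ordinary: "diff_form k X \<alpha> \<Longrightarrow> plot X n U P \<Longrightarrow> ordinary_form k n U (\<alpha> n U P)"
  unfolding diff_form_def by (drule conjunct1) blast

lemma diff_form_comp:
  "diff_form k X \<alpha> \<Longrightarrow> plot X n U P \<Longrightarrow> open_Rn m V \<Longrightarrow> smooth_map m V n U f \<Longrightarrow>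
   (\<And>v. v \<in> V \<Longrightarrow> Q v = P (f v)) \<Longrightarrow> v \<in> V \<Longrightarrow> ws \<in> tuples k m \<Longrightarrow>
   \<alpha> m V Q v ws = \<alpha> n U P (f v) (map (jacobian f v) ws)"
  unfolding diff_form_def by (drule conjunct2) blast

text \<open>An inclusion has identity Jacobian, so the value of a pulled back form at u depends only
  on the plot near u.\<close>

lemma diff_form_restrict:
  assumes "diff_form k X \<alpha>" "plot X n U P" "open_Rn n V" "V \<subseteq> U" "\<And>v. v \<in> V \<Longrightarrow> Q v = P v"
    and "u \<in> V" "vs \<in> tuples k n"
  shows "\<alpha> n V Q u vs = \<alpha> n U P u vs"
  using diff_form_comp[OF assms(1-3) smooth_map_incl[OF assms(3,4)] assms(5-7)]
  by (simp add: jacobian_ident cong: map_cong)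

lemma manifold_diffeological: "manifold n X \<Longrightarrow> diffeological_space X"
  by (simp add: manifold_def)

lemma chart_at:
  assumes "manifold d X" "x \<in> carrier X"
  obtains n U F where "chart_at X x = (n, U, F)" "chart X n U F" "x \<in> F ` U"
proof -
  obtain U F where "chart X d U F \<and> x \<in> F ` U"
    using assms unfolding manifold_def by blast
  then have "case (d, U, F) of (n, U, F) \<Rightarrow> chart X n U F \<and> x \<in> F ` U" by simp
  then have "case chart_at X x of (n, U, F) \<Rightarrow> chart X n U F \<and> x \<in> F ` U"
    unfolding chart_at_def by (rule someI)
  then show thesis using that by (auto split: prod.splits)
qed

text \<open>In the chart used by \<open>form_at\<close>, P is F composed with its coordinate
  expression \<iota>, so compatibility of the form evaluates it on the Jacobian of \<iota>. The
  entries of this Jacobian are derivatives of chart coordinates along lines, that is, the chart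
  components of the velocities of P.\<close>

lemma form_at_plot:
  assumes X: "manifold d X" and \<alpha>: "diff_form k X \<alpha>" and P: "plot X n U P" and u: "u \<in> U" and vs: "vs \<in> tuples k n"
  shows "form_at X \<alpha> (P u) (map (dir_velocity X P u) vs) = \<alpha> n U P u vs"
proof -
  note DX = manifold_diffeological[OF X]
  obtain m V F where F: "chart_at X (P u) = (m, V, F)" "chart X m V F" "P u \<in> F ` V"
    using chart_at[OF X plot_carrier[OF DX P u]] .
  define \<iota> where "\<iota> w = inv_into V F (P w)" for w
  define W where "W = {w \<in> U. P w \<in> F ` V}"
  have W: "open_Rn n W"
    unfolding W_def by (rule D_open_plot[OF chart_D_open[OF F(2)] P])
  have uW: "u \<in> W" using u F(3) by (simp add: W_def)
  have "plot X n W P"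
    by (rule plot_restrict[OF DX P W]) (auto simp: W_def)
  then have \<iota>: "smooth_map n W m V \<iota>"
    unfolding \<iota>_def by (rule chart_smooth[OF F(2)]) (simp add: W_def)
  have VR: "V \<subseteq> Rn m"
    by (rule open_Rn_subset[OF plot_openD[OF DX chart_plot[OF F(2)]]])
  have "\<alpha> n U P u vs = \<alpha> n W P u vs"
    by (rule diff_form_restrict[OF \<alpha> P W _ _ uW vs, symmetric]) (auto simp: W_def)
  also have "\<dots> = \<alpha> m V F (\<iota> u) (map (jacobian \<iota> u) vs)"
    by (rule diff_form_comp[OF \<alpha> chart_plot[OF F(2)] W \<iota> _ uW vs])
      (simp add: W_def \<iota>_def f_inv_into_f)
  also have "map (jacobian \<iota> u) vs = map (chart_components m V F) (map (dir_velocity X P u) vs)"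
  proof -
    have "jacobian \<iota> u v = chart_components m V F (dir_velocity X P u v)" if v: "v \<in> Rn n" for v
    proof
      fix j
      show "jacobian \<iota> u v j = chart_components m V F (dir_velocity X P u v) j"
      proof (cases "j < m")
        case True
        then show ?thesis
          using chart_coord_smooth_near[OF F(2,3) True]
          by (simp add: jacobian_def dir_deriv_def chart_components_def dir_velocity_def velocity_def \<iota>_def)
      next
        case False
        then show ?thesis
          using jacobian_Rn[OF \<iota> W VR uW v] by (simp add: chart_components_def Rn_iff)
      qed
    qed
    then show ?thesis using vs by (auto simp: tuples_def)
  qed
  finally show ?thesis by (simp add: form_at_def F(1) \<iota>_def)
qed

section \<open>Algebra of forms at a point\<close>

lemma chart_components_add:
  "chart_components n U F (\<lambda>f. v f + w f) =
   (\<lambda>i. 1 * chart_components n U F v i + 1 * chart_components n U F w i)"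
  by (auto simp: chart_components_def)

lemma chart_components_Rn: "chart_components n U F v \<in> Rn n"
  by (simp add: chart_components_def Rn_iff)

text \<open>Hides the chosen chart: what remains is an ordinary form at one point, evaluated through
  an additive map into R^n.\<close>

lemma form_at_chart:
  assumes X: "manifold d X" and \<alpha>: "diff_form k X \<alpha>" and x: "x \<in> carrier X"
  obtains n U \<beta> u comps where "ordinary_form k n U \<beta>" "u \<in> U" "\<And>v. comps v \<in> Rn n"
    "\<And>v w. comps (\<lambda>f. v f + w f) = (\<lambda>i. 1 * comps v i + 1 * comps w i)"
    "\<And>vs. form_at X \<alpha> x vs = \<beta> u (map comps vs)"
proof -
  obtain n U F where F: "chart_at X x = (n, U, F)" "chart X n U F" "x \<in> F ` U"
    using chart_at[OF X x] .
  show thesis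
    by (rule that[of n U "\<alpha> n U F" "inv_into U F x" "chart_components n U F"])
      (use F in \<open>auto simp: form_at_def chart_components_add chart_components_Rn inv_into_into
        intro: diff_form_ordinary[OF \<alpha> chart_plot]\<close>)
qed

text \<open>The factors 1 are kept so that the vector has the shape found in
  \<open>ordinary_form\<close> and \<open>chart_components_add\<close>.\<close>

lemma ordinary_form_add:
  assumes "ordinary_form k n U \<beta>" "u \<in> U" "vs \<in> tuples k n" "i < k" "v \<in> Rn n" "w \<in> Rn n"
  shows "\<beta> u (vs[i := (\<lambda>j. 1 * v j + 1 * w j)]) = \<beta> u (vs[i := v]) + \<beta> u (vs[i := w])"
proof -
  have "\<beta> u (vs[i := (\<lambda>j. 1 * v j + 1 * w j)]) = 1 * \<beta> u (vs[i := v]) + 1 * \<beta> u (vs[i := w])"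
    using assms unfolding ordinary_form_def by blast
  then show ?thesis by simp
qed

lemma form1_add:
  assumes "manifold d X" "diff_form 1 X \<alpha>" "x \<in> carrier X"
  shows "form_at X \<alpha> x [\<lambda>f. v f + w f] = form_at X \<alpha> x [v] + form_at X \<alpha> x [w]"
proof (rule form_at_chart[OF assms])
  fix n U \<beta> u comps
  assume c: "ordinary_form 1 n U \<beta>" "u \<in> U" "\<And>v. comps v \<in> Rn n"
    "\<And>v w. comps (\<lambda>f. v f + w f) = (\<lambda>i. 1 * comps v i + 1 * comps w i)"
    "\<And>vs. form_at X \<alpha> x vs = \<beta> u (map comps vs)"
  show ?thesis
    unfolding c(5) list.map c(4)
    using ordinary_form_add[OF c(1,2) _ _ c(3)[of v] c(3)[of w], of "[comps v]" 0] c(3)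
    by (simp add: tuples_def)
qed

lemma form2_add_left:
  assumes "manifold d X" "diff_form 2 X \<alpha>" "x \<in> carrier X"
  shows "form_at X \<alpha> x [\<lambda>f. v f + v' f, w] = form_at X \<alpha> x [v, w] + form_at X \<alpha> x [v', w]"
proof (rule form_at_chart[OF assms])
  fix n U \<beta> u comps
  assume c: "ordinary_form 2 n U \<beta>" "u \<in> U" "\<And>v. comps v \<in> Rn n"
    "\<And>v w. comps (\<lambda>f. v f + w f) = (\<lambda>i. 1 * comps v i + 1 * comps w i)"
    "\<And>vs. form_at X \<alpha> x vs = \<beta> u (map comps vs)"
  show ?thesis
    unfolding c(5) list.map c(4)
    using ordinary_form_add[OF c(1,2) _ _ c(3)[of v] c(3)[of v'], of "[comps v, comps w]" 0] c(3)
    by (simp add: tuples_def)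
qed

text \<open>Polarization: expand the value at (a + b, a + b), which vanishes because the form is
  alternating.\<close>

lemma form2_antisym:
  assumes "manifold d X" "diff_form 2 X \<alpha>" "x \<in> carrier X"
  shows "form_at X \<alpha> x [v, w] = - form_at X \<alpha> x [w, v]"
proof (rule form_at_chart[OF assms])
  fix n U \<beta> u comps
  assume c: "ordinary_form 2 n U \<beta>" "u \<in> U" "\<And>v. comps v \<in> Rn n"
    "\<And>v w. comps (\<lambda>f. v f + w f) = (\<lambda>i. 1 * comps v i + 1 * comps w i)"
    "\<And>vs. form_at X \<alpha> x vs = \<beta> u (map comps vs)"
  have alt: "\<beta> u [a, a] = 0" if "a \<in> Rn n" for a
  proof -
    have "[a, a] \<in> tuples 2 n" "\<not> distinct [a, a]" using that by (auto simp: tuples_def)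
    then show ?thesis using c(1,2) unfolding ordinary_form_def by blast
  qed
  define a b where "a = comps v" "b = comps w"
  have ab: "a \<in> Rn n" "b \<in> Rn n" using c(3) by (auto simp: a_b_def)
  define s where "s = (\<lambda>j. 1 * a j + 1 * b j)"
  have s: "s \<in> Rn n" using ab by (auto simp: s_def Rn_iff)
  have "\<beta> u [s, s] = \<beta> u [a, s] + \<beta> u [b, s]"
    using ordinary_form_add[OF c(1,2) _ _ ab, of "[a, s]" 0] ab s by (simp add: tuples_def s_def)
  also have "\<beta> u [a, s] = \<beta> u [a, a] + \<beta> u [a, b]"
    using ordinary_form_add[OF c(1,2) _ _ ab, of "[a, s]" 1] ab s by (simp add: tuples_def s_def)
  also have "\<beta> u [b, s] = \<beta> u [b, a] + \<beta> u [b, b]"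
    using ordinary_form_add[OF c(1,2) _ _ ab, of "[b, s]" 1] ab s by (simp add: tuples_def s_def)
  finally show ?thesis
    using alt ab s by (simp add: c(5) a_b_def)
qed

section \<open>Descent of forms to a quotient\<close>

lemma tuples_jacobian:
  assumes "smooth_map m V n U f" "open_Rn m V" "U \<subseteq> Rn n" "v \<in> V" "ws \<in> tuples k m"
  shows "map (jacobian f v) ws \<in> tuples k n"
  using jacobian_Rn[OF assms(1-4)] assms(5) by (auto simp: tuples_def)

lemma tuples_update: "vs \<in> tuples k n \<Longrightarrow> v \<in> Rn n \<Longrightarrow> vs[i := v] \<in> tuples k n"
  using set_update_subset_insert[of vs i v] by (auto simp: tuples_def)

text \<open>A plot of the quotient lifts locally, and the descended form is the original one on a
  lift. The hypothesis \<open>same\<close>, applied on the intersection of two domains, shows that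
  the lift does not matter.\<close>

lemma form_descends:
  assumes X: "diffeological_space X" and \<alpha>: "diff_form k X \<alpha>"
    and same: "\<And>n V P Q u vs. plot (sub_diff X C) n V P \<Longrightarrow> plot (sub_diff X C) n V Q \<Longrightarrow>
      (\<And>v. v \<in> V \<Longrightarrow> R `` {P v} = R `` {Q v}) \<Longrightarrow> u \<in> V \<Longrightarrow> vs \<in> tuples k n \<Longrightarrow>
      \<alpha> n V P u vs = \<alpha> n V Q u vs"
  shows "\<exists>\<beta>. diff_form k (quot_diff (sub_diff X C) R) \<beta> \<and>
    form_eq k (sub_diff X C) (pullback id \<alpha>) (pullback (\<lambda>x. R `` {x}) \<beta>)"
proof -
  define lift where "lift n U p u VQ \<longleftrightarrow> u \<in> fst VQ \<and> fst VQ \<subseteq> U \<and>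
    plot (sub_diff X C) n (fst VQ) (snd VQ) \<and> (\<forall>v\<in>fst VQ. p v = R `` {snd VQ v})" for n U p u VQ
  \<comment> \<open>The lift is chosen anew at every point u, so smoothness in u has to come from
    independence of the choice.\<close>
  define \<beta> where "\<beta> n U p u vs = (let VQ = SOME VQ. lift n U p u VQ in \<alpha> n (fst VQ) (snd VQ) u vs)" for n U p u vs
  have \<beta>: "\<beta> n U p u vs = \<alpha> n V Q u vs" if VQ: "lift n U p u (V, Q)" and vs: "vs \<in> tuples k n" for n U p u vs V Q
  proof -
    obtain V' Q' where VQ': "(SOME VQ. lift n U p u VQ) = (V', Q')" by (cases "SOME VQ. lift n U p u VQ")
    then have l': "lift n U p u (V', Q')" using someI[of "lift n U p u", OF VQ] by simp
    have P: "plot X n V Q" "plot X n V' Q'" "Q ` V \<subseteq> C" "Q' ` V' \<subseteq> C"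
      using VQ l' by (auto simp: lift_def plot_sub_diff)
    have o: "open_Rn n (V \<inter> V')"
      using plot_openD[OF X P(1)] plot_openD[OF X P(2)] by (rule openin_Int)
    have u: "u \<in> V \<inter> V'" using VQ l' by (auto simp: lift_def)
    have "plot X n (V \<inter> V') Q" "plot X n (V \<inter> V') Q'"
      by (rule plot_restrict[OF X P(1) o], auto) (rule plot_restrict[OF X P(2) o], auto)
    then have "plot (sub_diff X C) n (V \<inter> V') Q" "plot (sub_diff X C) n (V \<inter> V') Q'"
      using P(3,4) by (auto simp: plot_sub_diff)
    moreover have "R `` {Q v} = R `` {Q' v}" if "v \<in> V \<inter> V'" for v
      using VQ l' that unfolding lift_def by (metis IntD1 IntD2 fst_conv snd_conv)
    ultimately have "\<alpha> n (V \<inter> V') Q u vs = \<alpha> n (V \<inter> V') Q' u vs"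
      using u vs by (rule same)
    moreover have "\<alpha> n (V \<inter> V') Q u vs = \<alpha> n V Q u vs"
      by (rule diff_form_restrict[OF \<alpha> P(1) o _ _ u vs]) auto
    moreover have "\<alpha> n (V \<inter> V') Q' u vs = \<alpha> n V' Q' u vs"
      by (rule diff_form_restrict[OF \<alpha> P(2) o _ _ u vs]) auto
    ultimately show ?thesis by (simp add: \<beta>_def VQ')
  qed
  have lift_ex: "\<exists>V Q. lift n U p u (V, Q)" if "plot (quot_diff (sub_diff X C) R) n U p" "u \<in> U" for n U p u
    using that by (auto simp: quot_diff_def lift_def)
  have "diff_form k (quot_diff (sub_diff X C) R) \<beta>"
    unfolding diff_form_def
  proof (intro conjI allI impI ballI)
    fix n U p assume p: "plot (quot_diff (sub_diff X C) R) n U p"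
    then have U: "open_Rn n U" by (simp add: quot_diff_def)
    show "ordinary_form k n U (\<beta> n U p)"
      unfolding ordinary_form_def
    proof (intro conjI ballI)
      fix vs assume vs: "vs \<in> tuples k n"
      show "smooth_fun n U (\<lambda>u. \<beta> n U p u vs)"
      proof (rule smooth_fun_local[OF U])
        fix u assume "u \<in> U"
        from lift_ex[OF p this] obtain V Q where VQ: "lift n U p u (V, Q)" by blast
        then have Q: "plot X n V Q" by (simp add: lift_def plot_sub_diff)
        have V: "open_Rn n V" by (rule plot_openD[OF X Q])
        have "smooth_fun n V (\<lambda>u. \<alpha> n V Q u vs)"
          using diff_form_ordinary[OF \<alpha> Q] vs unfolding ordinary_form_def by blast
        \<comment> \<open>One lift serves all points of V, so on V the descended form is the smooth
          function given by this single lift.\<close>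
        moreover have "\<alpha> n V Q v vs = \<beta> n U p v vs" if "v \<in> V" for v
          using VQ that vs by (intro \<beta>[symmetric]) (auto simp: lift_def)
        ultimately have "smooth_fun n V (\<lambda>u. \<beta> n U p u vs)"
          using smooth_fun_cong[OF V, of "\<lambda>u. \<alpha> n V Q u vs" "\<lambda>u. \<beta> n U p u vs"] by simp
        then show "\<exists>V. open_Rn n V \<and> u \<in> V \<and> V \<subseteq> U \<and> smooth_fun n V (\<lambda>u. \<beta> n U p u vs)"
          using V VQ by (intro exI[of _ V]) (simp add: lift_def)
      qed
    next
      fix u vs assume u: "u \<in> U" and vs: "vs \<in> tuples k n"
      from lift_ex[OF p u] obtain V Q where VQ: "lift n U p u (V, Q)" by blast
      then have Q: "plot X n V Q" "u \<in> V" by (simp_all add: lift_def plot_sub_diff)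
      note of = diff_form_ordinary[OF \<alpha> Q(1)]
      show "\<not> distinct vs \<longrightarrow> \<beta> n U p u vs = 0"
        using of Q(2) vs \<beta>[OF VQ vs] unfolding ordinary_form_def by metis
      show "\<forall>i<k. \<forall>v\<in>Rn n. \<forall>w\<in>Rn n. \<forall>a b. \<beta> n U p u (vs[i := \<lambda>j. a * v j + b * w j]) =
          a * \<beta> n U p u (vs[i := v]) + b * \<beta> n U p u (vs[i := w])"
      proof (intro allI impI ballI)
        fix i v w a b assume i: "i < k" and v: "v \<in> Rn n" and w: "w \<in> Rn n"
        have "(\<lambda>j. a * v j + b * w j) \<in> Rn n" using v w by (simp add: Rn_iff)
        then have "\<beta> n U p u (vs[i := \<lambda>j. a * v j + b * w j]) = \<alpha> n V Q u (vs[i := \<lambda>j. a * v j + b * w j])"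
          by (intro \<beta>[OF VQ] tuples_update vs)
        also have "\<dots> = a * \<alpha> n V Q u (vs[i := v]) + b * \<alpha> n V Q u (vs[i := w])"
          using of Q(2) vs i v w unfolding ordinary_form_def by blast
        also have "\<alpha> n V Q u (vs[i := v]) = \<beta> n U p u (vs[i := v])"
          by (intro \<beta>[OF VQ, symmetric] tuples_update vs v)
        also have "\<alpha> n V Q u (vs[i := w]) = \<beta> n U p u (vs[i := w])"
          by (intro \<beta>[OF VQ, symmetric] tuples_update vs w)
        finally show "\<beta> n U p u (vs[i := \<lambda>j. a * v j + b * w j]) =
          a * \<beta> n U p u (vs[i := v]) + b * \<beta> n U p u (vs[i := w])" .
      qed
    qed
  next
    fix n U p m V f q v ws
    assume *: "plot (quot_diff (sub_diff X C) R) n U p \<and> open_Rn m V \<and> smooth_map m V n U f \<and>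
        (\<forall>v\<in>V. q v = p (f v))" and v: "v \<in> V" and ws: "ws \<in> tuples k m"
    then have p: "plot (quot_diff (sub_diff X C) R) n U p" and V: "open_Rn m V" and f: "smooth_map m V n U f"
      and q: "\<And>v. v \<in> V \<Longrightarrow> q v = p (f v)" by auto
    have U: "U \<subseteq> Rn n" using p open_Rn_subset by (auto simp: quot_diff_def)
    have "f v \<in> U" using f v by (auto simp: smooth_map_def)
    from lift_ex[OF p this] obtain U' Q where UQ: "lift n U p (f v) (U', Q)" by blast
    then have Q: "plot X n U' Q" "Q ` U' \<subseteq> C" "f v \<in> U'" "U' \<subseteq> U" "\<And>u. u \<in> U' \<Longrightarrow> p u = R `` {Q u}"
      by (simp_all add: lift_def plot_sub_diff)
    \<comment> \<open>A lift of \<open>p\<close> near \<open>f v\<close>, composed with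
      \<open>f\<close>, is a lift of \<open>q\<close> near \<open>v\<close>; compatibility is thus
      inherited from \<alpha>.\<close>
    define V' where "V' = {v \<in> V. f v \<in> U'}"
    have V': "open_Rn m V'"
      unfolding V'_def by (rule open_Rn_vimage[OF f V U plot_openD[OF X Q(1)]])
    have f': "smooth_map m V' n U' f"
      by (rule smooth_map_mono[OF f]) (auto simp: V'_def)
    have "plot X m V' (\<lambda>v. Q (f v))"
      by (rule plot_comp[OF X Q(1) V' f']) simp
    then have "lift m V q v (V', \<lambda>v. Q (f v))"
      using v Q q by (auto simp: lift_def plot_sub_diff V'_def)
    then have "\<beta> m V q v ws = \<alpha> m V' (\<lambda>v. Q (f v)) v ws"
      using ws by (rule \<beta>)
    also have "\<dots> = \<alpha> n U' Q (f v) (map (jacobian f v) ws)"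
      by (rule diff_form_comp[OF \<alpha> Q(1) V' f' _ _ ws]) (use v Q(3) in \<open>auto simp: V'_def\<close>)
    also have "\<dots> = \<beta> n U p (f v) (map (jacobian f v) ws)"
      by (rule \<beta>[OF UQ, symmetric]) (rule tuples_jacobian[OF f V U v ws])
    finally show "\<beta> m V q v ws = \<beta> n U p (f v) (map (jacobian f v) ws)" .
  qed
  \<comment> \<open>A plot P is itself a lift of its projection.\<close>
  moreover have "form_eq k (sub_diff X C) (pullback id \<alpha>) (pullback (\<lambda>x. R `` {x}) \<beta>)"
    unfolding form_eq_def pullback_def id_apply
  proof (intro allI impI ballI)
    fix n U P u vs assume "plot (sub_diff X C) n U P" "u \<in> U" "vs \<in> tuples k n"
    then show "\<alpha> n U P u vs = \<beta> n U (\<lambda>u. R `` {P u}) u vs"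
      by (intro \<beta>[symmetric]) (auto simp: lift_def)
  qed
  ultimately show ?thesis by blast
qed


section \<open>Strict actions\<close>

context
  fixes DG :: "'g diffspace" and C :: "'x diffspace" and \<phi> :: "'g \<Rightarrow> 'x \<Rightarrow> 'x"
  assumes strict: "strict_action DG C \<phi>"
begin

definition \<theta> :: "'g \<times> 'x \<Rightarrow> 'x \<times> 'x" where
  "\<theta> = (\<lambda>(g, x). (x, \<phi> g x))"

definition kernel_rel :: "(('g \<times> 'x) \<times> ('g \<times> 'x)) set" where
  "kernel_rel = {(p, q). p \<in> carrier (prod_diff DG C) \<and> q \<in> carrier (prod_diff DG C) \<and> \<theta> p = \<theta> q}"

lemma strict_diffeo:
  "diffeomorphism (quot_diff (prod_diff DG C) kernel_rel)
     (sub_diff (prod_diff C C) (\<theta> ` carrier (prod_diff DG C))) (\<lambda>A. the_elem (\<theta> ` A))"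
  using strict unfolding strict_action_def Let_def \<theta>_def kernel_rel_def .

lemma the_elem_kernel_class:
  assumes "p \<in> carrier (prod_diff DG C)"
  shows "the_elem (\<theta> ` (kernel_rel `` {p})) = \<theta> p"
proof -
  have "\<theta> ` (kernel_rel `` {p}) = {\<theta> p}"
    using assms by (auto simp: kernel_rel_def)
  then show ?thesis by simp
qed

text \<open>The induced bijection has target \<open>\<theta>(G \<times> C) \<inter> (C \<times> C)\<close>, hence strictness includes the
  invariance of \<open>C\<close>.\<close>

lemma strict_action_closed:
  assumes "g \<in> carrier DG" "x \<in> carrier C"
  shows "\<phi> g x \<in> carrier C"
proof -
  have p: "(g, x) \<in> carrier (prod_diff DG C)"
    using assms by (simp add: prod_diff_def)
  then have "kernel_rel `` {(g, x)} \<in> carrier (quot_diff (prod_diff DG C) kernel_rel)"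
    by (auto simp: quot_diff_def quotientI)
  then have "the_elem (\<theta> ` (kernel_rel `` {(g, x)})) \<in>
      carrier (sub_diff (prod_diff C C) (\<theta> ` carrier (prod_diff DG C)))"
    using strict_diffeo unfolding diffeomorphism_def by (auto dest: bij_betwE)
  then have "\<theta> (g, x) \<in> carrier C \<times> carrier C"
    unfolding the_elem_kernel_class[OF p] by (simp add: sub_diff_def prod_diff_def)
  then show ?thesis by (simp add: \<theta>_def)
qed

text \<open>The pair (P, Q) is a plot of the image of \<theta>. The smooth inverse of the induced
  bijection sends it to a plot of the quotient, which lifts locally to a plot K of G \<times> C with
  \<theta>(K) = (P, Q); the first component of K is the required g.\<close>

lemma strict_action_lift:
  assumes P: "plot C n U P" "plot C n U Q" "\<And>u. u \<in> U \<Longrightarrow> P u \<in> carrier C"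
    and orb: "\<And>u. u \<in> U \<Longrightarrow> \<exists>g\<in>carrier DG. Q u = \<phi> g (P u)" and u: "u \<in> U"
    and DG: "diffeological_space DG" and C: "diffeological_space C"
  shows "\<exists>V g. u \<in> V \<and> V \<subseteq> U \<and> plot DG n V g \<and> (\<forall>v\<in>V. Q v = \<phi> (g v) (P v))"
proof -
  let ?q = "quot_diff (prod_diff DG C) kernel_rel"
  let ?s = "sub_diff (prod_diff C C) (\<theta> ` carrier (prod_diff DG C))"
  let ?h = "\<lambda>A. the_elem (\<theta> ` A)"
  have PQ: "(P v, Q v) \<in> \<theta> ` carrier (prod_diff DG C)" if v: "v \<in> U" for v
  proof -
    obtain g where "g \<in> carrier DG" "Q v = \<phi> g (P v)" using orb[OF v] by blast
    then show ?thesis using P(3)[OF v] by (auto simp: \<theta>_def prod_diff_def)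
  qed
  have bij: "bij_betw ?h (carrier ?q) (carrier ?s)" and inv: "dsmooth ?s ?q (inv_into (carrier ?q) ?h)"
    using strict_diffeo by (auto simp: diffeomorphism_def)
  have s: "plot ?s n U (\<lambda>v. (P v, Q v))"
    using P PQ by (auto simp: plot_sub_diff plot_prod_diff)
  from dsmooth_plot[OF inv this] u obtain V K where V: "u \<in> V" "V \<subseteq> U" "plot (prod_diff DG C) n V K"
    and K: "\<And>v. v \<in> V \<Longrightarrow> inv_into (carrier ?q) ?h (P v, Q v) = kernel_rel `` {K v}"
    by (force simp: quot_diff_def)
  have "\<theta> (K v) = (P v, Q v)" if v: "v \<in> V" for v
  proof -
    have "(P v, Q v) \<in> carrier ?s"
      using PQ[of v] P(3)[of v] plot_carrier[OF C P(2), of v] V(2) v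
      by (auto simp: sub_diff_def prod_diff_def)
    then have "?h (inv_into (carrier ?q) ?h (P v, Q v)) = (P v, Q v)"
      using bij by (metis bij_betw_inv_into_right)
    moreover have "K v \<in> carrier (prod_diff DG C)"
    proof -
      have "fst (K v) \<in> carrier DG" "snd (K v) \<in> carrier C"
        using V(3) plot_carrier[OF DG, of n V "\<lambda>u. fst (K u)"] plot_carrier[OF C, of n V "\<lambda>u. snd (K u)"] v
        by (auto simp: plot_prod_diff)
      then show ?thesis by (simp add: prod_diff_def mem_Times_iff)
    qed
    ultimately show ?thesis using K[OF v] the_elem_kernel_class by simp
  qed
  then have "Q v = \<phi> (fst (K v)) (P v)" if "v \<in> V" for v
    using that by (force simp: \<theta>_def split_beta)
  then show ?thesis
    using V by (intro exI[of _ V] exI[of _ "\<lambda>v. fst (K v)"]) (auto simp: plot_prod_diff)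
qed

end


section \<open>Velocities of moving orbits\<close>

context
  fixes G :: "('g, 'b) monoid_scheme" and DG :: "'g diffspace" and X :: "'x diffspace" and \<phi>
  assumes G: "lie_group G DG" and X: "diffeological_space X" and act: "smooth_action G DG X \<phi>"
begin

interpretation group G by (rule lie_group_facts[OF G])

lemma act_group_action: "group_action G (carrier X) \<phi>"
  using act by (simp add: smooth_action_def)

lemma act_one: "x \<in> carrier X \<Longrightarrow> \<phi> \<one>\<^bsub>G\<^esub> x = x"
  using group_action.id_eq_one[OF act_group_action] by (metis restrict_apply)

lemma act_mult: "g \<in> carrier G \<Longrightarrow> h \<in> carrier G \<Longrightarrow> x \<in> carrier X \<Longrightarrow> \<phi> (g \<otimes>\<^bsub>G\<^esub> h) x = \<phi> g (\<phi> h x)"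
  using group_action.composition_rule[OF act_group_action] by simp

lemma plot_act:
  assumes "plot DG n U g" "plot X n U P"
  shows "plot X n U (\<lambda>u. \<phi> (g u) (P u))"
  using dsmooth_plot[of "prod_diff DG X" X "\<lambda>(g, x). \<phi> g x" n U "\<lambda>u. (g u, P u)"] act assms
  by (simp add: smooth_action_def plot_prod_diff)

lemma dsmooth_act_left:
  assumes "x \<in> carrier X"
  shows "dsmooth DG X (\<lambda>g. \<phi> g x)"
  unfolding dsmooth_def
proof (intro conjI allI impI)
  show "(\<lambda>g. \<phi> g x) ` carrier DG \<subseteq> carrier X"
    using group_action.element_image[OF act_group_action] assms lie_group_facts(2)[OF G] by blast
  fix n U P assume P: "plot DG n U P"
  have "plot X n U (\<lambda>_. x)"
    by (rule plot_const[OF X plot_openD[OF lie_group_facts(3)[OF G] P] assms])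
  then show "plot X n U (\<lambda>u. \<phi> (P u) x)" by (rule plot_act[OF P])
qed

text \<open>The velocity of the orbit map along a curve depends only on the velocity of the curve at
  the unit, so the chosen exponential curve may be replaced by \<open>c\<close>.\<close>

lemma fundamental_field_velocity:
  assumes c: "smooth_germ DG c" "c 0 = \<one>\<^bsub>G\<^esub>" and x: "x \<in> carrier X"
  shows "fundamental_field G DG X \<phi> (velocity DG c) x = velocity X (\<lambda>t. \<phi> (c t) x)"
proof -
  define \<gamma> where "\<gamma> = exp_curve G DG (velocity DG c)"
  have \<gamma>: "one_param_subgroup G DG \<gamma>" "velocity DG \<gamma> = velocity DG c"
    unfolding \<gamma>_def by (rule exp_curve[OF G c])+
  have "line 0 \<in> Rn 1" by (rule line_Rn1)
  then have g0: "\<gamma> 0 \<in> carrier G"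
    using plot_carrier[OF lie_group_facts(3)[OF G], of 1 "Rn 1" "\<lambda>u. \<gamma> (u 0)" "line 0"] \<gamma>(1)
    by (simp add: one_param_subgroup_def lie_group_facts(2)[OF G])
  \<comment> \<open>An idempotent of a group is the unit.\<close>
  moreover have "\<gamma> 0 \<otimes>\<^bsub>G\<^esub> \<gamma> 0 = \<gamma> 0"
    using \<gamma>(1) unfolding one_param_subgroup_def by (metis add_0)
  ultimately have "\<gamma> 0 = \<one>\<^bsub>G\<^esub>" by (metis l_cancel_one one_closed)
  then show ?thesis
    unfolding fundamental_field_def \<gamma>_def[symmetric]
    using \<gamma>(2) c(2) g0 by (intro velocity_comp_cong[OF lie_group_facts(3)[OF G] dsmooth_act_left[OF x]])
      (auto simp: lie_group_facts(2)[OF G])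
qed

text \<open>A product rule: S below gives g and P separate times, and
  \<open>velocity_diagonal\<close> adds the two velocities. With P frozen the curve of g through the
  unit yields a fundamental vector; with g frozen at the unit only P moves.\<close>

lemma dir_velocity_act:
  assumes g: "plot DG n U g" "g u = \<one>\<^bsub>G\<^esub>" and P: "plot X n U P" and u: "u \<in> U" and v: "v \<in> Rn n"
  shows "dir_velocity X (\<lambda>u. \<phi> (g u) (P u)) u v =
    (\<lambda>f. fundamental_field G DG X \<phi> (dir_velocity DG g u v) (P u) f + dir_velocity X P u v f)"
proof
  fix f
  note DG = lie_group_facts(3)[OF G]
  have U: "open_Rn n U" by (rule plot_openD[OF X P])
  obtain r where r: "r > 0" "\<And>t. \<bar>t\<bar> < r \<Longrightarrow> (\<lambda>i. u i + t * v i) \<in> U"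
    using open_Rn_line[OF U u v] by blast
  define S where "S s t = \<phi> (g (\<lambda>i. u i + s * v i)) (P (\<lambda>i. u i + t * v i))" for s t
  have sm: "smooth_map 2 (cube 2 (\<lambda>_. 0) r) n U (\<lambda>w i. u i + w j * v i)" if "j < 2" for j
    unfolding smooth_map_def
  proof (intro conjI allI impI)
    show "(\<lambda>w i. u i + w j * v i) ` cube 2 (\<lambda>_. 0) r \<subseteq> U"
      using r(2) that by (auto simp: cube_def)
  qed (intro smooth_fun_affine smooth_fun_coord open_Rn_cube)
  have "plot DG 2 (cube 2 (\<lambda>_. 0) r) (\<lambda>w. g (\<lambda>i. u i + w 0 * v i))"
    by (rule plot_comp[OF DG g(1) open_Rn_cube sm[of 0]]) auto
  moreover have "plot X 2 (cube 2 (\<lambda>_. 0) r) (\<lambda>w. P (\<lambda>i. u i + w 1 * v i))"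
    by (rule plot_comp[OF X P open_Rn_cube sm[of 1]]) auto
  ultimately have "plot X 2 (cube 2 (\<lambda>_. 0) r) (\<lambda>w. S (w 0) (w 1))"
    unfolding S_def by (rule plot_act)
  from velocity_diagonal[OF X r(1) this, of f]
  have "dir_velocity X (\<lambda>u. \<phi> (g u) (P u)) u v f = velocity X (\<lambda>t. S t 0) f + velocity X (\<lambda>t. S 0 t) f"
    by (simp add: dir_velocity_def S_def)
  also have "velocity X (\<lambda>t. S t 0) = fundamental_field G DG X \<phi> (dir_velocity DG g u v) (P u)"
    unfolding dir_velocity_def S_def
    using fundamental_field_velocity[OF smooth_germ_line[OF DG g(1) u v] _ plot_carrier[OF X P u]] g(2)
    by simp
  also have "velocity X (\<lambda>t. S 0 t) = dir_velocity X P u v"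
    unfolding dir_velocity_def
  proof (rule velocity_cong_ev)
    show "\<forall>\<^sub>F t in nhds 0. S 0 t = P (\<lambda>i. u i + t * v i)"
      using eventually_open_Rn_line[OF U u v]
      by eventually_elim (use plot_carrier[OF X P] act_one g(2) in \<open>simp add: S_def\<close>)
  qed
  finally show "dir_velocity X (\<lambda>u. \<phi> (g u) (P u)) u v f =
    fundamental_field G DG X \<phi> (dir_velocity DG g u v) (P u) f + dir_velocity X P u v f" .
qed

lemma dir_velocity_lie_algebra:
  assumes "plot DG n U g" "g u = \<one>\<^bsub>G\<^esub>" "u \<in> U" "v \<in> Rn n"
  shows "dir_velocity DG g u v \<in> lie_algebra G DG"
  using velocity_tangent_space[OF lie_group_facts(3)[OF G] smooth_germ_line[OF lie_group_facts(3)[OF G] assms(1,3,4)]] assms(2)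
  by (simp add: dir_velocity_def lie_algebra_def)

text \<open>Common to both degrees: everything except the comparison at a point where g is the unit,
  which is left to \<open>key\<close>.\<close>

lemma carries_reduced_formI:
  assumes \<alpha>: "diff_form k X \<alpha>" and inv: "invariant_form k G X \<phi> \<alpha>"
    and strict: "strict_action DG (sub_diff X (zero_level G DG X \<Phi>)) \<phi>"
    and key: "\<And>n U P g u vs. plot X n U P \<Longrightarrow> plot DG n U g \<Longrightarrow> u \<in> U \<Longrightarrow> g u = \<one>\<^bsub>G\<^esub> \<Longrightarrow>
      (\<And>v. v \<in> U \<Longrightarrow> P v \<in> zero_level G DG X \<Phi>) \<Longrightarrow>
      (\<And>v. v \<in> U \<Longrightarrow> \<phi> (g v) (P v) \<in> zero_level G DG X \<Phi>) \<Longrightarrow> vs \<in> tuples k n \<Longrightarrow>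
      \<alpha> n U (\<lambda>u. \<phi> (g u) (P u)) u vs = \<alpha> n U P u vs"
  shows "carries_reduced_form k G DG X \<phi> \<Phi> \<alpha>"
  unfolding carries_reduced_form_def reduced_space_def
proof (rule form_descends[OF X \<alpha>])
  define C where "C = zero_level G DG X \<Phi>"
  note DG = lie_group_facts(3)[OF G] and carrier_DG = lie_group_facts(2)[OF G]
  have CX: "carrier (sub_diff X C) = C" by (auto simp: C_def zero_level_def sub_diff_def)
  fix n U P Q u vs
  assume P: "plot (sub_diff X (zero_level G DG X \<Phi>)) n U P" and Q: "plot (sub_diff X (zero_level G DG X \<Phi>)) n U Q"
    and orb: "\<And>v. v \<in> U \<Longrightarrow> orbit_rel G \<phi> (zero_level G DG X \<Phi>) `` {P v} = orbit_rel G \<phi> (zero_level G DG X \<Phi>) `` {Q v}"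
    and u: "u \<in> U" and vs: "vs \<in> tuples k n"
  have PC: "plot X n U P" "\<And>v. v \<in> U \<Longrightarrow> P v \<in> C" and QC: "plot X n U Q" "\<And>v. v \<in> U \<Longrightarrow> Q v \<in> C"
    using P Q by (auto simp: plot_sub_diff C_def)
  have inX: "x \<in> carrier X" if "x \<in> C" for x using that by (simp add: C_def zero_level_def)
  have "\<exists>g\<in>carrier DG. Q v = \<phi> g (P v)" if v: "v \<in> U" for v
  proof -
    \<comment> \<open>Only equality of the two classes is given. Through the unit,
      \<open>Q v\<close> lies in its own class, hence in that of \<open>P v\<close>.\<close>
    have "Q v \<in> orbit G \<phi> (Q v)"
      using act_one[OF inX[OF QC(2)[OF v]]] unfolding orbit_def by (metis (mono_tags, lifting) CollectI one_closed)
    then have "Q v \<in> orbit_rel G \<phi> C `` {Q v}"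
      using QC(2)[OF v] by (simp add: orbit_rel_def)
    then have "Q v \<in> orbit G \<phi> (P v)"
      using orb[OF v] by (auto simp: orbit_rel_def C_def)
    then show ?thesis by (auto simp: orbit_def carrier_DG)
  qed
  from strict_action_lift[OF strict P Q _ this u DG diffeological_sub_diff[OF X]] PC(2) CX
  obtain V g where V: "u \<in> V" "V \<subseteq> U" "plot DG n V g" "\<And>v. v \<in> V \<Longrightarrow> Q v = \<phi> (g v) (P v)"
    by (auto simp: C_def)
  have oV: "open_Rn n V" by (rule plot_openD[OF DG V(3)])
  have gG: "g v \<in> carrier G" if "v \<in> V" for v
    using plot_carrier[OF DG V(3) that] by (simp add: carrier_DG)
  \<comment> \<open>A fixed group element, constant in v, so invariance under the single map
    \<open>\<phi> h\<close> applies to the whole plot Q.\<close>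
  define h where "h = inv\<^bsub>G\<^esub> (g u)"
  have h: "h \<in> carrier G" "h \<otimes>\<^bsub>G\<^esub> g u = \<one>\<^bsub>G\<^esub>" using gG[OF V(1)] by (simp_all add: h_def)
  have PV: "plot X n V P" and QV: "plot X n V Q"
    using plot_restrict[OF X PC(1) oV V(2)] plot_restrict[OF X QC(1) oV V(2)] by simp_all
  have g': "plot DG n V (\<lambda>v. h \<otimes>\<^bsub>G\<^esub> g v)"
    by (rule dsmooth_plot[OF dsmooth_mult_left[OF G h(1)] V(3)])
  have hQ: "\<phi> (h \<otimes>\<^bsub>G\<^esub> g v) (P v) = \<phi> h (Q v)" if "v \<in> V" for v
    using V(2,4) that by (auto simp: act_mult[OF h(1) gG[OF that] inX[OF PC(2)]])
  have "\<alpha> n U Q u vs = \<alpha> n V Q u vs"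
    by (rule diff_form_restrict[OF \<alpha> QC(1) oV V(2) _ V(1) vs, symmetric]) simp
  also have "\<dots> = \<alpha> n V (\<lambda>v. \<phi> h (Q v)) u vs"
    using inv h(1) QV V(1) vs unfolding invariant_form_def form_eq_def pullback_def by metis
  also have "\<dots> = \<alpha> n V (\<lambda>v. \<phi> (h \<otimes>\<^bsub>G\<^esub> g v) (P v)) u vs"
    by (rule diff_form_restrict[OF \<alpha> plot_act[OF g' PV] oV order_refl _ V(1) vs]) (simp add: hQ)
  also have "\<dots> = \<alpha> n V P u vs"
  proof (rule key[OF PV g' V(1) h(2) _ _ vs])
    show "P v \<in> zero_level G DG X \<Phi>" if "v \<in> V" for v
      using PC(2) V(2) that by (auto simp: C_def)
    show "\<phi> (h \<otimes>\<^bsub>G\<^esub> g v) (P v) \<in> zero_level G DG X \<Phi>" if "v \<in> V" for v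
      using strict_action_closed[OF strict, of h "Q v"] QC(2)[of v] V(2) that h(1) carrier_DG CX hQ[OF that]
      by (auto simp: C_def)
  qed
  also have "\<dots> = \<alpha> n U P u vs"
    by (rule diff_form_restrict[OF \<alpha> PC(1) oV V(2) _ V(1) vs]) simp
  finally show "\<alpha> n U P u vs = \<alpha> n U Q u vs" by simp
qed

end

section \<open>Reduced forms\<close>

lemma hamiltonian_reduced_form:
  assumes G: "lie_group G DG" and H: "hamiltonian_space G DG X \<phi> \<omega> \<Phi>"
    and strict: "strict_action DG (sub_diff X (zero_level G DG X \<Phi>)) \<phi>"
  shows "carries_reduced_form 2 G DG X \<phi> \<Phi> \<omega>"
proof -
  obtain d where X: "manifold d X" using H by (auto simp: hamiltonian_space_def)
  note DX = manifold_diffeological[OF X]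
  have act: "smooth_action G DG X \<phi>" and \<omega>: "diff_form 2 X \<omega>" and inv: "invariant_form 2 G X \<phi> \<omega>"
    and mom: "\<And>Z x v. Z \<in> lie_algebra G DG \<Longrightarrow> x \<in> carrier X \<Longrightarrow> v \<in> tangent_space X x \<Longrightarrow>
      form_at X \<omega> x [fundamental_field G DG X \<phi> Z x, v] = - v (\<lambda>y. \<Phi> y Z)"
    using H by (auto simp: hamiltonian_space_def symplectic_form_def moment_map_def)
  show ?thesis
  proof (rule carries_reduced_formI[OF G DX act \<omega> inv strict])
    fix n U P g u vs
    assume P: "plot X n U P" and g: "plot DG n U g" and u: "u \<in> U" and gu: "g u = \<one>\<^bsub>G\<^esub>"
      and PC: "\<And>v. v \<in> U \<Longrightarrow> P v \<in> zero_level G DG X \<Phi>"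
      and QC: "\<And>v. v \<in> U \<Longrightarrow> \<phi> (g v) (P v) \<in> zero_level G DG X \<Phi>" and vs: "vs \<in> tuples 2 n"
    define Q where "Q = (\<lambda>u. \<phi> (g u) (P u))"
    have Q: "plot X n U Q" unfolding Q_def by (rule plot_act[OF G DX act g P])
    obtain v w where vw: "vs = [v, w]" "v \<in> Rn n" "w \<in> Rn n"
      using vs by (auto simp: tuples_def numeral_2_eq_2 length_Suc_conv)
    have Pu: "P u \<in> carrier X" by (rule plot_carrier[OF DX P u])
    have Qu: "Q u = P u" using act_one[OF G DX act Pu] by (simp add: Q_def gu)
    define \<zeta> where "\<zeta> v = fundamental_field G DG X \<phi> (dir_velocity DG g u v) (P u)" for v
    have dQ: "dir_velocity X Q u v = (\<lambda>f. \<zeta> v f + dir_velocity X P u v f)" if "v \<in> Rn n" for v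
      unfolding Q_def \<zeta>_def by (rule dir_velocity_act[OF G DX act g gu P u that])
    \<comment> \<open>R will be Q once and P once. Both pass through \<open>P u\<close> and stay in
      the zero level, where the component of \<Phi> along the Lie algebra element is constantly
      0.\<close>
    have zero: "form_at X \<omega> (P u) [\<zeta> v, dir_velocity X R u w] = 0"
      if R: "plot X n U R" "R u = P u" "\<And>w. w \<in> U \<Longrightarrow> R w \<in> zero_level G DG X \<Phi>"
        and v: "v \<in> Rn n" and w: "w \<in> Rn n" for v w R
    proof -
      have Z: "dir_velocity DG g u v \<in> lie_algebra G DG"
        by (rule dir_velocity_lie_algebra[OF G DX act g gu u v])
      have "dir_velocity X R u w \<in> tangent_space X (P u)"
        using velocity_tangent_space[OF DX smooth_germ_line[OF DX R(1) u w]] R(2) by (simp add: dir_velocity_def)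
      then have "form_at X \<omega> (P u) [\<zeta> v, dir_velocity X R u w] =
          - dir_velocity X R u w (\<lambda>y. \<Phi> y (dir_velocity DG g u v))"
        unfolding \<zeta>_def by (rule mom[OF Z Pu])
      also have "\<dots> = 0"
        using dir_velocity_vanish[OF DX R(1) u w, of "\<lambda>y. \<Phi> y (dir_velocity DG g u v)"] R(3) Z
        by (simp add: zero_level_def)
      finally show ?thesis .
    qed
    note add = form2_add_left[OF X \<omega> Pu] and antisym = form2_antisym[OF X \<omega> Pu]
    have "\<omega> n U Q u vs = form_at X \<omega> (Q u) (map (dir_velocity X Q u) vs)"
      by (rule form_at_plot[OF X \<omega> Q u vs, symmetric])
    also have "\<dots> = form_at X \<omega> (P u) [dir_velocity X Q u v, dir_velocity X Q u w]"
      by (simp add: Qu vw)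
    \<comment> \<open>Only the first argument is expanded. The second remains the velocity of Q, a
      curve in the level, so \<open>zero\<close> disposes of the term with two fundamental vectors
      as well.\<close>
    also have "\<dots> = form_at X \<omega> (P u) [\<zeta> v, dir_velocity X Q u w] + form_at X \<omega> (P u) [dir_velocity X P u v, dir_velocity X Q u w]"
      unfolding dQ[OF vw(2)] by (rule add)
    also have "form_at X \<omega> (P u) [\<zeta> v, dir_velocity X Q u w] = 0"
      by (rule zero[OF Q Qu _ vw(2,3)]) (simp add: Q_def QC)
    \<comment> \<open>The remaining expansion concerns the second argument; antisymmetry moves it to
      the first place, where additivity is available, and a second application below restores the
      order.\<close>
    also have "form_at X \<omega> (P u) [dir_velocity X P u v, dir_velocity X Q u w] =
        - (form_at X \<omega> (P u) [\<zeta> w, dir_velocity X P u v] + form_at X \<omega> (P u) [dir_velocity X P u w, dir_velocity X P u v])"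
      unfolding dQ[OF vw(3)] add[symmetric] by (rule antisym)
    also have "form_at X \<omega> (P u) [\<zeta> w, dir_velocity X P u v] = 0"
      by (rule zero[OF P refl PC vw(3,2)])
    also have "form_at X \<omega> (P u) [dir_velocity X P u w, dir_velocity X P u v] =
        - form_at X \<omega> (P u) [dir_velocity X P u v, dir_velocity X P u w]"
      by (rule antisym)
    finally have "\<omega> n U Q u vs = form_at X \<omega> (P u) (map (dir_velocity X P u) vs)"
      by (simp add: vw)
    also have "\<dots> = \<omega> n U P u vs"
      by (rule form_at_plot[OF X \<omega> P u vs])
    finally show "\<omega> n U (\<lambda>u. \<phi> (g u) (P u)) u vs = \<omega> n U P u vs"
      by (simp add: Q_def)
  qed
qed

text \<open>In degree 1 the single extra term is the form on a fundamental vector, which by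
  definition is the moment map at \<open>P u\<close>. Its value 0 at this point is enough, whereas
  degree 2 uses its derivative along the level.\<close>

lemma prequantum_reduced_form:
  assumes G: "lie_group G DG" and H: "prequantum_space G DG X \<phi> \<alpha>" and \<Phi>: "\<Phi> = prequantum_moment G DG X \<phi> \<alpha>"
    and strict: "strict_action DG (sub_diff X (zero_level G DG X \<Phi>)) \<phi>"
  shows "carries_reduced_form 1 G DG X \<phi> \<Phi> \<alpha>"
proof -
  obtain d where X: "manifold d X" using H by (auto simp: prequantum_space_def)
  note DX = manifold_diffeological[OF X]
  have act: "smooth_action G DG X \<phi>" and \<alpha>: "diff_form 1 X \<alpha>" and inv: "invariant_form 1 G X \<phi> \<alpha>"
    using H by (auto simp: prequantum_space_def contact_form_def)
  show ?thesis
  proof (rule carries_reduced_formI[OF G DX act \<alpha> inv strict])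
    fix n U P g u vs
    assume P: "plot X n U P" and g: "plot DG n U g" and u: "u \<in> U" and gu: "g u = \<one>\<^bsub>G\<^esub>"
      and PC: "\<And>v. v \<in> U \<Longrightarrow> P v \<in> zero_level G DG X \<Phi>" and vs: "vs \<in> tuples 1 n"
    define Q where "Q = (\<lambda>u. \<phi> (g u) (P u))"
    have Q: "plot X n U Q" unfolding Q_def by (rule plot_act[OF G DX act g P])
    obtain v where v: "vs = [v]" "v \<in> Rn n"
      using vs by (auto simp: tuples_def length_Suc_conv)
    have Pu: "P u \<in> carrier X" by (rule plot_carrier[OF DX P u])
    have Qu: "Q u = P u" using act_one[OF G DX act Pu] by (simp add: Q_def gu)
    have Z: "dir_velocity DG g u v \<in> lie_algebra G DG"
      by (rule dir_velocity_lie_algebra[OF G DX act g gu u v(2)])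
    have "\<alpha> n U Q u vs = form_at X \<alpha> (Q u) (map (dir_velocity X Q u) vs)"
      by (rule form_at_plot[OF X \<alpha> Q u vs, symmetric])
    also have "\<dots> = form_at X \<alpha> (P u) [dir_velocity X Q u v]"
      by (simp add: Qu v)
    also have "\<dots> = \<Phi> (P u) (dir_velocity DG g u v) + form_at X \<alpha> (P u) [dir_velocity X P u v]"
      unfolding Q_def dir_velocity_act[OF G DX act g gu P u v(2)] \<Phi> prequantum_moment_def
      by (rule form1_add[OF X \<alpha> Pu])
    also have "\<Phi> (P u) (dir_velocity DG g u v) = 0"
      using PC[OF u] Z by (simp add: zero_level_def)
    finally have "\<alpha> n U Q u vs = form_at X \<alpha> (P u) (map (dir_velocity X P u) vs)"
      by (simp add: v)
    also have "\<dots> = \<alpha> n U P u vs"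
      by (rule form_at_plot[OF X \<alpha> P u vs])
    finally show "\<alpha> n U (\<lambda>u. \<phi> (g u) (P u)) u vs = \<alpha> n U P u vs"
      by (simp add: Q_def)
  qed
qed

theorem theorem6p4:
  fixes G :: "('g, 'b) monoid_scheme" and DG :: "'g diffspace"
  assumes "lie_group G DG"
  shows "(\<forall>(X :: 'x diffspace) \<phi> \<omega> \<Phi>.
            hamiltonian_space G DG X \<phi> \<omega> \<Phi> \<and>
            strict_action DG (sub_diff X (zero_level G DG X \<Phi>)) \<phi> \<longrightarrow>
            carries_reduced_form 2 G DG X \<phi> \<Phi> \<omega>) \<and>
         (\<forall>(Y :: 'y diffspace) \<phi> \<alpha> \<Phi>.
            prequantum_space G DG Y \<phi> \<alpha> \<and>
            \<Phi> = prequantum_moment G DG Y \<phi> \<alpha> \<and>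
            strict_action DG (sub_diff Y (zero_level G DG Y \<Phi>)) \<phi> \<longrightarrow>
            carries_reduced_form 1 G DG Y \<phi> \<Phi> \<alpha>)"
  using hamiltonian_reduced_form[OF assms] prequantum_reduced_form[OF assms] by blast

end
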